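(* (i) Let $n$ be even, $n=2n'$. The generic $z$-classes are the $z$-classes of $n'$-rotatory elliptics, $(n'-1)$-rotatory hyperbolics, and $(n'-1)$-rotatory hyperbolic inversions, all with pairwise distinct rotation angles. (ii) Let $n$ be odd, $n=2n'+1$. The generic $z$-classes are the $z$-classes of $n'$-rotatory hyperbolics, $n'$-rotatory elliptic inversions, and $(n'-1)$-rotatory hyperbolic inversions, all with pairwise distinct rotation angles.
   Context: $\mathbb{V}$ is a real vector space of dimension $n+1$ with a quadratic form $Q$ of signature $(1,n)$ (one positive, $n$ negative), and $O(Q)$ is its full isometry group. The hyperboloid $\{v\in\mathbb{V}: Q(v)=1\}$ has two components; one of them is the model of the hyperbolic space $\mathbb{H}^n$. $I(Q)$ is the subgroup of $O(Q)$ preserving this component, and it is identified with the full isometry group $I(\mathbb{H}^n)$. Two elements of $I(Q)$ are $z$-equivalent if their centralizers in $I(Q)$ are conjugate in $I(Q)$; the equivalence classes are the $z$-classes of $I(Q)$. Each $z$-class is a manifold, and so each component has a well-defined dimension; a $z$-class is said to be generic if it has the maximum dimension ($=\dim I(Q)$). An element $T\in I(Q)$ is elliptic if it has an eigenvector $v$ with $Q(v)>0$, and hyperbolic if it has a real eigenvalue $r\ne\pm1$. For $T$ elliptic, the characteristic polynomial has the form $(x-1)^l(x+1)^m\prod_{j=1}^s(x^2-2a_jx+1)^{r_j}$, and for $T$ hyperbolic it has the form $(x-1)^l(x+1)^m(x-r)(x-r^{-1})\prod_{j=1}^s(x^2-2a_jx+1)^{r_j}$, with distinct real $a_j$, $|a_j|<1$.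 Put $k=\sum_j r_j+[\frac m2]$. Then $T$ is called a $k$-rotatory elliptic (resp. hyperbolic) if $m$ is even, and a $k$-rotatory elliptic (resp. hyperbolic) inversion if $m$ is odd. The roots of $x^2-2a_jx+1$ are $e^{\pm i\theta_j}$ with a unique $0<\theta_j<\pi$; $\theta_j$ is called a rotation angle of $T$, and it is repeated as many times as its multiplicity $r_j$.
   Formalization: "With pairwise distinct rotation angles" is read as: a k-rotatory element has exactly k distinct rotation angles in (0,π), so [m/2]=0. Otherwise a half turn of the hyperbolic plane (n=2, m=2) would be listed, though its z-class has dimension 2 < 3. *)

theory Defs
  imports
    "HOL-Analysis.Analysis"
    "HOL-Computational_Algebra.Computational_Algebra"
    "HOL-Computational_Algebra.Field_as_Ring"
begin

section \<open>Quadratic forms and their isometries\<close>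

text \<open>The vector space \<open>\<V>\<close> is \<open>real ^ 'n\<close> with an arbitrary quadratic form, and a linear map
  is given by its matrix, so that a set of linear maps carries the usual (Euclidean) topology.\<close>

definition quadratic_form :: "(real ^ 'n \<Rightarrow> real) \<Rightarrow> bool" where
  "quadratic_form Q \<longleftrightarrow> (\<exists>B. bilinear B \<and> (\<forall>x y. B x y = B y x) \<and> (\<forall>v. Q v = B v v))"

definition polar_form :: "(real ^ 'n \<Rightarrow> real) \<Rightarrow> real ^ 'n \<Rightarrow> real ^ 'n \<Rightarrow> real" where
  "polar_form Q x y = (Q (x + y) - Q x - Q y) / 2"

definition has_signature :: "(real ^ 'n \<Rightarrow> real) \<Rightarrow> nat \<Rightarrow> nat \<Rightarrow> bool" where
  "has_signature Q p q \<longleftrightarrow>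
     (\<exists>E. independent E \<and> span E = UNIV \<and> pairwise (\<lambda>u v. polar_form Q u v = 0) E \<and>
          card {v \<in> E. Q v > 0} = p \<and> card {v \<in> E. Q v < 0} = q)"

definition orthogonal_group :: "(real ^ 'n \<Rightarrow> real) \<Rightarrow> (real ^ 'n ^ 'n) set" where
  "orthogonal_group Q = {A. invertible A \<and> (\<forall>v. Q (A *v v) = Q v)}"

text \<open>\<open>H\<close> is the chosen component of the hyperboloid \<open>{v. Q v = 1}\<close>.\<close>

definition isometries :: "(real ^ 'n \<Rightarrow> real) \<Rightarrow> (real ^ 'n) set \<Rightarrow> (real ^ 'n ^ 'n) set" where
  "isometries Q H = {A \<in> orthogonal_group Q. (\<lambda>v. A *v v) ` H = H}"


section \<open>z-classes of a group of matrices\<close>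

definition centralizer :: "(real ^ 'n ^ 'n) set \<Rightarrow> real ^ 'n ^ 'n \<Rightarrow> (real ^ 'n ^ 'n) set" where
  "centralizer G T = {S \<in> G. S ** T = T ** S}"

definition z_equivalence :: "(real ^ 'n ^ 'n) set \<Rightarrow> ((real ^ 'n ^ 'n) \<times> (real ^ 'n ^ 'n)) set" where
  "z_equivalence G = {(S, T) \<in> G \<times> G.
     \<exists>g\<in>G. centralizer G T = (\<lambda>X. g ** X ** matrix_inv g) ` centralizer G S}"

definition z_class :: "(real ^ 'n ^ 'n) set \<Rightarrow> real ^ 'n ^ 'n \<Rightarrow> (real ^ 'n ^ 'n) set" where
  "z_class G T = z_equivalence G `` {T}"

definition z_classes :: "(real ^ 'n ^ 'n) set \<Rightarrow> (real ^ 'n ^ 'n) set set" where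
  "z_classes G = G // z_equivalence G"

definition manifold_of_dim :: "nat \<Rightarrow> 'a topology \<Rightarrow> bool" where
  "manifold_of_dim d X \<longleftrightarrow> Hausdorff_space X \<and> second_countable X \<and>
     (\<forall>x\<in>topspace X. \<exists>U V. openin X U \<and> x \<in> U \<and> openin (Euclidean_space d) V \<and>
        subtopology X U homeomorphic_space subtopology (Euclidean_space d) V)"

text \<open>All components of a z-class are required to have the same dimension \<open>d\<close>, which is then the
  dimension of the z-class; the topology is the one induced from the space of matrices.\<close>

definition generic_z_classes :: "(real ^ 'n ^ 'n) set \<Rightarrow> (real ^ 'n ^ 'n) set set" where
  "generic_z_classes G = {C \<in> z_classes G.
     \<exists>d. manifold_of_dim d (top_of_set C) \<and>
         (\<forall>C'\<in>z_classes G. \<forall>d'. manifold_of_dim d' (top_of_set C') \<longrightarrow> d' \<le> d)}"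


section \<open>Elliptic and hyperbolic isometries\<close>

definition charpoly :: "real ^ 'n ^ 'n \<Rightarrow> real poly" where
  "charpoly A = det (mat [:0, 1:] - map_matrix (\<lambda>a. [:a:]) A)"

definition elliptic :: "(real ^ 'n \<Rightarrow> real) \<Rightarrow> (real ^ 'n) set \<Rightarrow> real ^ 'n ^ 'n \<Rightarrow> bool" where
  "elliptic Q H T \<longleftrightarrow> T \<in> isometries Q H \<and> (\<exists>v c. Q v > 0 \<and> T *v v = c *\<^sub>R v)"

definition hyperbolic :: "(real ^ 'n \<Rightarrow> real) \<Rightarrow> (real ^ 'n) set \<Rightarrow> real ^ 'n ^ 'n \<Rightarrow> bool" where
  "hyperbolic Q H T \<longleftrightarrow> T \<in> isometries Q H \<and>
     (\<exists>v r. v \<noteq> 0 \<and> r \<noteq> 1 \<and> r \<noteq> -1 \<and> T *v v = r *\<^sub>R v)"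

text \<open>The following three definitions read off the data of the factorization
  \<open>(x - 1)\<^sup>l (x + 1)\<^sup>m \<Prod>\<^sub>j (x\<^sup>2 - 2 a\<^sub>j x + 1)\<^bsup>r\<^sub>j\<^esup>\<close> (with the additional factor
  \<open>(x - r) (x - r\<^sup>-\<^sup>1)\<close> in the hyperbolic case) of the characteristic polynomial,
  where \<open>a\<^sub>j = cos \<theta>\<^sub>j\<close> with \<open>0 < \<theta>\<^sub>j < \<pi>\<close>.\<close>

definition minus_one_mult :: "real ^ 'n ^ 'n \<Rightarrow> nat" where
  "minus_one_mult T = order (-1) (charpoly T)"

definition rotation_angles :: "real ^ 'n ^ 'n \<Rightarrow> real set" where
  "rotation_angles T = {\<theta>. 0 < \<theta> \<and> \<theta> < pi \<and> [:1, - 2 * cos \<theta>, 1:] dvd charpoly T}"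

definition angle_mult :: "real ^ 'n ^ 'n \<Rightarrow> real \<Rightarrow> nat" where
  "angle_mult T \<theta> = multiplicity [:1, - 2 * cos \<theta>, 1:] (charpoly T)"

definition rotation_number :: "real ^ 'n ^ 'n \<Rightarrow> nat" where
  "rotation_number T = (\<Sum>\<theta>\<in>rotation_angles T. angle_mult T \<theta>) + minus_one_mult T div 2"

text \<open>In the next four definitions \<open>k\<close> is an integer so that \<open>n' - 1\<close> can be substituted for it
  without truncation when \<open>n' = 0\<close>.\<close>

definition rotatory_elliptic ::
    "(real ^ 'n \<Rightarrow> real) \<Rightarrow> (real ^ 'n) set \<Rightarrow> int \<Rightarrow> real ^ 'n ^ 'n \<Rightarrow> bool" where
  "rotatory_elliptic Q H k T \<longleftrightarrow>
     elliptic Q H T \<and> even (minus_one_mult T) \<and> int (rotation_number T) = k"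

definition rotatory_elliptic_inversion ::
    "(real ^ 'n \<Rightarrow> real) \<Rightarrow> (real ^ 'n) set \<Rightarrow> int \<Rightarrow> real ^ 'n ^ 'n \<Rightarrow> bool" where
  "rotatory_elliptic_inversion Q H k T \<longleftrightarrow>
     elliptic Q H T \<and> odd (minus_one_mult T) \<and> int (rotation_number T) = k"

definition rotatory_hyperbolic ::
    "(real ^ 'n \<Rightarrow> real) \<Rightarrow> (real ^ 'n) set \<Rightarrow> int \<Rightarrow> real ^ 'n ^ 'n \<Rightarrow> bool" where
  "rotatory_hyperbolic Q H k T \<longleftrightarrow>
     hyperbolic Q H T \<and> even (minus_one_mult T) \<and> int (rotation_number T) = k"

definition rotatory_hyperbolic_inversion ::
    "(real ^ 'n \<Rightarrow> real) \<Rightarrow> (real ^ 'n) set \<Rightarrow> int \<Rightarrow> real ^ 'n ^ 'n \<Rightarrow> bool" where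
  "rotatory_hyperbolic_inversion Q H k T \<longleftrightarrow>
     hyperbolic Q H T \<and> odd (minus_one_mult T) \<and> int (rotation_number T) = k"

text \<open>A \<open>k\<close>-rotatory isometry has \<open>k\<close> pairwise distinct rotation angles: no rotation angle is
  repeated, and there are \<open>k\<close> of them. The second part excludes that some of the \<open>k\<close>
  rotations are half turns in the eigenspace for the eigenvalue -1; these are counted in \<open>k\<close> but
  have no rotation angle strictly between 0 and \<open>\<pi>\<close>. (For instance a half turn of the
  hyperbolic plane is a 1-rotatory elliptic without any rotation angle. Its centralizer is an
  O(2), and its z-class is the 2-dimensional set of half turns, which is not generic.)\<close>

definition distinct_rotation_angles :: "real ^ 'n ^ 'n \<Rightarrow> bool" where
  "distinct_rotation_angles T \<longleftrightarrow>
     (\<forall>\<theta>\<in>rotation_angles T. angle_mult T \<theta> = 1) \<and>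
     card (rotation_angles T) = rotation_number T"

end

theory Submission
  imports Defs "HOL-Homology.Homology"
begin

text \<open>An isometry is called regular if its characteristic polynomial has no multiple root, and the
  proof identifies the generic z-classes with the z-classes of regular isometries.
  The Cayley transform makes the group locally homeomorphic to the space of skew matrices, so by
  invariance of domain a z-class of full dimension is open; since regular isometries are dense,
  it contains one. Conversely, if \<open>S\<close> has the centralizer of a regular \<open>T\<close>, then \<open>S\<close> and \<open>T\<close> have the
  same commutant \<open>P\<close> in the matrix algebra, which splits as \<open>P \<oplus> [T, -]\<close>. Every matrix near \<open>S\<close> is of the
  form \<open>u S' u\<^sup>-\<^sup>1\<close> with \<open>S'\<close> in \<open>P\<close> near \<open>S\<close> and \<open>u\<close> near the identity, uniquely in suitable Cayley
  coordinates, and by uniqueness \<open>u\<close> is an isometry as soon as the matrix is one; so the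
  z-class is open. Finally, regular isometries are exactly the listed types, by counting
  eigenvalues.\<close>

text \<open>In general neither the group nor a centralizer in it is connected, so skew matrices
  alone do not reach everything. For density, the discriminant is a rational function along a Cayley
  curve \<open>T ** cay (t *\<^sub>R X)\<close>, so regular isometries near its end force regular
  ones near \<open>T\<close>. A chain of such curves, fixing the vectors of an orthonormal basis one
  after the other, leads from any isometry to the identity or to one reflection, and for these two a
  regular isometry on a Cayley curve is written down. For centralizers, the argument with skew
  matrices says nothing on the eigenspaces for 1 and -1, where reflections take over. Openness rests
  on invariance of domain, which asks only for continuity and injectivity; strict differentiability
  at the single point 0 provides both. In the final count regularity rules out parabolic isometries:
  if the fixed point of Brouwer's theorem is an isotropic line with eigenvalue 1, this eigenvalue
  cannot be simple.\<close>

hide_const (open) up_ring.coeff up_ring.monom Coset.order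

no_notation fps_nth (infixl "$" 75)

section \<open>Square matrices\<close>

lemma matrix_add_rdistrib: "(A + B) ** C = A ** C + B ** C"
  by (vector matrix_matrix_mult_def sum.distrib distrib_right)

lemma bounded_bilinear_matrix_mult:
  "bounded_bilinear ((**) :: real^'n^'n \<Rightarrow> real^'n^'n \<Rightarrow> real^'n^'n)"
proof -
  have "bilinear ((**) :: real^'n^'n \<Rightarrow> real^'n^'n \<Rightarrow> real^'n^'n)"
    unfolding bilinear_def
    by (auto intro!: linearI simp: matrix_add_ldistrib matrix_add_rdistrib scalar_matrix_assoc
        matrix_scalar_ac)
  then show ?thesis
    by (simp add: bilinear_conv_bounded_bilinear)
qed

interpretation mm: bounded_bilinear "(**) :: real^'n^'n \<Rightarrow> real^'n^'n \<Rightarrow> real^'n^'n"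
  by (rule bounded_bilinear_matrix_mult)

lemma bounded_bilinear_matrix_vector_mult:
  "bounded_bilinear ((*v) :: real^'n^'n \<Rightarrow> real^'n \<Rightarrow> real^'n)"
proof -
  have "bilinear ((*v) :: real^'n^'n \<Rightarrow> real^'n \<Rightarrow> real^'n)"
    unfolding bilinear_def
    by (auto intro!: linearI simp: algebra_simps scaleR_matrix_vector_assoc)
  then show ?thesis
    by (simp add: bilinear_conv_bounded_bilinear)
qed

interpretation mv: bounded_bilinear "(*v) :: real^'n^'n \<Rightarrow> real^'n \<Rightarrow> real^'n"
  by (rule bounded_bilinear_matrix_vector_mult)

lemmas mat_ring = mm.add_left mm.add_right mm.diff_left mm.diff_right mm.minus_left mm.minus_right
  mm.scaleR_left mm.scaleR_right matrix_mul_assoc[symmetric]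

lemmas mat_vec = mv.add_left mv.add_right mv.diff_left mv.diff_right mv.minus_left mv.minus_right
  mv.scaleR_left mv.scaleR_right matrix_vector_mul_assoc[symmetric]

section \<open>Inverses of square matrices\<close>

lemma matrix_inv:
  fixes A :: "'a::semiring_1^'n^'m"
  assumes "invertible A"
  shows matrix_inv_right: "A ** matrix_inv A = mat 1"
    and matrix_inv_left: "matrix_inv A ** A = mat 1"
  using someI_ex[OF assms[unfolded invertible_def]] unfolding matrix_inv_def by auto

lemma matrix_inv_right_assoc: "invertible A \<Longrightarrow> A ** (matrix_inv A ** C) = C" for A C :: "real^'n^'n"
  by (simp add: matrix_mul_assoc matrix_inv_right)

lemma matrix_inv_left_assoc: "invertible A \<Longrightarrow> matrix_inv A ** (A ** C) = C" for A C :: "real^'n^'n"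
  by (simp add: matrix_mul_assoc matrix_inv_left)

lemmas mat_inv = matrix_inv_right matrix_inv_left matrix_inv_right_assoc matrix_inv_left_assoc

lemma matrix_inv_unique:
  fixes A :: "real^'n^'n"
  assumes "A ** C = mat 1"
  shows "invertible A" "matrix_inv A = C"
proof -
  show i: "invertible A" using assms invertible_right_inverse by blast
  have "matrix_inv A ** (A ** C) = C" using i by (simp add: mat_inv)
  then show "matrix_inv A = C" using assms by simp
qed

lemma invertible_matrix_inv: "invertible A \<Longrightarrow> invertible (matrix_inv A)" for A :: "real^'n^'n"
  using matrix_inv invertible_def by blast

lemma matrix_inv_matrix_inv: "invertible A \<Longrightarrow> matrix_inv (matrix_inv A) = A" for A :: "real^'n^'n"
  by (simp add: matrix_inv_unique(2) mat_inv)

lemma matrix_inv_mult: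
  fixes A C :: "real^'n^'n"
  assumes "invertible A" "invertible C"
  shows "matrix_inv (A ** C) = matrix_inv C ** matrix_inv A"
  by (rule matrix_inv_unique) (simp add: assms mat_ring mat_inv)

lemma matrix_inv_commute:
  fixes A C :: "real^'n^'n"
  assumes "invertible A" "A ** C = C ** A"
  shows "matrix_inv A ** C = C ** matrix_inv A"
proof -
  have "matrix_inv A ** (A ** C) ** matrix_inv A = matrix_inv A ** (C ** A) ** matrix_inv A"
    using assms(2) by simp
  then show ?thesis using assms(1) by (simp add: mat_ring mat_inv)
qed

lemma commute_mult:
  fixes A C D :: "real^'n^'n"
  assumes "A ** D = D ** A" "C ** D = D ** C"
  shows "(A ** C) ** D = D ** (A ** C)"
  by (metis assms matrix_mul_assoc)

lemma invertible_iff_ker: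
  fixes A :: "real^'n^'n"
  shows "invertible A \<longleftrightarrow> (\<forall>x. A *v x = 0 \<longrightarrow> x = 0)"
  using invertible_left_inverse matrix_left_invertible_ker by blast

lemma invertible_mat_1 [simp]: "invertible (mat 1 :: real^'n^'n)"
  unfolding invertible_def by (rule exI[of _ "mat 1"]) simp

text \<open>Cramer's rule. Entries of the inverse are quotients of determinants, which gives the
  continuity of inversion and, later, the rationality of the Cayley transform along a line.\<close>

lemma matrix_inv_component:
  fixes A :: "real^'n^'n"
  assumes "invertible A"
  shows "matrix_inv A $ k $ l = det (\<chi> i j. if j = k then axis l 1 $ i else A $ i $ j) / det A"
proof -
  have "A *v (matrix_inv A *v axis l 1) = axis l 1"
    using assms by (simp add: matrix_vector_mul_assoc mat_inv)
  then have "matrix_inv A *v axis l 1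
      = (\<chi> k. det (\<chi> i j. if j = k then axis l 1 $ i else A $ i $ j) / det A)"
    using cramer[of A] assms by (simp add: invertible_det_nz)
  moreover have "(matrix_inv A *v axis l 1) $ k = matrix_inv A $ k $ l"
    by (simp add: matrix_vector_mult_def axis_def if_distrib cong: if_cong)
  ultimately show ?thesis by simp
qed

section \<open>Continuity of determinant and inverse\<close>

lemma continuous_on_det [continuous_intros]:
  fixes f :: "'a::topological_space \<Rightarrow> real^'n^'n"
  assumes "continuous_on S f"
  shows "continuous_on S (\<lambda>x. det (f x))"
  unfolding det_def using assms by (intro continuous_intros)

lemma continuous_on_matrix_inv [continuous_intros]:
  fixes f :: "'a::topological_space \<Rightarrow> real^'n^'n"
  assumes f: "continuous_on S f" and inv: "\<And>x. x \<in> S \<Longrightarrow> invertible (f x)"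
  shows "continuous_on S (\<lambda>x. matrix_inv (f x))"
proof -
  have *: "continuous_on S (\<lambda>x. if j = k then c else f x $ i $ j)" for i j k and c :: real
    using f by (cases "j = k") (auto intro!: continuous_intros)
  have "continuous_on S (\<lambda>x. \<chi> k l. det (\<chi> i j. if j = k then axis l 1 $ i else f x $ i $ j) / det (f x))"
    by (intro continuous_on_vec_lambda continuous_on_divide continuous_on_det f *)
       (use inv invertible_det_nz in auto)
  also have "?this \<longleftrightarrow> continuous_on S (\<lambda>x. matrix_inv (f x))"
    by (rule continuous_on_cong) (auto simp: inv vec_eq_iff matrix_inv_component)
  finally show ?thesis .
qed

lemma open_invertible: "open {A :: real^'n^'n. invertible A}"
proof -
  have "open ((\<lambda>A :: real^'n^'n. det A) -` (- {0}))"
    by (intro open_vimage continuous_intros)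
  then show ?thesis by (simp add: invertible_det_nz vimage_def)
qed

lemma open_invertible_minus: "open {X :: real^'n^'n. invertible (mat 1 - X)}"
proof -
  have "open ((\<lambda>X. mat 1 - X) -` {A. invertible (A :: real^'n^'n)})"
    by (intro open_vimage open_invertible continuous_intros)
  then show ?thesis by (simp add: vimage_def)
qed

text \<open>By hypothesis \<open>f\<close> is injective on its range, so by dimension it maps its
  range onto itself, and \<open>f x = f (f y)\<close> for some \<open>y\<close>. Applied to
  \<open>ad T\<close>, to \<open>S - adj S\<close> and to \<open>T - mat 1\<close>.\<close>

lemma linear_ker_im_decomposition:
  fixes f :: "'a::euclidean_space \<Rightarrow> 'a"
  assumes f: "linear f" and ff: "\<And>x. f (f x) = 0 \<Longrightarrow> f x = 0"
  obtains k y where "f k = 0" "x = k + f y"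
proof -
  interpret linear f by (rule f)
  have sub: "subspace (range f)" by (simp add: f linear_subspace_image)
  have inj: "inj_on f (range f)"
  proof (rule inj_onI, clarsimp)
    fix x y assume "f (f x) = f (f y)"
    then have "f (f (x - y)) = 0" by (simp add: diff)
    then show "f x = f y" using ff diff by (metis right_minus_eq)
  qed
  have "dim (f ` range f) = dim (range f)"
    by (rule dim_image_eq[OF f]) (use inj sub span_eq_iff in metis)
  moreover have "subspace (f ` range f)" using f sub linear_subspace_image by blast
  ultimately have "f ` range f = range f"
    using subspace_dim_equal[of "f ` range f" "range f"] sub by auto
  then obtain y where "f x = f (f y)" by blast
  then have "f (x - f y) = 0" by (simp add: diff)
  then show thesis using that[of "x - f y" y] by simp
qed

section \<open>Lorentzian forms\<close>

text \<open>Signature (1, n) is encoded by one vector of square 1 whose orthogonal complement is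
  negative definite. Most sign arguments below form a linear combination that lands in this
  complement.\<close>

locale lorentz =
  fixes J :: "real^'n^'n" and e0 :: "real^'n"
  assumes symJ: "transpose J = J"
    and timelike: "e0 \<bullet> (J *v e0) = 1"
    and neg: "\<And>y. e0 \<bullet> (J *v y) = 0 \<Longrightarrow> y \<noteq> 0 \<Longrightarrow> y \<bullet> (J *v y) < 0"
begin

definition B :: "real^'n \<Rightarrow> real^'n \<Rightarrow> real" where "B x y = x \<bullet> (J *v y)"

text \<open>The adjoint with respect to \<open>B\<close> instead of the inner product; the factors
  \<open>J\<close> convert one into the other.\<close>

definition adj :: "real^'n^'n \<Rightarrow> real^'n^'n" where "adj A = matrix_inv J ** transpose A ** J"

definition H :: "(real^'n) set" where "H = {x. B x x = 1 \<and> B e0 x > 0}"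

definition OB :: "(real^'n^'n) set" where "OB = {A. adj A ** A = mat 1}"

definition G :: "(real^'n^'n) set" where "G = {A \<in> OB. (\<lambda>v. A *v v) ` H = H}"

lemma B_sym: "B x y = B y x"
  by (metis B_def dot_lmul_matrix inner_commute symJ transpose_matrix_vector)

lemma B_simps [simp]:
  "B (x + y) z = B x z + B y z" "B z (x + y) = B z x + B z y"
  "B (x - y) z = B x z - B y z" "B z (x - y) = B z x - B z y"
  "B (c *\<^sub>R x) z = c * B x z" "B z (c *\<^sub>R x) = c * B z x"
  "B (- x) z = - B x z" "B z (- x) = - B z x"
  "B 0 z = 0" "B z 0 = 0"
  by (simp_all add: B_def mat_vec inner_simps)

lemma continuous_on_B [continuous_intros]:
  "continuous_on S f \<Longrightarrow> continuous_on S g \<Longrightarrow> continuous_on S (\<lambda>x. B (f x) (g x))"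
  unfolding B_def by (intro continuous_intros mv.continuous_on)

lemma B_e0 [simp]: "B e0 e0 = 1" using timelike by (simp add: B_def)

lemma B_neg: "B e0 y = 0 \<Longrightarrow> y \<noteq> 0 \<Longrightarrow> B y y < 0" using neg by (simp add: B_def)

lemma B_nonpos: "B e0 y = 0 \<Longrightarrow> B y y \<le> 0" using B_neg[of y] by (cases "y = 0") auto

lemma B_nonneg_eq_0: "B e0 y = 0 \<Longrightarrow> B y y \<ge> 0 \<Longrightarrow> y = 0" using B_neg[of y] by force

lemma B_nondegenerate: "(\<And>x. B x y = 0) \<Longrightarrow> y = 0"
  using B_nonneg_eq_0[of y] by (simp add: B_sym)

lemma invertible_J: "invertible J"
  unfolding invertible_iff_ker by (metis B_def B_nondegenerate inner_zero_right)

lemma B_adj: "B (A *v x) y = B x (adj A *v y)"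
proof -
  have "J ** adj A = transpose A ** J"
    by (simp add: adj_def mat_ring mat_inv invertible_J)
  then have "J *v (adj A *v y) = transpose A *v (J *v y)"
    by (simp add: matrix_vector_mul_assoc)
  then show ?thesis
    unfolding B_def by (metis dot_lmul_matrix inner_commute transpose_matrix_vector)
qed

lemma B_ext: "(\<And>x y. B x (A *v y) = B x (C *v y)) \<Longrightarrow> A = C"
  by (metis (no_types, lifting) B_nondegenerate B_simps(4) matrix_eq right_minus_eq)

lemma adj_unique: "(\<And>x y. B (A *v x) y = B x (C *v y)) \<Longrightarrow> adj A = C"
  by (rule B_ext) (simp add: B_adj[symmetric])

lemma adj_adj [simp]: "adj (adj A) = A"
  by (rule adj_unique) (metis B_adj B_sym)

lemma B_adj2: "B x (A *v y) = B (adj A *v x) y"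
  by (simp add: B_adj)

lemma adj_mult [simp]: "adj (A ** C) = adj C ** adj A"
  by (rule adj_unique) (simp add: B_adj mat_vec)

lemma adj_simps [simp]:
  "adj (A + C) = adj A + adj C" "adj (A - C) = adj A - adj C" "adj (- A) = - adj A"
  "adj (c *\<^sub>R A) = c *\<^sub>R adj A" "adj (mat 1) = mat 1" "adj 0 = 0"
  by (rule adj_unique; simp add: mat_vec B_adj)+

lemma linear_adj: "linear adj"
  by (auto intro: linearI)

lemma continuous_on_adj [continuous_intros]:
  "continuous_on S f \<Longrightarrow> continuous_on S (\<lambda>x. adj (f x))"
  using bounded_linear.continuous_on linear_adj linear_conv_bounded_linear by blast

lemma invertible_adj: "invertible A \<Longrightarrow> invertible (adj A)"
  by (metis adj_mult adj_simps(5) invertible_def)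

lemma adj_matrix_inv: "invertible A \<Longrightarrow> adj (matrix_inv A) = matrix_inv (adj A)"
  by (rule matrix_inv_unique(2)[symmetric]) (metis adj_mult adj_simps(5) matrix_inv_left)

section \<open>The orthogonal group of \<open>B\<close>\<close>

lemma OB_iff: "A \<in> OB \<longleftrightarrow> (\<forall>x. B (A *v x) (A *v x) = B x x)"
proof
  assume "A \<in> OB"
  then show "\<forall>x. B (A *v x) (A *v x) = B x x"
    by (simp add: B_adj OB_def matrix_vector_mul_assoc)
next
  assume q: "\<forall>x. B (A *v x) (A *v x) = B x x"
  have "B (A *v x) (A *v y) = B x y" for x y
  proof -
    have "B (A *v (x + y)) (A *v (x + y)) = B (x + y) (x + y)" using q by blast
    then show ?thesis using q B_sym[of y x] B_sym[of "A *v y" "A *v x"] by (simp add: mat_vec)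
  qed
  then have "adj A ** A = mat 1"
    by (intro B_ext) (simp add: mat_vec B_adj)
  then show "A \<in> OB" by (simp add: OB_def)
qed

lemma OB_D:
  assumes "A \<in> OB"
  shows "adj A ** A = mat 1" "A ** adj A = mat 1" "invertible A" "matrix_inv A = adj A"
proof -
  show 1: "adj A ** A = mat 1" using assms by (simp add: OB_def)
  then show 2: "A ** adj A = mat 1" using matrix_left_right_inverse by blast
  then show "invertible A" "matrix_inv A = adj A" by (rule matrix_inv_unique)+
qed

lemma OB_B [simp]: "A \<in> OB \<Longrightarrow> B (A *v x) (A *v y) = B x y"
  by (simp add: B_adj matrix_vector_mul_assoc OB_D)

lemma OB_mult: "A \<in> OB \<Longrightarrow> C \<in> OB \<Longrightarrow> A ** C \<in> OB"
  by (simp add: OB_iff mat_vec)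

lemma OB_adj: "A \<in> OB \<Longrightarrow> adj A \<in> OB"
  using OB_D(2) by (simp add: OB_def)

lemma OB_1 [simp]: "mat 1 \<in> OB" by (simp add: OB_def)

text \<open>The combination of \<open>x\<close> and \<open>y\<close> orthogonal to \<open>e0\<close>
  has nonpositive square; expanding this square bounds \<open>B x y\<close> from below.\<close>

lemma cone_pos:
  assumes "B e0 x > 0" "B e0 y > 0" "B x x \<ge> 0" "B y y \<ge> 0" "B x x > 0 \<or> B y y > 0"
  shows "B x y > 0"
proof -
  define a b where "a = B e0 x" and "b = B e0 y"
  have "B e0 (b *\<^sub>R x - a *\<^sub>R y) = 0" by (simp add: a_def b_def)
  then have "B (b *\<^sub>R x - a *\<^sub>R y) (b *\<^sub>R x - a *\<^sub>R y) \<le> 0" by (rule B_nonpos)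
  then have "b * b * B x x + a * a * B y y \<le> 2 * (a * b) * B x y"
    by (simp add: B_sym[of y x] algebra_simps)
  moreover have "b * b * B x x + a * a * B y y > 0"
    using assms by (fold a_def b_def) (auto intro: add_pos_nonneg add_nonneg_pos)
  ultimately have "2 * (a * b) * B x y > 0" by linarith
  moreover have "a * b > 0" using assms by (simp add: a_def b_def)
  ultimately show ?thesis by (simp add: zero_less_mult_iff)
qed

section \<open>Isometries preserving the sheet \<open>H\<close>\<close>

lemma timelike_B_ne_0: "B x x > 0 \<Longrightarrow> B e0 x \<noteq> 0"
  using B_nonpos[of x] by force

lemma e0_in_H: "e0 \<in> H" by (simp add: H_def)

text \<open>If \<open>A *v x\<close> lay on the other sheet, \<open>- (A *v x)\<close> and
  \<open>A *v e0\<close> would lie in the same cone and have a positive product, but as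
  \<open>A\<close> is an isometry this product is \<open>- B e0 x\<close>.\<close>

lemma OB_pos_H:
  assumes A: "A \<in> OB" and p: "B e0 (A *v e0) > 0" and x: "x \<in> H"
  shows "A *v x \<in> H"
proof -
  have q: "B (A *v x) (A *v x) = 1" using A x by (simp add: H_def)
  have "B e0 (A *v x) > 0"
  proof (rule ccontr)
    assume "\<not> B e0 (A *v x) > 0"
    then have "B e0 (- (A *v x)) > 0" using timelike_B_ne_0[of "A *v x"] q by simp
    from cone_pos[OF p this] have "B (A *v e0) (- (A *v x)) > 0"
      using A q by simp
    then show False using A x by (simp add: H_def)
  qed
  then show ?thesis using q by (simp add: H_def)
qed

text \<open>Preservation of the sheet is tested at the single vector \<open>e0\<close> by a strict
  inequality. So \<open>G\<close> is open in \<open>OB\<close>, and a small change within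
  \<open>OB\<close> does not leave \<open>G\<close>.\<close>

lemma G_iff: "A \<in> G \<longleftrightarrow> A \<in> OB \<and> B e0 (A *v e0) > 0"
proof
  assume "A \<in> G"
  then show "A \<in> OB \<and> B e0 (A *v e0) > 0"
    using e0_in_H unfolding G_def H_def by blast
next
  assume A: "A \<in> OB \<and> B e0 (A *v e0) > 0"
  then have "adj A \<in> OB" "B e0 (adj A *v e0) > 0"
    by (auto simp: OB_adj B_adj[symmetric] B_sym)
  then have "A *v x \<in> H" "adj A *v x \<in> H" if "x \<in> H" for x
    using A OB_pos_H that by blast+
  moreover have "A *v (adj A *v x) = x" for x
    using A by (simp add: OB_D matrix_vector_mul_assoc)
  ultimately have "(\<lambda>v. A *v v) ` H = H" by (auto simp: image_iff) metis
  then show "A \<in> G" using A by (simp add: G_def)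
qed

lemma G_OB: "A \<in> G \<Longrightarrow> A \<in> OB" by (simp add: G_iff)

lemma G_H: "A \<in> G \<Longrightarrow> x \<in> H \<Longrightarrow> A *v x \<in> H" unfolding G_def by blast

lemma G_I: "A \<in> OB \<Longrightarrow> x \<in> H \<Longrightarrow> A *v x \<in> H \<Longrightarrow> A \<in> G"
proof (rule ccontr)
  assume A: "A \<in> OB" "x \<in> H" "A *v x \<in> H" "A \<notin> G"
  then have "B e0 (A *v e0) \<le> 0" "B (A *v e0) (A *v e0) = 1" by (auto simp: G_iff)
  then have "B e0 (- (A *v e0)) > 0" "B (- (A *v e0)) (- (A *v e0)) = 1"
    using timelike_B_ne_0[of "A *v e0"] by auto
  from cone_pos[OF this(1), of "A *v x"] this(2) have "B (- (A *v e0)) (A *v x) > 0"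
    using A(3) by (simp add: H_def)
  then show False using A by (simp add: H_def)
qed

lemma G_mult: "A \<in> G \<Longrightarrow> C \<in> G \<Longrightarrow> A ** C \<in> G"
  using G_I[of "A ** C" e0] by (simp add: G_OB OB_mult e0_in_H G_H mat_vec)

lemma G_1 [simp]: "mat 1 \<in> G" by (simp add: G_iff)

lemma G_adj: "A \<in> G \<Longrightarrow> adj A \<in> G"
  by (simp add: G_iff OB_adj B_adj[symmetric] B_sym)

lemma G_matrix_inv: "A \<in> G \<Longrightarrow> matrix_inv A \<in> G"
  by (simp add: G_adj OB_D G_OB)


section \<open>The Cayley transform\<close>

definition skew :: "(real^'n^'n) set" where "skew = {X. adj X = - X}"

end

text \<open>This is \<open>(1 + X) (1 - X)^-1\<close>, written with a single occurrence of
  \<open>X\<close>, so that continuity, commutation and conjugation are inherited from the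
  inverse.\<close>

definition cay :: "real^'n^'n \<Rightarrow> real^'n^'n" where
  "cay X = 2 *\<^sub>R matrix_inv (mat 1 - X) - mat 1"

lemma cay_mult:
  assumes "invertible (mat 1 - X)"
  shows "(mat 1 - X) ** cay X = mat 1 + X"
proof -
  have "(mat 1 - X) ** cay X = 2 *\<^sub>R ((mat 1 - X) ** matrix_inv (mat 1 - X)) - (mat 1 - X)"
    by (simp only: cay_def mm.diff_right mm.scaleR_right matrix_mul_rid)
  then show ?thesis using assms by (simp add: mat_inv vec_eq_iff)
qed

lemma cay_0 [simp]: "cay 0 = mat 1"
proof -
  have "matrix_inv (mat 1 :: real^'n^'n) = mat 1" by (rule matrix_inv_unique) simp
  then show ?thesis by (simp add: cay_def vec_eq_iff)
qed

lemma cay_vector: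
  assumes i: "invertible (mat 1 - X)" and "(mat 1 - X) *v v = (mat 1 + X) *v u"
  shows "cay X *v u = v"
proof -
  have "(mat 1 - X) *v (cay X *v u) = (mat 1 - X) *v v"
    using assms by (simp add: matrix_vector_mul_assoc cay_mult)
  then show ?thesis using inj_matrix_vector_mult[OF i] by (auto dest: injD)
qed

lemma cay_inverse:
  assumes i: "invertible (mat 1 - X)" "invertible (mat 1 + X)"
  shows "cay (- X) ** cay X = mat 1" "cay X ** cay (- X) = mat 1"
proof -
  have *: "cay (- X) ** cay X = mat 1" if i: "invertible (mat 1 - X)" "invertible (mat 1 + X)"
    for X :: "real^'n^'n"
  proof -
    define P R where "P = matrix_inv (mat 1 + X)" and "R = matrix_inv (mat 1 - X)"
    have "P ** (mat 1 - X + (mat 1 + X)) ** R = P ** ((mat 1 - X) ** R) + (P ** (mat 1 + X)) ** R"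
      by (simp only: mm.add_left mm.add_right matrix_mul_assoc)
    also have "\<dots> = P + R" by (simp add: P_def R_def mat_inv i)
    finally have "P ** (mat 1 - X + (mat 1 + X)) ** R = P + R" .
    moreover have "mat 1 - X + (mat 1 + X) = 2 *\<^sub>R mat 1" by (simp add: vec_eq_iff)
    ultimately have PR: "2 *\<^sub>R (P ** R) = P + R"
      by (simp only: mm.scaleR_left mm.scaleR_right matrix_mul_rid)
    have "cay (- X) ** cay X = 2 *\<^sub>R (2 *\<^sub>R (P ** R)) - 2 *\<^sub>R P - 2 *\<^sub>R R + mat 1"
      by (simp add: cay_def P_def R_def mat_ring vec_eq_iff)
    also have "\<dots> = mat 1" unfolding PR by (simp add: vec_eq_iff)
    finally show ?thesis .
  qed
  show "cay (- X) ** cay X = mat 1" using * i by blast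
  show "cay X ** cay (- X) = mat 1" using *[of "- X"] i by simp
qed

lemma invertible_cay:
  assumes "invertible (mat 1 - X)" "invertible (mat 1 + X)"
  shows "invertible (cay X)" "matrix_inv (cay X) = cay (- X)"
  using matrix_inv_unique[of "cay X" "cay (- X)"] cay_inverse assms by blast+

text \<open>\<open>1 - 2 (1 + A)^-1 = (A - 1) (A + 1)^-1\<close> is the inverse Cayley transform,
  defined where \<open>1 + A\<close> is invertible.\<close>

lemma cay_surj:
  assumes i: "invertible (mat 1 + A)"
  defines "X \<equiv> mat 1 - 2 *\<^sub>R matrix_inv (mat 1 + A)"
  shows "invertible (mat 1 - X)" "cay X = A"
proof -
  have X: "mat 1 - X = 2 *\<^sub>R matrix_inv (mat 1 + A)" by (simp add: X_def)
  have "(mat 1 - X) ** ((1/2) *\<^sub>R (mat 1 + A)) = mat 1"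
    unfolding X using i by (simp add: mm.scaleR_left mm.scaleR_right mat_inv)
  from matrix_inv_unique[OF this] show "invertible (mat 1 - X)" "cay X = A"
    by (simp_all add: cay_def)
qed

lemma cay_commute:
  assumes "invertible (mat 1 - X)" "X ** T = T ** X"
  shows "cay X ** T = T ** cay X"
proof -
  have "(mat 1 - X) ** T = T ** (mat 1 - X)" using assms(2) by (simp add: mat_ring)
  from matrix_inv_commute[OF assms(1) this] show ?thesis
    by (simp add: cay_def mat_ring)
qed

lemma cay_commute_rev:
  assumes i: "invertible (mat 1 - X)" and c: "cay X ** T = T ** cay X"
  shows "X ** T = T ** X"
proof -
  have "matrix_inv (mat 1 - X) ** T = T ** matrix_inv (mat 1 - X)"
    using c by (simp add: cay_def mat_ring)
  from matrix_inv_commute[OF invertible_matrix_inv[OF i] this]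
  show ?thesis using i by (simp add: matrix_inv_matrix_inv mat_ring)
qed

context lorentz
begin

lemma adj_cay: "invertible (mat 1 - X) \<Longrightarrow> adj (cay X) = cay (adj X)"
  by (simp add: cay_def adj_matrix_inv)

text \<open>\<open>1 + X\<close> is the adjoint of \<open>1 - X\<close>.\<close>

lemma skew_invertible: "X \<in> skew \<Longrightarrow> invertible (mat 1 - X) \<Longrightarrow> invertible (mat 1 + X)"
  using invertible_adj[of "mat 1 - X"] by (simp add: skew_def)

lemma cay_OB:
  assumes "X \<in> skew" "invertible (mat 1 - X)"
  shows "cay X \<in> OB"
proof -
  have "adj X = - X" using assms by (simp add: skew_def)
  then show ?thesis
    using assms cay_inverse[of X] skew_invertible by (simp add: OB_def adj_cay)
qed

text \<open>With \<open>R = (1 + A)^-1\<close> one has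
  \<open>adj R = (1 + A^-1)^-1 = A R = 1 - R\<close>, so \<open>1 - 2 R\<close> changes its sign
  under \<open>adj\<close>.\<close>

lemma OB_cay_skew:
  assumes A: "A \<in> OB" and i: "invertible (mat 1 + A)"
  shows "mat 1 - 2 *\<^sub>R matrix_inv (mat 1 + A) \<in> skew"
proof -
  define R where "R = matrix_inv (mat 1 + A)"
  have "(mat 1 + adj A) ** (A ** R) = (mat 1 + A) ** R"
    using OB_D[OF A] by (simp add: mat_ring) (simp add: matrix_mul_assoc)
  also have "\<dots> = mat 1" by (simp add: R_def mat_inv i)
  finally have 1: "matrix_inv (mat 1 + adj A) = A ** R" by (rule matrix_inv_unique)
  have "R + A ** R = (mat 1 + A) ** R" by (simp add: mat_ring)
  then have "A ** R = mat 1 - R" using i by (simp add: R_def mat_inv algebra_simps)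
  then have "adj R = mat 1 - R" using 1 i by (simp add: R_def adj_matrix_inv)
  then show ?thesis unfolding skew_def R_def[symmetric] by (simp add: vec_eq_iff)
qed

lemma subspace_skew: "subspace skew"
  by (auto simp: subspace_def skew_def)

end

section \<open>Topological manifolds\<close>

lemma Euclidean_space_subspace:
  assumes "n \<le> m"
  shows "Euclidean_space n = subtopology (Euclidean_space m) (topspace (Euclidean_space n))"
  by (metis Euclidean_space_def assms inf.absorb_iff2 subset_Euclidean_space subtopology_subtopology
      topspace_Euclidean_space)

text \<open>If \<open>n < d\<close>, the image in the smaller space would be open in the larger one
  by invariance of domain, although it lies in a coordinate hyperplane.\<close>

lemma Euclidean_space_open_dim_le:
  assumes V: "openin (Euclidean_space d) V" "V \<noteq> {}"
    and f: "continuous_map (subtopology (Euclidean_space d) V) (Euclidean_space n) f" "inj_on f V"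
  shows "d \<le> n"
proof (rule ccontr)
  assume "\<not> d \<le> n"
  then have nd: "n < d" by simp
  have "continuous_map (subtopology (Euclidean_space d) V) (Euclidean_space d) f"
    using f(1) Euclidean_space_subspace[of n d] nd
    by (metis continuous_map_in_subtopology less_imp_le)
  then have op: "openin (Euclidean_space d) (f ` V)"
    using V f(2) by (intro invariance_of_domain_Euclidean_space_gen) auto
  have sub: "f ` V \<subseteq> topspace (Euclidean_space n)"
    using f(1) openin_subset[OF V(1)] by (auto simp: continuous_map_def)
  obtain y where y: "y \<in> f ` V" using V by blast
  \<comment> \<open>The line through \<open>y\<close> in the direction of coordinate
    \<open>n\<close>. Points of \<open>Euclidean_space n\<close> are sequences supported below
    \<open>n\<close>, so the line leaves the image at once, although an open image would contain a
    piece of it.\<close>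
  define p where "p = (\<lambda>(t::real) i. if i < d then (y i + (if i = n then t else 0)) else (0::real))"
  have cont: "continuous_map euclideanreal (Euclidean_space d) p"
    unfolding p_def continuous_map_componentwise_Euclidean_space
  proof (intro allI impI)
    fix i
    show "continuous_map euclideanreal euclideanreal (\<lambda>t. y i + (if i = n then t else 0))"
      by (cases "i = n") (auto simp: continuous_map_iff_continuous2 intro!: continuous_intros)
  qed
  have y0: "y i = 0" if "i \<ge> n" for i
    using y sub that by (auto simp: topspace_Euclidean_space)
  have "p 0 = y"
  proof
    show "p 0 i = y i" for i using nd y0[of i] by (cases "i < d") (simp_all add: p_def)
  qed
  have "open {t. p t \<in> f ` V}"
    using openin_continuous_map_preimage[OF cont op] by simp
  moreover have "0 \<in> {t. p t \<in> f ` V}" using y \<open>p 0 = y\<close> by simp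
  ultimately obtain e where "e > 0" "ball 0 e \<subseteq> {t. p t \<in> f ` V}"
    using openE by blast
  then have "p (e / 2) \<in> f ` V" by (auto simp: subset_iff)
  then have "p (e / 2) n = 0" using sub by (auto simp: topspace_Euclidean_space)
  then show False using nd y0[of n] \<open>e > 0\<close> by (simp add: p_def)
qed

lemma manifold_of_dim_open_subset:
  assumes X: "manifold_of_dim d X" and C: "openin X C"
  shows "manifold_of_dim d (subtopology X C)"
  unfolding manifold_of_dim_def
proof (intro conjI ballI)
  show "Hausdorff_space (subtopology X C)" "second_countable (subtopology X C)"
    using X by (auto simp: manifold_of_dim_def Hausdorff_space_subtopology second_countable_subtopology)
  fix x assume "x \<in> topspace (subtopology X C)"
  then have x: "x \<in> topspace X" "x \<in> C" by auto
  then obtain U V h where U: "openin X U" "x \<in> U" "openin (Euclidean_space d) V"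
      and h: "homeomorphic_map (subtopology X U) (subtopology (Euclidean_space d) V) h"
    using X unfolding manifold_of_dim_def homeomorphic_space by metis
  have sub: "U \<subseteq> topspace X" "V \<subseteq> topspace (Euclidean_space d)"
    using U openin_subset by auto
  have "openin (subtopology X U) (U \<inter> C)" using U C by (simp add: openin_subtopology_Int2)
  then have "openin (subtopology (Euclidean_space d) V) (h ` (U \<inter> C))"
    by (simp add: homeomorphic_map_openness_eq[OF h])
  then have hUC: "openin (Euclidean_space d) (h ` (U \<inter> C))" "h ` (U \<inter> C) \<subseteq> V"
    by (simp_all add: openin_open_subtopology[OF U(3)])
  have "homeomorphic_map (subtopology (subtopology X U) (U \<inter> C))
      (subtopology (subtopology (Euclidean_space d) V) (h ` (U \<inter> C))) h"
    by (rule homeomorphic_map_subtopologies[OF h]) (use hUC sub in auto)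
  then have "subtopology X (U \<inter> C) homeomorphic_space subtopology (Euclidean_space d) (h ` (U \<inter> C))"
    using hUC by (auto simp: subtopology_subtopology homeomorphic_space Int_absorb1)
  moreover have "subtopology (subtopology X C) (U \<inter> C) = subtopology X (U \<inter> C)"
    by (simp add: subtopology_subtopology Int_absorb1)
  moreover have "openin (subtopology X C) (U \<inter> C)"
    using U(1) by (auto simp: openin_subtopology)
  ultimately show "\<exists>U V. openin (subtopology X C) U \<and> x \<in> U \<and> openin (Euclidean_space d) V \<and>
      subtopology (subtopology X C) U homeomorphic_space subtopology (Euclidean_space d) V"
    using hUC(1) U(2) x(2) by (metis IntI)
qed

text \<open>An inverse chart of \<open>C\<close> followed by a chart of \<open>X\<close> is a
  continuous injection of a nonempty open set of dimension \<open>d\<close> into dimension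
  \<open>n\<close>. This forces \<open>d \<le> n\<close>, and if \<open>d = n\<close> its image is
  open by invariance of domain.\<close>

lemma submanifold_dim:
  assumes X: "manifold_of_dim n X" and C: "C \<subseteq> topspace X"
    and M: "manifold_of_dim d (subtopology X C)"
  shows "C \<noteq> {} \<Longrightarrow> d \<le> n" and "d = n \<Longrightarrow> openin X C"
proof -
  have main: "d \<le> n \<and> (d = n \<longrightarrow> (\<exists>T. openin X T \<and> x \<in> T \<and> T \<subseteq> C))" if "x \<in> C" for x
  proof -
    have x: "x \<in> topspace X" "x \<in> topspace (subtopology X C)" using that C by auto
    then obtain D W g where D: "openin X D" "x \<in> D" "openin (Euclidean_space n) W"
      and g: "homeomorphic_map (subtopology X D) (subtopology (Euclidean_space n) W) g"
      using X unfolding manifold_of_dim_def homeomorphic_space by metis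
    from x obtain U V h where U: "openin (subtopology X C) U" "x \<in> U" "openin (Euclidean_space d) V"
      and h: "homeomorphic_map (subtopology (subtopology X C) U) (subtopology (Euclidean_space d) V) h"
      using M unfolding manifold_of_dim_def homeomorphic_space by metis
    have UC: "U \<subseteq> C" using openin_imp_subset[OF U(1)] .
    then have XU: "subtopology (subtopology X C) U = subtopology X U"
      by (simp add: subtopology_subtopology Int_absorb1)
    obtain k where k: "homeomorphic_maps (subtopology X U) (subtopology (Euclidean_space d) V) h k"
      using h XU by (auto simp: homeomorphic_map_maps)
    define V' where "V' = h ` (U \<inter> D)"
    have sub: "D \<subseteq> topspace X" "U \<subseteq> topspace X" "V \<subseteq> topspace (Euclidean_space d)"
        "W \<subseteq> topspace (Euclidean_space n)"
      using D U UC C openin_subset by blast+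
    have "openin (subtopology X U) (U \<inter> D)" using D by (simp add: openin_subtopology_Int2)
    then have "openin (subtopology (Euclidean_space d) V) V'"
      by (simp add: homeomorphic_map_openness_eq[OF h[unfolded XU]] V'_def)
    then have V': "openin (Euclidean_space d) V'" "V' \<subseteq> V"
      by (simp_all add: openin_open_subtopology[OF U(3)])
    have kh: "k (h z) = z" if "z \<in> U" for z
      using k that sub by (auto simp: homeomorphic_maps_def)
    have kV': "k ` V' = U \<inter> D" using kh by (force simp: V'_def image_iff)
    have "continuous_map (subtopology (Euclidean_space d) V') (subtopology X U) k"
      using k V' by (metis continuous_map_from_subtopology_mono homeomorphic_maps_def)
    then have "continuous_map (subtopology (Euclidean_space d) V') X k"
      using continuous_map_in_subtopology by blast
    then have "continuous_map (subtopology (Euclidean_space d) V') (subtopology X D) k"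
      using kV' by (auto simp: continuous_map_in_subtopology)
    moreover have "continuous_map (subtopology X D) (Euclidean_space n) g"
      using g homeomorphic_imp_continuous_map continuous_map_in_subtopology by blast
    ultimately have cont: "continuous_map (subtopology (Euclidean_space d) V') (Euclidean_space n) (g \<circ> k)"
      by (rule continuous_map_compose)
    have "inj_on g D" using g sub by (auto simp: homeomorphic_eq_everything_map Int_absorb1)
    moreover have "inj_on k V'" using kh unfolding V'_def inj_on_def by auto
    ultimately have inj: "inj_on (g \<circ> k) V'"
      using kV' by (auto intro!: comp_inj_on intro: inj_on_subset)
    have "V' \<noteq> {}" using D U by (auto simp: V'_def)
    then have le: "d \<le> n" using Euclidean_space_open_dim_le[OF V'(1) _ cont inj] by blast
    moreover have "openin X (U \<inter> D)" if "d = n"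
    proof -
      have "openin (Euclidean_space n) ((g \<circ> k) ` V')"
        using invariance_of_domain_Euclidean_space_gen[OF _ V'(1) cont inj] that by simp
      then have "openin (Euclidean_space n) (g ` (U \<inter> D))" by (metis image_comp kV')
      moreover have "g ` D = W"
        using g sub by (simp add: homeomorphic_eq_everything_map Int_absorb1)
      ultimately have "openin (subtopology (Euclidean_space n) W) (g ` (U \<inter> D))"
        by (auto simp: openin_open_subtopology[OF D(3)])
      then have "openin (subtopology X D) (U \<inter> D)"
        using homeomorphic_map_openness[OF g, of "U \<inter> D"] sub by auto
      then show ?thesis using D(1) openin_trans_full by blast
    qed
    ultimately show ?thesis using D U UC by blast
  qed
  show "C \<noteq> {} \<Longrightarrow> d \<le> n" using main by blast
  show "d = n \<Longrightarrow> openin X C"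
    by (subst openin_subopen) (use main in blast)
qed

context lorentz
begin

text \<open>The chart around \<open>S\<close> is the inverse Cayley transform of
  \<open>S^-1 A\<close>. It lives where \<open>1 + S^-1 A\<close> is invertible, which holds at
  \<open>A = S\<close>.\<close>

lemma G_manifold: "manifold_of_dim (dim skew) (top_of_set G)"
  unfolding manifold_of_dim_def
proof (intro conjI ballI)
  obtain \<B> :: "(real^'n^'n) set set" where "countable \<B>" and op: "\<And>C. C \<in> \<B> \<Longrightarrow> open C"
    and un: "\<And>S. open S \<Longrightarrow> \<exists>U. U \<subseteq> \<B> \<and> S = \<Union>U"
    using univ_second_countable by blast
  moreover have "\<exists>V\<in>\<B>. x \<in> V \<and> V \<subseteq> U" if "open U" "x \<in> U" for U x
    using un[OF that(1)] that(2) by blast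
  ultimately have "second_countable (euclidean :: (real^'n^'n) topology)"
    unfolding second_countable_def by (intro exI[of _ \<B>]) auto
  then show "Hausdorff_space (top_of_set G)" "second_countable (top_of_set G)"
    by (simp_all add: Hausdorff_space_subtopology second_countable_subtopology)
  fix S assume "S \<in> topspace (top_of_set G)"
  then have S: "S \<in> G" by simp
  note SO = OB_D[OF G_OB[OF S]]
  define D where "D = {A \<in> G. invertible (mat 1 + adj S ** A)}"
  define W where "W = {X \<in> skew. invertible (mat 1 - X) \<and> S ** cay X \<in> G}"
  define f where "f = (\<lambda>A. mat 1 - 2 *\<^sub>R matrix_inv (mat 1 + adj S ** A))"
  define g where "g = (\<lambda>X. S ** cay X)"
  have "homeomorphism D W f g"
  proof
    show "continuous_on D f"
      unfolding f_def by (intro continuous_intros mm.continuous_on) (auto simp: D_def)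
    show "continuous_on W g"
      unfolding g_def cay_def by (intro continuous_intros mm.continuous_on) (auto simp: W_def)
    have AO: "adj S ** A \<in> OB" if "A \<in> D" for A
      using that S by (simp add: D_def OB_mult OB_adj G_OB)
    have cayf: "invertible (mat 1 - f A)" "cay (f A) = adj S ** A" if "A \<in> D" for A
      using cay_surj[of "adj S ** A"] that by (auto simp: f_def D_def)
    show gf: "g (f A) = A" if "A \<in> D" for A
      using cayf[OF that] SO by (simp add: g_def matrix_mul_assoc)
    show "f ` D \<subseteq> W"
    proof clarify
      fix A assume A: "A \<in> D"
      then show "f A \<in> W"
        using cayf[OF A] gf[OF A] OB_cay_skew[OF AO[OF A]]
        by (auto simp: W_def D_def f_def g_def)
    qed
    \<comment> \<open>Since \<open>1 + cay X = 2 (1 - X)^-1\<close>, a Cayley transform always lies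
      in the domain of the inverse transform.\<close>
    have gi: "mat 1 + adj S ** g X = 2 *\<^sub>R matrix_inv (mat 1 - X)" if "X \<in> W" for X
      using SO by (simp add: g_def matrix_mul_assoc cay_def)
    show "g ` W \<subseteq> D"
    proof clarify
      fix X assume X: "X \<in> W"
      have "invertible (2 *\<^sub>R matrix_inv (mat 1 - X))"
        using X by (intro scalar_invertible) (auto simp: W_def invertible_matrix_inv)
      then show "g X \<in> D" using X gi[OF X] by (simp add: D_def W_def g_def)
    qed
    show "f (g X) = X" if X: "X \<in> W" for X
    proof -
      have i: "invertible (mat 1 - X)" using X by (simp add: W_def)
      have "(2 *\<^sub>R matrix_inv (mat 1 - X)) ** ((1/2) *\<^sub>R (mat 1 - X)) = mat 1"
        using i by (simp add: mm.scaleR_left mm.scaleR_right mat_inv)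
      then have "matrix_inv (2 *\<^sub>R matrix_inv (mat 1 - X)) = (1/2) *\<^sub>R (mat 1 - X)"
        by (rule matrix_inv_unique)
      then have "2 *\<^sub>R matrix_inv (mat 1 + adj S ** g X) = mat 1 - X" by (simp add: gi[OF X])
      then show ?thesis by (simp add: f_def)
    qed
  qed
  then have hom: "top_of_set D homeomorphic_space top_of_set W"
    by (auto simp: homeomorphic_def)
  have D: "openin (top_of_set G) D"
  proof -
    have "openin (top_of_set G) (G \<inter> (\<lambda>A. mat 1 + adj S ** A) -` {A. invertible A})"
      by (intro continuous_openin_preimage_gen open_invertible continuous_intros mm.continuous_on)
    then show ?thesis by (simp add: D_def vimage_def Int_def)
  qed
  have SD: "S \<in> D"
    using S SO scalar_invertible[of 2 "mat 1 :: real^'n^'n"] scaleR_2[of "mat 1 :: real^'n^'n"]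
    by (simp add: D_def)
  have W: "openin (top_of_set skew) W"
  proof -
    let ?I = "{X :: real^'n^'n. invertible (mat 1 - X)}"
    have I: "open ?I" by (rule open_invertible_minus)
    have "continuous_on ?I (\<lambda>X. B e0 ((S ** cay X) *v e0))"
      unfolding cay_def by (intro continuous_intros mm.continuous_on mv.continuous_on) auto
    then have "open (?I \<inter> (\<lambda>X. B e0 ((S ** cay X) *v e0)) -` {0<..})"
      using I continuous_on_open_vimage by (metis inf_commute open_greaterThan)
    moreover have "W = skew \<inter> (?I \<inter> (\<lambda>X. B e0 ((S ** cay X) *v e0)) -` {0<..})"
      using S by (auto simp: W_def G_iff cay_OB OB_mult)
    ultimately show ?thesis by (metis openin_open)
  qed
  obtain e where e: "homeomorphic_map (top_of_set skew) (Euclidean_space (dim skew)) e"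
    using homeomorphic_subspace_Euclidean_space_dim[OF subspace_skew] homeomorphic_space by blast
  have V: "openin (Euclidean_space (dim skew)) (e ` W)"
    using homeomorphic_map_openness_eq[OF e] W by blast
  have "homeomorphic_map (subtopology (top_of_set skew) W) (subtopology (Euclidean_space (dim skew)) (e ` W)) e"
    by (rule homeomorphic_map_subtopologies[OF e])
      (use openin_subset[OF V] openin_imp_subset[OF W] in auto)
  then have "top_of_set W homeomorphic_space subtopology (Euclidean_space (dim skew)) (e ` W)"
    using openin_imp_subset[OF W] by (auto simp: homeomorphic_space subtopology_subtopology inf.absorb_iff2)
  then have "subtopology (top_of_set G) D homeomorphic_space subtopology (Euclidean_space (dim skew)) (e ` W)"
    using homeomorphic_space_trans[OF hom] openin_imp_subset[OF D]
    by (simp add: subtopology_subtopology Int_absorb1)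
  then show "\<exists>U V. openin (top_of_set G) U \<and> S \<in> U \<and> openin (Euclidean_space (dim skew)) V \<and>
      subtopology (top_of_set G) U homeomorphic_space subtopology (Euclidean_space (dim skew)) V"
    using D SD V by blast
qed

end

section \<open>The characteristic polynomial\<close>

text \<open>The determinant is a polynomial in the entries with integer coefficients. The
  homomorphisms needed are the evaluation of polynomials and the embedding of the reals into the
  complex numbers.\<close>

lemma det_hom:
  fixes h :: "'a::comm_ring_1 \<Rightarrow> 'b::comm_ring_1" and A :: "'a^'c^'c"
  assumes add: "\<And>x y. h (x + y) = h x + h y" and mult: "\<And>x y. h (x * y) = h x * h y"
    and one: "h 1 = 1"
  shows "h (det A) = det (map_matrix h A)"
proof -
  have "h (0 + 0) = h 0 + h 0" by (rule add)
  then have zero: "h 0 = 0" by simp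
  have "h (x + (- x)) = h x + h (- x)" for x by (rule add)
  then have uminus: "h (- x) = - h x" for x
    by (metis add.right_inverse zero add_eq_0_iff)
  have sum: "h (sum f S) = (\<Sum>i\<in>S. h (f i))" for f :: "('c \<Rightarrow> 'c) \<Rightarrow> 'a" and S
    by (induction S rule: infinite_finite_induct) (auto simp: zero add)
  have prod: "h (prod f S) = (\<Prod>i\<in>S. h (f i))" for f :: "'c \<Rightarrow> 'a" and S
    by (induction S rule: infinite_finite_induct) (auto simp: one mult)
  have sgn: "h (of_int (sign p)) = of_int (sign p)" for p :: "'c \<Rightarrow> 'c"
    by (simp add: sign_def one uminus)
  show ?thesis
    by (simp add: det_def sum mult prod sgn)
qed

section \<open>Complexification, complex eigenvalues and the degree of the characteristic
  polynomial\<close>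

definition cmat :: "real^'n^'n \<Rightarrow> complex^'n^'n" where
  "cmat = map_matrix complex_of_real"

definition cspec :: "real^'n^'n \<Rightarrow> complex set" where
  "cspec T = {z. poly (map_poly of_real (charpoly T)) z = 0}"

text \<open>Counting distinct complex eigenvalues, instead of asking for a squarefree polynomial,
  makes it enough to exhibit \<open>CARD('n)\<close> of them.\<close>

definition regular :: "real^'n^'n \<Rightarrow> bool" where
  "regular T \<longleftrightarrow> card (cspec T) = CARD('n)"

lemma cmat_nth [simp]: "cmat A $ i $ j = of_real (A $ i $ j)"
  by (simp add: cmat_def)

lemma cmat_simps:
  "cmat (A + C) = cmat A + cmat C" "cmat (A - C) = cmat A - cmat C" "cmat 0 = 0"
  "cmat (mat 1) = mat 1" "cmat (A ** C) = cmat A ** cmat C"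
  by (auto simp: vec_eq_iff mat_def matrix_matrix_mult_def)

lemma cmat_inj: "cmat A = cmat C \<Longrightarrow> A = C"
  by (simp add: vec_eq_iff)

definition cvec :: "real^'n \<Rightarrow> real^'n \<Rightarrow> complex^'n" where
  "cvec x y = (\<chi> i. Complex (x $ i) (y $ i))"

lemma cvec_surj: "\<exists>x y. v = cvec x y"
  by (rule exI[of _ "\<chi> i. Re (v $ i)"], rule exI[of _ "\<chi> i. Im (v $ i)"]) (simp add: cvec_def vec_eq_iff)

lemma cvec_eq_iff: "cvec x y = cvec x' y' \<longleftrightarrow> x = x' \<and> y = y'"
  by (auto simp: cvec_def vec_eq_iff)

lemma cvec_0: "cvec x y = 0 \<longleftrightarrow> x = 0 \<and> y = 0"
  by (auto simp: cvec_def vec_eq_iff complex_eq_iff)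

lemma cmat_cvec: "cmat A *v cvec x y = cvec (A *v x) (A *v y)"
  by (simp add: vec_eq_iff matrix_vector_mult_def cvec_def complex_eq_iff Re_sum Im_sum)

lemma scale_cvec: "z *s cvec x y = cvec (Re z *\<^sub>R x - Im z *\<^sub>R y) (Im z *\<^sub>R x + Re z *\<^sub>R y)"
  by (simp add: vec_eq_iff cvec_def complex_eq_iff)

lemma poly_charpoly: "poly (charpoly T) x = det (mat x - T)"
proof -
  have "poly (charpoly T) x = det (map_matrix (\<lambda>p. poly p x) (mat [:0, 1:] - map_matrix (\<lambda>a. [:a:]) T))"
    unfolding charpoly_def by (rule det_hom) auto
  also have "map_matrix (\<lambda>p. poly p x) (mat [:0, 1:] - map_matrix (\<lambda>a. [:a:]) T) = mat x - T"
    by (simp add: vec_eq_iff mat_def)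
  finally show ?thesis .
qed

lemma map_poly_of_real_add:
  "map_poly of_real (p + q) = map_poly of_real p + map_poly (of_real :: real \<Rightarrow> complex) q"
  by (simp add: poly_eq_iff coeff_map_poly)

lemma map_poly_of_real_mult:
  "map_poly of_real (p * q) = map_poly of_real p * map_poly (of_real :: real \<Rightarrow> complex) q"
  by (simp add: poly_eq_iff coeff_map_poly coeff_mult)

lemma cpoly_charpoly: "poly (map_poly of_real (charpoly T)) z = det (mat z - cmat T)"
proof -
  let ?h = "\<lambda>p. poly (map_poly complex_of_real p) z"
  have "?h (charpoly T) = det (map_matrix ?h (mat [:0, 1:] - map_matrix (\<lambda>a. [:a:]) T))"
    unfolding charpoly_def by (rule det_hom) (simp_all add: map_poly_of_real_add map_poly_of_real_mult)
  also have "map_matrix ?h (mat [:0, 1:] - map_matrix (\<lambda>a. [:a:]) T) = mat z - cmat T"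
    by (simp add: vec_eq_iff mat_def map_poly_pCons)
  finally show ?thesis .
qed

lemma cspec_iff_det: "z \<in> cspec T \<longleftrightarrow> det (mat z - cmat T) = 0"
  by (simp add: cspec_def cpoly_charpoly)

lemma mat_vec_scale: "mat z *v v = z *s v" for z :: "'a::comm_semiring_1"
  by (simp add: vec_eq_iff matrix_vector_mult_def mat_def if_distrib if_distribR sum.delta cong: if_cong)

lemma det_eq_0_iff_ker:
  fixes A :: "'a::field^'n^'n"
  shows "det A = 0 \<longleftrightarrow> (\<exists>v. v \<noteq> 0 \<and> A *v v = 0)"
  using invertible_det_nz[of A] invertible_left_inverse[of A] matrix_left_invertible_ker[of A] by blast

lemma cspec_iff: "z \<in> cspec T \<longleftrightarrow> (\<exists>v. v \<noteq> 0 \<and> cmat T *v v = z *s v)"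
  by (auto simp: cspec_iff_det det_eq_0_iff_ker matrix_vector_mult_diff_rdistrib mat_vec_scale)

text \<open>Real and imaginary part of a complex eigenvector; the real form \<open>B\<close> can be
  evaluated on these.\<close>

lemma cspec_iff_real:
  "z \<in> cspec T \<longleftrightarrow> (\<exists>x y. (x \<noteq> 0 \<or> y \<noteq> 0) \<and> T *v x = Re z *\<^sub>R x - Im z *\<^sub>R y \<and>
     T *v y = Im z *\<^sub>R x + Re z *\<^sub>R y)"
proof
  assume "z \<in> cspec T"
  then obtain v where v: "v \<noteq> 0" "cmat T *v v = z *s v" by (auto simp: cspec_iff)
  obtain x y where "v = cvec x y" using cvec_surj by blast
  with v have "(x \<noteq> 0 \<or> y \<noteq> 0) \<and> T *v x = Re z *\<^sub>R x - Im z *\<^sub>R y \<and> T *v y = Im z *\<^sub>R x + Re z *\<^sub>R y"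
    by (auto simp: cvec_0 cmat_cvec scale_cvec cvec_eq_iff)
  then show "\<exists>x y. (x \<noteq> 0 \<or> y \<noteq> 0) \<and> T *v x = Re z *\<^sub>R x - Im z *\<^sub>R y \<and>
     T *v y = Im z *\<^sub>R x + Re z *\<^sub>R y" by blast
next
  assume "\<exists>x y. (x \<noteq> 0 \<or> y \<noteq> 0) \<and> T *v x = Re z *\<^sub>R x - Im z *\<^sub>R y \<and>
     T *v y = Im z *\<^sub>R x + Re z *\<^sub>R y"
  then obtain x y where "x \<noteq> 0 \<or> y \<noteq> 0" "T *v x = Re z *\<^sub>R x - Im z *\<^sub>R y"
    "T *v y = Im z *\<^sub>R x + Re z *\<^sub>R y" by blast
  then show "z \<in> cspec T"
    unfolding cspec_iff by (intro exI[of _ "cvec x y"]) (auto simp: cvec_0 cmat_cvec scale_cvec)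
qed

lemma of_real_cspec_iff: "of_real r \<in> cspec T \<longleftrightarrow> (\<exists>x. x \<noteq> 0 \<and> T *v x = r *\<^sub>R x)"
  unfolding cspec_iff_real by auto

lemma of_real_cspec_iff_poly: "of_real r \<in> cspec T \<longleftrightarrow> poly (charpoly T) r = 0"
  unfolding of_real_cspec_iff poly_charpoly det_eq_0_iff_ker
  by (auto simp: matrix_vector_mult_diff_rdistrib mat_vec_scale scalar_mult_eq_scaleR)

lemma cnj_cspec: "z \<in> cspec T \<Longrightarrow> cnj z \<in> cspec T"
  unfolding cspec_iff_real
proof (elim exE conjE)
  fix x y assume "x \<noteq> 0 \<or> y \<noteq> 0" "T *v x = Re z *\<^sub>R x - Im z *\<^sub>R y" "T *v y = Im z *\<^sub>R x + Re z *\<^sub>R y"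
  then show "\<exists>x y. (x \<noteq> 0 \<or> y \<noteq> 0) \<and> T *v x = Re (cnj z) *\<^sub>R x - Im (cnj z) *\<^sub>R y \<and>
     T *v y = Im (cnj z) *\<^sub>R x + Re (cnj z) *\<^sub>R y"
    by (intro exI[of _ x] exI[of _ "- y"]) (auto simp: mat_vec)
qed

text \<open>In the Leibniz formula a permutation contributes a polynomial of degree at most the
  number of its fixed points, so only the identity reaches \<open>CARD('n)\<close>.\<close>

lemma charpoly_monic: "degree (charpoly (T :: real^'n^'n)) = CARD('n)" "lead_coeff (charpoly T) = 1"
proof -
  define A where "A = mat [:0, 1:] - map_matrix (\<lambda>a. [:a:]) T"
  have A: "A $ i $ j = (if i = j then [:- (T $ i $ j), 1:] else [:- (T $ i $ j):])" for i j
    by (simp add: A_def mat_def)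
  define t where "t p = of_int (sign p) * (\<Prod>i\<in>UNIV. A $ i $ p i)" for p
  have ch: "charpoly T = (\<Sum>p | p permutes UNIV. t p)"
    by (simp add: charpoly_def A_def[symmetric] det_def t_def)
  have deg_t: "degree (t p) \<le> card {i. p i = i}" for p
  proof -
    have "degree (t p) \<le> degree (\<Prod>i\<in>UNIV. A $ i $ p i)"
      by (simp add: t_def sign_def)
    also have "\<dots> \<le> (\<Sum>i\<in>UNIV. degree (A $ i $ p i))"
      using degree_prod_sum_le[of UNIV "\<lambda>i. A $ i $ p i"] by (simp add: o_def)
    also have "\<dots> \<le> (\<Sum>i\<in>UNIV. if p i = i then 1 else 0)"
      by (rule sum_mono) (auto simp: A)
    also have "\<dots> = card {i. p i = i}" by (simp add: sum.If_cases)
    finally show ?thesis .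
  qed
  have t_id: "t id = (\<Prod>i\<in>UNIV. [:- (T $ i $ i), 1:])"
    by (simp add: t_def sign_id A)
  have c_id: "coeff (t id) CARD('n) = 1"
  proof -
    have "degree (t id) = CARD('n)"
      unfolding t_id by (subst degree_prod_eq_sum_degree) auto
    moreover have "lead_coeff (t id) = 1"
      unfolding t_id by (subst lead_coeff_prod) auto
    ultimately show ?thesis by simp
  qed
  have c_p: "coeff (t p) CARD('n) = 0" if ne: "p \<noteq> id" for p
  proof -
    obtain i where "p i \<noteq> i" using ne by (metis eq_id_iff)
    then have "card {i. p i = i} < CARD('n)" by (intro psubset_card_mono) auto
    then show ?thesis using deg_t[of p] by (intro coeff_eq_0) simp
  qed
  have "coeff (charpoly T) CARD('n) = (\<Sum>p | p permutes UNIV. coeff (t p) CARD('n))"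
    by (simp add: ch coeff_sum)
  also have "\<dots> = (\<Sum>p | p permutes (UNIV :: 'n set). if p = id then 1 else 0)"
    using c_id c_p by (intro sum.cong) auto
  also have "\<dots> = 1" by (simp add: permutes_id finite_permutations)
  finally have c: "coeff (charpoly T) CARD('n) = 1" .
  have "degree (t p) \<le> CARD('n)" for p
    using deg_t[of p] card_mono[of UNIV "{i. p i = i}"] by (simp add: order.trans)
  then have "degree (charpoly T) \<le> CARD('n)"
    unfolding ch by (intro degree_sum_le finite_permutations) auto
  then show d: "degree (charpoly T) = CARD('n)"
    using c by (metis le_degree le_antisym zero_neq_one)
  show "lead_coeff (charpoly T) = 1" using c d by simp
qed

lemma charpoly_nonzero: "charpoly T \<noteq> 0"
  using charpoly_monic(2)[of T] by auto

lemma finite_cspec: "finite (cspec T)"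
  and card_cspec: "card (cspec (T :: real^'n^'n)) \<le> CARD('n)"
proof -
  have nz: "map_poly complex_of_real (charpoly T) \<noteq> 0"
    using charpoly_nonzero[of T] by (simp add: map_poly_eq_0_iff)
  show "finite (cspec T)" unfolding cspec_def using poly_roots_finite[OF nz] by simp
  have "card (cspec T) \<le> degree (map_poly complex_of_real (charpoly T))"
    unfolding cspec_def by (rule card_poly_roots_bound[OF nz])
  then show "card (cspec T) \<le> CARD('n)"
    using charpoly_monic(1)[of T] by (simp add: degree_map_poly)
qed

lemma regularI:
  assumes "L \<subseteq> cspec (T :: real^'n^'n)" "CARD('n) \<le> card L"
  shows "regular T" "cspec T = L"
proof -
  have le: "card L \<le> card (cspec T)" using assms finite_cspec card_mono by blast
  then show "regular T" using assms card_cspec[of T] by (simp add: regular_def)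
  have "card (cspec T) \<le> card L" using assms card_cspec[of T] by simp
  then show "cspec T = L" using card_seteq[OF finite_cspec assms(1)] by simp
qed


section \<open>Matrices with distinct complex eigenvalues\<close>

lemma regular_diagonalizable:
  fixes T :: "real^'n^'n"
  assumes "regular T"
  obtains E :: "complex^'n^'n" and l :: "'n \<Rightarrow> complex"
  where "invertible E" "inj l" "cmat T ** E = E ** (\<chi> i j. if i = j then l i else 0)"
proof -
  have "card (UNIV :: 'n set) = card (cspec T)" using assms by (simp add: regular_def)
  then obtain l where l: "bij_betw l (UNIV :: 'n set) (cspec T)"
    using finite_same_card_bij[OF finite_class.finite_UNIV finite_cspec] by blast
  then have inj: "inj l" by (simp add: bij_betw_def)
  have "\<exists>v. v \<noteq> 0 \<and> cmat T *v v = l i *s v" for i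
    using l by (auto simp: cspec_iff[symmetric] bij_betw_def)
  then obtain v where v: "\<And>i. v i \<noteq> 0" "\<And>i. cmat T *v v i = l i *s v i" by metis
  define E where "E = (\<chi> r c. v c $ r)"
  have Ex: "E *v x = (\<Sum>i\<in>UNIV. x $ i *s v i)" for x
    by (simp add: E_def vec_eq_iff matrix_vector_mult_def mult.commute)
  have mv_sum: "A *v (\<Sum>i\<in>S. f i) = (\<Sum>i\<in>S. A *v f i)"
    for A :: "complex^'n^'n" and f :: "'n \<Rightarrow> complex^'n" and S
    by (induction S rule: infinite_finite_induct) (auto simp: matrix_vector_right_distrib)
  have "x = 0" if "E *v x = 0" for x
  proof -
    \<comment> \<open>Applying \<open>T - l k\<close> multiplies the coefficient of
      \<open>v i\<close> by \<open>l i - l k\<close>. After this is done for all indices but one, a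
      single term of the relation survives.\<close>
    have J: "(\<Sum>i\<in>UNIV. (x $ i * (\<Prod>j\<in>J. l i - l j)) *s v i) = 0" if "finite J" for J
      using that
    proof (induction J)
      case empty
      then show ?case using \<open>E *v x = 0\<close> Ex by simp
    next
      case (insert k J)
      let ?c = "\<lambda>i. x $ i * (\<Prod>j\<in>J. l i - l j)"
      have "(cmat T - mat (l k)) *v (\<Sum>i\<in>UNIV. ?c i *s v i)
          = (\<Sum>i\<in>UNIV. (cmat T - mat (l k)) *v (?c i *s v i))"
        by (rule mv_sum)
      also have "\<dots> = (\<Sum>i\<in>UNIV. (?c i * (l i - l k)) *s v i)"
        by (simp add: matrix_vector_mult_diff_rdistrib mat_vec_scale vector_scalar_commute v
            vec_eq_iff algebra_simps)
      finally show ?case using insert by (simp add: mult_ac)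
    qed
    have "x $ k = 0" for k
    proof -
      have "(\<Sum>i\<in>UNIV. (x $ i * (\<Prod>j\<in>UNIV - {k}. l i - l j)) *s v i)
          = (\<Sum>i\<in>UNIV. if i = k then (x $ k * (\<Prod>j\<in>UNIV - {k}. l k - l j)) *s v k else 0)"
        by (rule sum.cong) (auto simp: prod_zero_iff)
      then have "(x $ k * (\<Prod>j\<in>UNIV - {k}. l k - l j)) *s v k = 0"
        using J[of "UNIV - {k}"] by simp
      moreover have "(\<Prod>j\<in>UNIV - {k}. l k - l j) \<noteq> 0"
        using inj by (auto simp: inj_def)
      ultimately show ?thesis using v(1)[of k] by (simp add: vector_mul_eq_0)
    qed
    then show ?thesis by (simp add: vec_eq_iff)
  qed
  then have "invertible E"
    using invertible_left_inverse matrix_left_invertible_ker by blast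
  moreover have "cmat T ** E = E ** (\<chi> i j. if i = j then l i else 0)"
  proof -
    have "(cmat T ** E) $ r $ c = (E ** (\<chi> i j. if i = j then l i else 0)) $ r $ c" for r c
    proof -
      have "(cmat T ** E) $ r $ c = (cmat T *v v c) $ r"
        by (simp add: matrix_matrix_mult_def matrix_vector_mult_def E_def)
      also have "\<dots> = (E ** (\<chi> i j. if i = j then l i else 0)) $ r $ c"
        by (simp add: v(2) matrix_matrix_mult_def E_def if_distrib mult.commute cong: if_cong)
      finally show ?thesis .
    qed
    then show ?thesis by (simp add: vec_eq_iff)
  qed
  ultimately show thesis using that inj by blast
qed

text \<open>\<open>h\<close> is the conjugation of the complexified matrix into an eigenbasis of
  \<open>T\<close>, and \<open>w\<close> gives the coordinates of a real vector in it. The condition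
  on \<open>w\<close> covers injectivity (\<open>a = 0\<close>) and allows complex factors
  \<open>a\<close>. The last condition turns questions on the commutant into questions on diagonal
  matrices.\<close>

definition diagonalizes ::
  "real^'n^'n \<Rightarrow> (real^'n^'n \<Rightarrow> complex^'n^'n) \<Rightarrow> (real^'n \<Rightarrow> complex^'n) \<Rightarrow> ('n \<Rightarrow> complex) \<Rightarrow> bool"
  where "diagonalizes T h w l \<longleftrightarrow> inj l \<and> inj h \<and>
     (\<forall>A C. h (A ** C) = h A ** h C) \<and> (\<forall>A C. h (A - C) = h A - h C) \<and>
     (\<forall>i j. h T $ i $ j = (if i = j then l i else 0)) \<and>
     (\<forall>A x. w (A *v x) = h A *v w x) \<and> (\<forall>x a y. w y = a *s w x \<longleftrightarrow> cvec y 0 = a *s cvec x 0) \<and>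
     (\<forall>A. A ** T = T ** A \<longrightarrow> (\<exists>m. \<forall>i j. h A $ i $ j = (if i = j then m i else 0)))"

lemma regular_simultaneous:
  fixes T :: "real^'n^'n"
  assumes "regular T"
  obtains h w l where "diagonalizes T h w l"
proof -
  obtain E :: "complex^'n^'n" and l where E: "invertible E" "inj l" "cmat T ** E = E ** (\<chi> i j. if i = j then l i else 0)"
    by (rule regular_diagonalizable[OF assms])
  note Ei = matrix_inv_right[OF E(1)] matrix_inv_left[OF E(1)]
  define h where "h A = matrix_inv E ** cmat A ** E" for A
  define w where "w x = matrix_inv E *v cvec x 0" for x
  have inv: "cmat A = E ** h A ** matrix_inv E" for A
  proof -
    have "E ** h A ** matrix_inv E = (E ** matrix_inv E) ** cmat A ** (E ** matrix_inv E)"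
      by (simp add: h_def matrix_mul_assoc)
    then show ?thesis by (simp add: Ei)
  qed
  have mult: "h (A ** C) = h A ** h C" for A C
  proof -
    have "h A ** h C = matrix_inv E ** cmat A ** (E ** matrix_inv E) ** cmat C ** E"
      by (simp add: h_def matrix_mul_assoc)
    then show ?thesis by (simp add: Ei h_def cmat_simps matrix_mul_assoc)
  qed
  have hT: "h T = (\<chi> i j. if i = j then l i else 0)"
  proof -
    have "h T = matrix_inv E ** (cmat T ** E)" by (simp add: h_def matrix_mul_assoc)
    also have "\<dots> = (matrix_inv E ** E) ** (\<chi> i j. if i = j then l i else 0)"
      by (simp only: E(3) matrix_mul_assoc)
    finally show ?thesis by (simp add: Ei)
  qed
  have "diagonalizes T h w l"
    unfolding diagonalizes_def
  proof (intro conjI allI impI)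
    show "inj l" by fact
    show "inj h" by (rule injI) (metis inv cmat_inj)
    show "h (A ** C) = h A ** h C" for A C by (rule mult)
    show "h (A - C) = h A - h C" for A C
      by (simp add: h_def cmat_simps vec_eq_iff matrix_matrix_mult_def algebra_simps sum_subtractf sum_distrib_left)
    show "h T $ i $ j = (if i = j then l i else 0)" for i j by (simp add: hT)
    show "w (A *v x) = h A *v w x" for A x
    proof -
      have "h A *v w x = matrix_inv E *v (cmat A *v ((E ** matrix_inv E) *v cvec x 0))"
        by (simp add: h_def w_def matrix_vector_mul_assoc matrix_mul_assoc)
      then show ?thesis by (simp add: Ei w_def cmat_cvec)
    qed
    show "w y = a *s w x \<longleftrightarrow> cvec y 0 = a *s cvec x 0" for x a y
    proof -
      have "E *v w z = cvec z 0" for z by (simp add: w_def matrix_vector_mul_assoc Ei)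
      then show ?thesis unfolding w_def by (metis vector_scalar_commute)
    qed
    show "\<exists>m. \<forall>i j. h A $ i $ j = (if i = j then m i else 0)" if "A ** T = T ** A" for A
    proof -
      have "h A ** h T = h T ** h A" using mult that by metis
      then have "(h A ** h T) $ i $ j = (h T ** h A) $ i $ j" for i j by simp
      then have "h A $ i $ j * l j = l i * h A $ i $ j" for i j
        by (simp add: hT matrix_matrix_mult_def if_distrib if_distribR cong: if_cong)
      moreover have "l i \<noteq> l j" if "i \<noteq> j" for i j using E(2) that by (auto simp: inj_def)
      ultimately have "h A $ i $ j = 0" if "i \<noteq> j" for i j
        using that by (metis mult.commute mult_cancel_left)
      then show ?thesis by (intro exI[of _ "\<lambda>i. h A $ i $ i"]) auto
    qed
  qed
  then show thesis by (rule that)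
qed

text \<open>In an eigenbasis of \<open>T\<close> both matrices are diagonal.\<close>

lemma regular_commutant_commutes:
  fixes T :: "real^'a^'a"
  assumes T: "regular T" and "A ** T = T ** A" "C ** T = T ** C"
  shows "A ** C = C ** A"
proof -
  obtain h w l where D: "diagonalizes T h w l"
    by (rule regular_simultaneous[OF T])
  have h: "inj h" "\<And>A C. h (A ** C) = h A ** h C"
    and d: "\<And>A. A ** T = T ** A \<Longrightarrow> \<exists>m. \<forall>i j. h A $ i $ j = (if i = j then m i else 0)"
    using D unfolding diagonalizes_def by blast+
  obtain a c where ac: "\<And>i j. h A $ i $ j = (if i = j then a i else 0)"
    "\<And>i j. h C $ i $ j = (if i = j then c i else 0)"
    using d[OF assms(2)] d[OF assms(3)] by blast
  have diag: "(M ** N) $ i $ j = (if i = j then m i * n i else 0)"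
    if "\<And>i j. M $ i $ j = (if i = j then m i else 0)" "\<And>i j. N $ i $ j = (if i = j then n i else 0)"
    for M N :: "complex^'a^'a" and m n i j
  proof -
    have "(M ** N) $ i $ j = (\<Sum>k\<in>UNIV. if k = i then m i * N $ i $ j else 0)"
      unfolding matrix_matrix_mult_def vec_lambda_beta
      by (rule sum.cong[OF refl]) (auto simp: that(1))
    then show ?thesis by (simp add: that(2))
  qed
  have "h A ** h C = h C ** h A"
    by (simp add: vec_eq_iff diag[OF ac] diag[OF ac(2,1)] mult.commute)
  then show ?thesis using h by (metis injD)
qed

text \<open>In an eigenbasis of \<open>T\<close> a commutator with \<open>T\<close> has zero
  diagonal, while a matrix commuting with \<open>T\<close> is diagonal. So kernel and range of
  \<open>[T, -]\<close> meet only in 0.\<close>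

lemma regular_ad_semisimple:
  assumes T: "regular T" and W: "W = T ** Y - Y ** T" "W ** T = T ** W"
  shows "W = 0"
proof -
  obtain h w l where D: "diagonalizes T h w l"
    by (rule regular_simultaneous[OF T])
  have h: "inj h" "\<And>A C. h (A ** C) = h A ** h C" "\<And>A C. h (A - C) = h A - h C"
    and hT: "\<And>i j. h T $ i $ j = (if i = j then l i else 0)"
    and d: "\<And>A. A ** T = T ** A \<Longrightarrow> \<exists>m. \<forall>i j. h A $ i $ j = (if i = j then m i else 0)"
    using D unfolding diagonalizes_def by blast+
  obtain m where hW: "\<And>i j. h W $ i $ j = (if i = j then m i else 0)" using d[OF W(2)] by blast
  have "h W = h T ** h Y - h Y ** h T" by (simp only: W(1) h)
  then have "h W $ i $ i = 0" for i
    by (simp add: matrix_matrix_mult_def hT if_distrib if_distribR cong: if_cong)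
  then have "m i = 0" for i using hW[of i i] by simp
  then have "h W = h (W - W)" unfolding h(3) by (simp add: vec_eq_iff hW)
  then show ?thesis using h(1) by (auto dest: injD)
qed

text \<open>\<open>Z\<close> is diagonal in an eigenbasis of \<open>T\<close>, and a diagonal matrix
  kills a vector as soon as its square does.\<close>

lemma regular_commutant_semisimple:
  assumes T: "regular T" and Z: "Z ** T = T ** Z" "Z *v (Z *v x) = 0"
  shows "Z *v x = 0"
proof -
  obtain h w l where D: "diagonalizes T h w l"
    by (rule regular_simultaneous[OF T])
  have d: "\<And>A. A ** T = T ** A \<Longrightarrow> \<exists>m. \<forall>i j. h A $ i $ j = (if i = j then m i else 0)"
    and w: "\<And>A x. w (A *v x) = h A *v w x" "\<And>x a y. w y = a *s w x \<longleftrightarrow> cvec y 0 = a *s cvec x 0"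
    using D unfolding diagonalizes_def by blast+
  have w0: "w y = 0 \<longleftrightarrow> y = 0" for y using w(2)[of y 0 0] by (simp add: cvec_0)
  obtain m where hZ: "\<And>i j. h Z $ i $ j = (if i = j then m i else 0)" using d[OF Z(1)] by blast
  have hv: "(h Z *v u) $ i = m i * u $ i" for u i
    by (simp add: hZ matrix_vector_mult_def if_distrib if_distribR cong: if_cong)
  have "h Z *v (h Z *v w x) = 0" using w w0 Z(2) by metis
  then have "m i * (m i * w x $ i) = 0" for i
    by (metis hv zero_index)
  then have "(h Z *v w x) $ i = 0" for i using hv[of "w x" i] by simp
  then show ?thesis using w0 w(1) by (metis vec_eq_iff zero_index)
qed

text \<open>As the eigenvalues are distinct, both vectors have only one nonzero coordinate in the
  eigenbasis, the same for both. The ratio is complex at first; as the vectors are real, its real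
  part serves.\<close>

lemma regular_eigenspace:
  assumes T: "regular T" and xy: "T *v x = c *\<^sub>R x" "T *v y = c *\<^sub>R y" and "x \<noteq> 0"
  obtains a where "y = a *\<^sub>R x"
proof -
  obtain h w l where D: "diagonalizes T h w l"
    by (rule regular_simultaneous[OF T])
  have l: "inj l" and hT: "\<And>i j. h T $ i $ j = (if i = j then l i else 0)"
    and w: "\<And>A x. w (A *v x) = h A *v w x" "\<And>x a y. w y = a *s w x \<longleftrightarrow> cvec y 0 = a *s cvec x 0"
    using D unfolding diagonalizes_def by blast+
  have w0: "w y = 0 \<longleftrightarrow> y = 0" for y using w(2)[of y 0 0] by (simp add: cvec_0)
  have ev: "l i * w u $ i = c * w u $ i" if "T *v u = c *\<^sub>R u" for u i
  proof -
    have "w (c *\<^sub>R u) = c *s w u" using w(2)[of "c *\<^sub>R u" c u] by (simp add: scale_cvec)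
    then have "h T *v w u = c *s w u" using w(1) that by metis
    then have "(h T *v w u) $ i = c * w u $ i" by simp
    then show ?thesis by (simp add: matrix_vector_mult_def hT if_distrib if_distribR cong: if_cong)
  qed
  obtain k where k: "w x $ k \<noteq> 0" using w0[of x] \<open>x \<noteq> 0\<close> by (auto simp: vec_eq_iff)
  then have "l k = c" using ev[OF xy(1), of k] by simp
  then have z: "w u $ i = 0" if "T *v u = c *\<^sub>R u" "i \<noteq> k" for u i
    using ev[OF that(1), of i] l that(2) by (auto simp: inj_def)
  have "w y $ i = w y $ k / w x $ k * w x $ i" for i
    using k z[OF xy(1), of i] z[OF xy(2), of i] by (cases "i = k") simp_all
  then have "w y = (w y $ k / w x $ k) *s w x"
    unfolding vec_eq_iff vector_smult_component by blast
  then have "cvec y 0 = (w y $ k / w x $ k) *s cvec x 0" using w(2) by blast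
  then have "y = Re (w y $ k / w x $ k) *\<^sub>R x" by (simp add: scale_cvec cvec_eq_iff)
  then show thesis by (rule that)
qed

section \<open>Centralizers and commutants\<close>

context lorentz
begin

lemma cay_near_0:
  obtains d where "d > 0"
    "\<And>X. norm X < d \<Longrightarrow> invertible (mat 1 - X) \<and> B e0 (cay X *v e0) > 0"
proof -
  let ?I = "{X :: real^'n^'n. invertible (mat 1 - X)}"
  have I: "open ?I" by (rule open_invertible_minus)
  have "continuous_on ?I (\<lambda>X. B e0 (cay X *v e0))"
    unfolding cay_def by (intro continuous_intros mm.continuous_on mv.continuous_on) auto
  then have "open (?I \<inter> (\<lambda>X. B e0 (cay X *v e0)) -` {0<..})"
    using I continuous_on_open_vimage by (metis inf_commute open_greaterThan)
  moreover have "0 \<in> ?I \<inter> (\<lambda>X. B e0 (cay X *v e0)) -` {0<..}" by simp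
  ultimately obtain d where "d > 0" "ball 0 d \<subseteq> ?I \<inter> (\<lambda>X. B e0 (cay X *v e0)) -` {0<..}"
    by (rule openE)
  then show thesis using that[of d] by (auto simp: subset_iff)
qed

text \<open>Scaling does not affect commutation, and it brings \<open>X\<close> so close to 0 that
  \<open>cay\<close> is defined and its value stays on the right sheet.\<close>

lemma small_cay_G:
  assumes "X \<in> skew"
  obtains t where "t > 0" "invertible (mat 1 - t *\<^sub>R X)" "cay (t *\<^sub>R X) \<in> G"
proof -
  obtain d where d: "d > 0" "\<And>X. norm X < d \<Longrightarrow> invertible (mat 1 - X) \<and> B e0 (cay X *v e0) > 0"
    by (rule cay_near_0) blast
  define t where "t = d / (norm X + 1)"
  have t: "t > 0" using d by (simp add: t_def add_nonneg_pos)
  have "norm (t *\<^sub>R X) = d * (norm X / (norm X + 1))" using d(1) by (simp add: t_def)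
  also have "\<dots> < d * 1" using d(1) by (intro mult_strict_left_mono) (auto simp: divide_less_eq_1 add_nonneg_pos)
  finally have "norm (t *\<^sub>R X) < d" by simp
  then have i: "invertible (mat 1 - t *\<^sub>R X)" "B e0 (cay (t *\<^sub>R X) *v e0) > 0" using d(2) by blast+
  have "t *\<^sub>R X \<in> skew" using assms subspace_skew by (simp add: subspace_def)
  then have "cay (t *\<^sub>R X) \<in> G" using i by (simp add: G_iff cay_OB)
  then show thesis using that t i by blast
qed

section \<open>Reflections in negative vectors\<close>

definition reflection :: "real^'n \<Rightarrow> real^'n^'n" where
  "reflection w = matrix (\<lambda>x. x - (2 * B x w / B w w) *\<^sub>R w)"

lemma reflection_apply: "reflection w *v x = x - (2 * B x w / B w w) *\<^sub>R w"
proof -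
  have "linear (\<lambda>x. x - (2 * B x w / B w w) *\<^sub>R w)"
    by (rule linearI) (auto simp: algebra_simps add_divide_distrib)
  then show ?thesis unfolding reflection_def by (simp add: matrix_works)
qed

text \<open>The sheet is preserved because
  \<open>B e0 (reflection w *v e0) = 1 - 2 (B e0 w)^2 / B w w\<close>, which is at least 1 for
  negative \<open>w\<close>.\<close>

lemma reflection_G: "B w w < 0 \<Longrightarrow> reflection w \<in> G"
proof -
  assume w: "B w w < 0"
  have "B (reflection w *v x) (reflection w *v x) = B x x" for x
    using w by (simp add: reflection_apply B_sym[of w x] field_simps)
  moreover have "B e0 (reflection w *v e0) = 1 - 2 * (B e0 w)\<^sup>2 / B w w"
    by (simp add: reflection_apply power2_eq_square)
  moreover have "2 * (B e0 w)\<^sup>2 / B w w \<le> 0"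
    using w by (intro divide_nonneg_neg) auto
  ultimately show ?thesis by (auto simp: G_iff OB_iff)
qed

lemma reflection_commute:
  assumes S: "S \<in> OB" and w: "S *v w = c *\<^sub>R w" "c * c = 1"
  shows "reflection w ** S = S ** reflection w"
proof -
  have "c * B (S *v x) w = B x w" for x
  proof -
    have "B x w = B (S *v x) (S *v w)" using S by simp
    then show ?thesis using w by simp
  qed
  then have "B (S *v x) w = c * B x w" for x
    using w(2) by (metis mult.assoc mult_1)
  then have "reflection w *v (S *v x) = S *v (reflection w *v x)" for x
    by (simp add: reflection_apply mat_vec w)
  then show ?thesis by (simp add: matrix_eq matrix_vector_mul_assoc)
qed

text \<open>\<open>T *v w\<close> lies in the eigenspace of the reflection for -1, which is the line
  of \<open>w\<close>.\<close>

lemma reflection_commute_eigen: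
  assumes "reflection w ** T = T ** reflection w" "B w w < 0"
  obtains c where "T *v w = c *\<^sub>R w"
proof -
  define r where "r = B (T *v w) w / B w w"
  have "reflection w *v (T *v w) = T *v (reflection w *v w)"
    using assms(1) by (simp add: matrix_vector_mul_assoc)
  moreover have "reflection w *v w = - w"
    using assms(2) by (simp add: reflection_apply vec_eq_iff)
  ultimately have "reflection w *v (T *v w) = - (T *v w)" by (simp only: mv.minus_right)
  then have *: "T *v w - (2 * B (T *v w) w / B w w) *\<^sub>R w = - (T *v w)"
    by (simp only: reflection_apply)
  have "(T *v w) $ i = (r *\<^sub>R w) $ i" for i
    using arg_cong[OF *, of "\<lambda>v. v $ i"] by (simp add: r_def)
  then have "T *v w = r *\<^sub>R w" by (simp add: vec_eq_iff)
  then show thesis by (rule that)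
qed

section \<open>From centralizers in the group to commutants in the matrix algebra\<close>

lemma adj_commute: "S \<in> OB \<Longrightarrow> Y ** S = S ** Y \<Longrightarrow> Y ** adj S = adj S ** Y"
  using matrix_inv_commute[of S Y] by (simp add: OB_D)

lemma commute_adj:
  assumes S: "S \<in> OB" and c: "Y ** S = S ** Y"
  shows "adj Y ** S = S ** adj Y"
proof -
  have "adj (Y ** adj S) = adj (adj S ** Y)" using adj_commute[OF assms] by simp
  then show ?thesis by simp
qed

text \<open>The Cayley transform of a small multiple of \<open>X\<close> lies in the centralizer of
  \<open>S\<close>, and \<open>X\<close> is recovered from the transform. So equality of
  centralizers passes to the Lie algebra.\<close>

lemma skew_commutant:
  assumes "centralizer G S = centralizer G T" and X: "X \<in> skew" "X ** S = S ** X"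
  shows "X ** T = T ** X"
proof -
  obtain t where t: "t > 0" "invertible (mat 1 - t *\<^sub>R X)" "cay (t *\<^sub>R X) \<in> G"
    using small_cay_G[OF X(1)] .
  have "cay (t *\<^sub>R X) ** S = S ** cay (t *\<^sub>R X)"
    by (rule cay_commute[OF t(2)]) (simp add: mat_ring X)
  then have "cay (t *\<^sub>R X) \<in> centralizer G T"
    using assms(1) t(3) unfolding centralizer_def by blast
  then have "(t *\<^sub>R X) ** T = T ** (t *\<^sub>R X)"
    using cay_commute_rev[OF t(2)] by (simp add: centralizer_def)
  then show ?thesis using t(1) by (simp add: mat_ring)
qed

text \<open>The reflections in the negative vectors of the eigenspace commute with \<open>S\<close>, hence with \<open>T\<close>, so
  that these vectors are eigenvectors of \<open>T\<close>.\<close>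

lemma eigenspace_le_1:
  assumes T: "regular T" and S: "S \<in> G" and cen: "centralizer G S = centralizer G T"
    and c: "c * c = 1" and x: "S *v x = c *\<^sub>R x" "x \<noteq> 0" and y: "S *v y = c *\<^sub>R y"
  shows "\<exists>a. y = a *\<^sub>R x"
proof (rule ccontr)
  assume indep: "\<not> ?thesis"
  have ev: "\<exists>k. T *v v = k *\<^sub>R v" if "S *v v = c *\<^sub>R v" "B v v < 0" for v
  proof -
    have "reflection v \<in> centralizer G S"
      using reflection_G[OF that(2)] reflection_commute[OF G_OB[OF S] that(1) c] by (simp add: centralizer_def)
    then have "reflection v ** T = T ** reflection v" unfolding cen by (simp add: centralizer_def)
    then show ?thesis using reflection_commute_eigen that(2) by metis
  qed
  \<comment> \<open>A plane inside the eigenspace meets the hyperplane orthogonal to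
    \<open>e0\<close>, where the form is negative definite.\<close>
  have "\<exists>w. S *v w = c *\<^sub>R w \<and> w \<noteq> 0 \<and> B e0 w = 0"
  proof (cases "B e0 x = 0")
    case True
    then show ?thesis using x by blast
  next
    case False
    let ?w = "y - (B e0 y / B e0 x) *\<^sub>R x"
    have "S *v ?w = c *\<^sub>R ?w" using x y by (simp add: mat_vec algebra_simps)
    moreover have "?w \<noteq> 0" using indep by auto
    moreover have "B e0 ?w = 0" using False by simp
    ultimately show ?thesis by blast
  qed
  then obtain w where w: "S *v w = c *\<^sub>R w" "w \<noteq> 0" "B w w < 0" using B_neg by blast
  have "\<exists>z. S *v z = c *\<^sub>R z \<and> (\<forall>a. z \<noteq> a *\<^sub>R w)"
  proof (rule ccontr)
    assume "\<not> ?thesis"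
    then obtain a b where ab: "x = a *\<^sub>R w" "y = b *\<^sub>R w" using x y by metis
    then have "y = (b / a) *\<^sub>R x" using x(2) by auto
    then show False using indep by blast
  qed
  then obtain z where z: "S *v z = c *\<^sub>R z" "\<And>a. z \<noteq> a *\<^sub>R w" by blast
  obtain k where k: "T *v w = k *\<^sub>R w" using ev w by blast
  have "open ((\<lambda>t. B (w + t *\<^sub>R z) (w + t *\<^sub>R z)) -` {..<0})"
    by (intro open_vimage continuous_intros)
  moreover have "0 \<in> (\<lambda>t. B (w + t *\<^sub>R z) (w + t *\<^sub>R z)) -` {..<0}" using w(3) by simp
  ultimately obtain e where e: "e > 0" "ball 0 e \<subseteq> (\<lambda>t. B (w + t *\<^sub>R z) (w + t *\<^sub>R z)) -` {..<0}"
    by (rule openE)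
  have ex: "\<exists>m. T *v z = m *\<^sub>R z + ((m - k) / t) *\<^sub>R w" if "0 < t" "t < e" for t
  proof -
    have "t \<in> ball 0 e" using that by simp
    then have "B (w + t *\<^sub>R z) (w + t *\<^sub>R z) < 0" using e(2) by blast
    moreover have "S *v (w + t *\<^sub>R z) = c *\<^sub>R (w + t *\<^sub>R z)" using w z by (simp add: mat_vec algebra_simps)
    ultimately obtain m where "T *v (w + t *\<^sub>R z) = m *\<^sub>R (w + t *\<^sub>R z)" using ev by blast
    then have "k *\<^sub>R w + t *\<^sub>R (T *v z) = m *\<^sub>R w + t *\<^sub>R (m *\<^sub>R z)"
      using k by (simp add: mat_vec algebra_simps)
    then have "t *\<^sub>R (T *v z) = t *\<^sub>R (m *\<^sub>R z) + (m - k) *\<^sub>R w"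
      by (simp add: algebra_simps)
    then have "(1/t) *\<^sub>R (t *\<^sub>R (T *v z)) = (1/t) *\<^sub>R (t *\<^sub>R (m *\<^sub>R z) + (m - k) *\<^sub>R w)" by simp
    then have "T *v z = m *\<^sub>R z + ((m - k) / t) *\<^sub>R w"
      using that(1) by (simp add: scaleR_add_right)
    then show ?thesis by blast
  qed
  \<comment> \<open>Two values of \<open>t\<close> are compared. As \<open>z\<close> and
    \<open>w\<close> are independent, their coefficients give \<open>m1 = m2 = k\<close>, so
    \<open>w\<close> and \<open>z\<close> both lie in the eigenspace of \<open>T\<close> for
    \<open>k\<close>, which is a line.\<close>
  obtain m1 where m1: "T *v z = m1 *\<^sub>R z + ((m1 - k) / (e/2)) *\<^sub>R w" using ex[of "e/2"] e(1) by auto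
  obtain m2 where m2: "T *v z = m2 *\<^sub>R z + ((m2 - k) / (e/3)) *\<^sub>R w" using ex[of "e/3"] e(1) by auto
  have eq: "(m1 - m2) *\<^sub>R z = ((m2 - k) / (e/3) - (m1 - k) / (e/2)) *\<^sub>R w"
    using m1 m2 by (simp add: algebra_simps)
  have "m1 = m2"
  proof (rule ccontr)
    assume "m1 \<noteq> m2"
    then have "(1 / (m1 - m2)) *\<^sub>R ((m1 - m2) *\<^sub>R z) = z" by simp
    then have "z = (1 / (m1 - m2)) *\<^sub>R (((m2 - k) / (e/3) - (m1 - k) / (e/2)) *\<^sub>R w)" using eq by simp
    then show False using z(2) by simp
  qed
  then have "m1 = k" using eq w(2) e(1) by (auto simp: field_simps)
  then have "T *v z = k *\<^sub>R z" using m1 by simp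
  then show False using regular_eigenspace[OF T k] w(2) z(2) by metis
qed

text \<open>If \<open>Y\<close> commutes with \<open>S\<close> and \<open>Z = S - S\<^sup>-\<^sup>1\<close>, then \<open>Z Y\<close> is a combination of skew matrices commuting
  with \<open>S\<close> and products of such, and Cayley transforms of small skew matrices are isometries; so
  \<open>Z Y\<close> commutes with \<open>T\<close>. This leaves the kernel of \<open>Z\<close>, the sum of the eigenspaces of \<open>S\<close> for 1 and -1,
  which are at most one-dimensional.\<close>

lemma commutant_eq:
  assumes T: "regular T" and S: "S \<in> G" and cen: "centralizer G S = centralizer G T"
  shows "Y ** S = S ** Y \<longleftrightarrow> Y ** T = T ** Y"
proof
  have SO: "S \<in> OB" using S by (rule G_OB)
  have "S \<in> centralizer G S" using S by (simp add: centralizer_def)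
  then have ST: "S ** T = T ** S" unfolding cen by (simp add: centralizer_def)
  then have aST: "adj S ** T = T ** adj S" using adj_commute[OF SO, of T] by simp
  show "Y ** T = T ** Y \<Longrightarrow> Y ** S = S ** Y" using regular_commutant_commutes[OF T _ ST] .
  assume Y: "Y ** S = S ** Y"
  have aY: "adj Y ** S = S ** adj Y" using commute_adj[OF SO Y] .
  define Z where "Z = S - adj S"
  have Zskew: "adj Z = - Z" by (simp add: Z_def)
  have ZT: "Z ** T = T ** Z" using ST aST by (simp add: Z_def mat_ring)
  have ZM: "Z ** V = V ** Z" if "V ** S = S ** V" for V
    using that adj_commute[OF SO that] by (simp add: Z_def mat_ring)
  have ZS: "Z ** S = S ** Z" using ZM[of S] OB_D[OF SO] by (simp add: Z_def mat_ring)
  have sk: "Y - adj Y \<in> skew" by (simp add: skew_def)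
  then have 1: "(Y - adj Y) ** T = T ** (Y - adj Y)"
    by (rule skew_commutant[OF cen]) (use Y aY in \<open>simp add: mat_ring\<close>)
  \<comment> \<open>\<open>Y + adj Y\<close> is self-adjoint; its product with the skew
    \<open>Z\<close>, which commutes with it, is skew.\<close>
  have "(Z ** (Y + adj Y)) ** T = T ** (Z ** (Y + adj Y))"
  proof (rule skew_commutant[OF cen])
    show "Z ** (Y + adj Y) \<in> skew"
      using ZM[OF Y] ZM[OF aY] by (simp add: skew_def Zskew mat_ring)
    show "Z ** (Y + adj Y) ** S = S ** (Z ** (Y + adj Y))"
      by (rule commute_mult[OF ZS]) (use Y aY in \<open>simp add: mat_ring\<close>)
  qed
  moreover have "(Z ** (Y - adj Y)) ** T = T ** (Z ** (Y - adj Y))"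
    by (rule commute_mult[OF ZT 1])
  ultimately have "(Z ** (Y + adj Y) + Z ** (Y - adj Y)) ** T = T ** (Z ** (Y + adj Y) + Z ** (Y - adj Y))"
    by (simp only: mm.add_left mm.add_right)
  moreover have "Z ** (Y + adj Y) + Z ** (Y - adj Y) = 2 *\<^sub>R (Z ** Y)"
    by (simp add: mm.add_right mm.diff_right scaleR_2)
  ultimately have ZYT: "(Z ** Y) ** T = T ** (Z ** Y)"
    by (simp add: mm.scaleR_left mm.scaleR_right)
  define A where "A = Y ** T - T ** Y"
  have AZ: "A ** Z = 0"
  proof -
    have "A ** Z = Y ** (T ** Z) - T ** (Y ** Z)" by (simp add: A_def mat_ring)
    also have "\<dots> = (Y ** Z) ** T - T ** (Z ** Y)" by (simp add: ZT[symmetric] ZM[OF Y] matrix_mul_assoc)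
    also have "\<dots> = 0" by (simp add: ZM[OF Y, symmetric] ZYT)
    finally show ?thesis .
  qed
  have AE: "A *v u = 0" if u: "S *v u = c *\<^sub>R u" "c * c = 1" for u c
  proof (cases "u = 0")
    case False
    have "S *v (Y *v u) = c *\<^sub>R (Y *v u)"
      using Y u(1) by (simp add: matrix_vector_mul_assoc Y[symmetric]) (simp add: mat_vec)
    then obtain a where a: "Y *v u = a *\<^sub>R u"
      using eigenspace_le_1[OF T S cen u(2) u(1) False] by blast
    have "S *v (T *v u) = c *\<^sub>R (T *v u)"
      using u(1) by (simp add: matrix_vector_mul_assoc ST) (simp add: mat_vec)
    then obtain b where b: "T *v u = b *\<^sub>R u"
      using eigenspace_le_1[OF T S cen u(2) u(1) False] by blast
    show ?thesis by (simp add: A_def mat_vec a b)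
  qed simp
  have "A *v x = 0" for x
  proof -
    obtain k y where ky: "Z *v k = 0" "x = k + Z *v y"
      using linear_ker_im_decomposition[of "(*v) Z" x] regular_commutant_semisimple[OF T ZT]
      by (metis matrix_vector_mul_linear)
    \<comment> \<open>On the kernel of \<open>Z\<close> the square of \<open>S\<close> is the
      identity, so \<open>k + S *v k\<close> and \<open>k - S *v k\<close> lie in the eigenspaces
      for 1 and -1.\<close>
    have "S *v k = adj S *v k" using ky(1) by (simp add: Z_def mat_vec)
    then have SSk: "S *v (S *v k) = k" using OB_D[OF SO] by (simp add: matrix_vector_mul_assoc)
    have "A *v (k + S *v k) = 0"
      by (rule AE[of _ 1]) (simp_all add: mat_vec SSk)
    then have 1: "A *v k + A *v (S *v k) = 0" by (simp only: mv.add_right)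
    have "A *v (k - S *v k) = 0"
      by (rule AE[of _ "-1"]) (simp_all add: mat_vec SSk)
    then have 2: "A *v k - A *v (S *v k) = 0" by (simp only: mv.diff_right)
    have "(A *v k) $ i = 0" for i
      using arg_cong[OF 1, of "\<lambda>v. v $ i"] arg_cong[OF 2, of "\<lambda>v. v $ i"] by simp
    then have "A *v k = 0" by (simp add: vec_eq_iff)
    then show ?thesis using AZ by (simp add: ky(2) mv.add_right matrix_vector_mul_assoc)
  qed
  then have "A = 0" by (simp add: matrix_eq)
  then show "Y ** T = T ** Y" by (simp add: A_def)
qed

end

section \<open>Strict differentiability\<close>

text \<open>Strict differentiability at 0: both points vary near 0. An injective \<open>L\<close>
  then makes \<open>f\<close> injective near 0, and no derivative away from 0 has to be
  computed.\<close>

definition strict_deriv :: "('a::real_normed_vector \<Rightarrow> 'b::real_normed_vector) \<Rightarrow> ('a \<Rightarrow> 'b) \<Rightarrow> bool"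
  where "strict_deriv f L \<longleftrightarrow> bounded_linear L \<and> (\<forall>e>0. \<exists>d>0. \<forall>x y. norm x < d \<longrightarrow> norm y < d \<longrightarrow>
     norm (f x - f y - L (x - y)) \<le> e * norm (x - y))"

lemma strict_derivD:
  assumes "strict_deriv f L" "e > 0"
  obtains d where "d > 0"
    "\<And>x y. norm x < d \<Longrightarrow> norm y < d \<Longrightarrow> norm (f x - f y - L (x - y)) \<le> e * norm (x - y)"
  using assms unfolding strict_deriv_def by blast

lemma strict_deriv_lipschitz:
  assumes "strict_deriv f L"
  obtains K d where "K > 0" "d > 0"
    "\<And>x y. norm x < d \<Longrightarrow> norm y < d \<Longrightarrow> norm (f x - f y) \<le> K * norm (x - y)"
proof -
  obtain d where d: "d > 0"
    "\<And>x y. norm x < d \<Longrightarrow> norm y < d \<Longrightarrow> norm (f x - f y - L (x - y)) \<le> 1 * norm (x - y)"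
    using strict_derivD[OF assms, of 1] by auto
  obtain M where M: "M > 0" "\<And>x. norm (L x) \<le> norm x * M"
    using assms bounded_linear.pos_bounded unfolding strict_deriv_def by blast
  have "norm (f x - f y) \<le> (M + 1) * norm (x - y)" if "norm x < d" "norm y < d" for x y
  proof -
    have "norm (f x - f y) \<le> norm (f x - f y - L (x - y)) + norm (L (x - y))"
      by (rule norm_triangle_sub[of "f x - f y" "L (x - y)", THEN order_trans]) simp
    also have "\<dots> \<le> 1 * norm (x - y) + norm (x - y) * M" by (intro add_mono d M that)
    finally show ?thesis by (simp add: algebra_simps)
  qed
  then show thesis using that[of "M + 1" d] M d by simp
qed

lemma strict_deriv_const: "strict_deriv (\<lambda>x. c) (\<lambda>x. 0)"
  unfolding strict_deriv_def by (auto intro!: exI[of _ 1])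

lemma strict_deriv_compose_linear:
  fixes f :: "'b::real_normed_vector \<Rightarrow> 'c::real_normed_vector" and g :: "'a::real_normed_vector \<Rightarrow> 'b"
  assumes f: "strict_deriv f L" and g: "bounded_linear g"
  shows "strict_deriv (\<lambda>x. f (g x)) (\<lambda>x. L (g x))"
  unfolding strict_deriv_def
proof (intro conjI allI impI)
  show "bounded_linear (\<lambda>x. L (g x))"
    using f g bounded_linear_compose unfolding strict_deriv_def by blast
  fix e :: real assume e: "e > 0"
  obtain M where M: "M > 0" "\<And>x. norm (g x) \<le> norm x * M"
    using g bounded_linear.pos_bounded by blast
  obtain d where d: "d > 0"
    "\<And>x y. norm x < d \<Longrightarrow> norm y < d \<Longrightarrow> norm (f x - f y - L (x - y)) \<le> e / M * norm (x - y)"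
    using strict_derivD[OF f, of "e / M"] e M by auto
  show "\<exists>d>0. \<forall>(x :: 'a) y :: 'a. norm x < d \<longrightarrow> norm y < d \<longrightarrow>
     norm (f (g x) - f (g y) - L (g (x - y))) \<le> e * norm (x - y)"
  proof (intro exI[of _ "d / M"] conjI allI impI)
    show "d / M > 0" using d M by simp
    fix x y :: 'a assume xy: "norm x < d / M" "norm y < d / M"
    have "norm (g x) < d" "norm (g y) < d"
      using M xy by (auto simp: field_simps intro: le_less_trans[OF M(2)])
    then have "norm (f (g x) - f (g y) - L (g x - g y)) \<le> e / M * norm (g x - g y)" by (rule d(2))
    also have "\<dots> = e / M * norm (g (x - y))" by (simp add: linear_diff[OF bounded_linear.linear[OF g]])
    also have "\<dots> \<le> e / M * (norm (x - y) * M)" using e M by (intro mult_left_mono M) auto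
    finally show "norm (f (g x) - f (g y) - L (g (x - y))) \<le> e * norm (x - y)"
      using M by (simp add: linear_diff[OF bounded_linear.linear[OF g]])
  qed
qed

lemma strict_deriv_bilinear:
  fixes pr :: "'b::real_normed_vector \<Rightarrow> 'c::real_normed_vector \<Rightarrow> 'd::real_normed_vector"
    and f :: "'a::real_normed_vector \<Rightarrow> 'b" and g :: "'a \<Rightarrow> 'c"
  assumes b: "bounded_bilinear pr" and f: "strict_deriv f L" and g: "strict_deriv g M"
  shows "strict_deriv (\<lambda>x. pr (f x) (g x)) (\<lambda>h. pr (L h) (g 0) + pr (f 0) (M h))"
  unfolding strict_deriv_def
proof (intro conjI allI impI)
  interpret bounded_bilinear pr by (rule b)
  have LM: "bounded_linear L" "bounded_linear M" using f g by (auto simp: strict_deriv_def)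
  show "bounded_linear (\<lambda>h. pr (L h) (g 0) + pr (f 0) (M h))"
    by (intro bounded_linear_add bounded_linear_compose[OF bounded_linear_left LM(1)]
        bounded_linear_compose[OF bounded_linear_right LM(2)])
  fix e :: real assume e: "e > 0"
  obtain K where K: "K > 0" "\<And>a b. norm (pr a b) \<le> norm a * norm b * K"
    using pos_bounded by blast
  obtain Kf df where Kf: "Kf > 0" "df > 0"
    "\<And>x y. norm x < df \<Longrightarrow> norm y < df \<Longrightarrow> norm (f x - f y) \<le> Kf * norm (x - y)"
    using strict_deriv_lipschitz[OF f] by blast
  obtain Kg dg where Kg: "Kg > 0" "dg > 0"
    "\<And>x y. norm x < dg \<Longrightarrow> norm y < dg \<Longrightarrow> norm (g x - g y) \<le> Kg * norm (x - y)"
    using strict_deriv_lipschitz[OF g] by blast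
  define R where "R = norm (f 0) + norm (g 0) + 1"
  have R: "R > 0" by (simp add: R_def add_nonneg_pos)
  define e' where "e' = e / (4 * K * R)"
  have e': "e' > 0" using e K R by (simp add: e'_def)
  obtain d1 where d1: "d1 > 0"
    "\<And>x y. norm x < d1 \<Longrightarrow> norm y < d1 \<Longrightarrow> norm (f x - f y - L (x - y)) \<le> e' * norm (x - y)"
    using strict_derivD[OF f e'] by blast
  obtain d2 where d2: "d2 > 0"
    "\<And>x y. norm x < d2 \<Longrightarrow> norm y < d2 \<Longrightarrow> norm (g x - g y - M (x - y)) \<le> e' * norm (x - y)"
    using strict_derivD[OF g e'] by blast
  \<comment> \<open>The last entry makes the products of two increments small:
    \<open>K * Kf * Kg * d \<le> e / 4\<close>.\<close>
  define d where "d = Min {d1, d2, df, dg, e / (4 * K * Kf * Kg)}"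
  have d: "d > 0" "d \<le> d1" "d \<le> d2" "d \<le> df" "d \<le> dg" "d \<le> e / (4 * K * Kf * Kg)"
    unfolding d_def using e K Kf Kg d1 d2 by auto
  show "\<exists>d>0. \<forall>(x :: 'a) y :: 'a. norm x < d \<longrightarrow> norm y < d \<longrightarrow>
     norm (pr (f x) (g x) - pr (f y) (g y) - (pr (L (x - y)) (g 0) + pr (f 0) (M (x - y)))) \<le> e * norm (x - y)"
  proof (intro exI[of _ d] conjI allI impI)
    fix x y :: 'a assume xy: "norm x < d" "norm y < d"
    let ?n = "norm (x - y)"
    \<comment> \<open>Two summands are products of increments and two carry the linearization errors
      of \<open>f\<close> and \<open>g\<close>; each is bounded by a quarter of the total.\<close>
    have eq: "pr (f x) (g x) - pr (f y) (g y) - (pr (L (x - y)) (g 0) + pr (f 0) (M (x - y)))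
      = pr (f x - f y) (g x - g 0) + pr (f x - f y - L (x - y)) (g 0)
        + pr (f y - f 0) (g x - g y) + pr (f 0) (g x - g y - M (x - y))"
      by (simp add: diff_left diff_right add_left add_right algebra_simps)
    have gx: "norm (g x - g 0) \<le> Kg * d"
      using Kg(3)[of x 0] xy d Kg(1) by (auto intro: order_trans mult_left_mono)
    have fy: "norm (f y - f 0) \<le> Kf * d"
      using Kf(3)[of y 0] xy d Kf(1) by (auto intro: order_trans mult_left_mono)
    have fxy: "norm (f x - f y) \<le> Kf * ?n" "norm (g x - g y) \<le> Kg * ?n"
      using Kf(3)[of x y] Kg(3)[of x y] xy d by auto
    have fd: "norm (f x - f y - L (x - y)) \<le> e' * ?n" "norm (g x - g y - M (x - y)) \<le> e' * ?n"
      using d1(2)[of x y] d2(2)[of x y] xy d by auto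
    have R1: "norm (g 0) \<le> R" "norm (f 0) \<le> R" by (auto simp: R_def)
    have dK: "K * Kf * Kg * d \<le> e / 4"
      using d(6) K Kf(1) Kg(1) by (simp add: field_simps)
    have e'K: "e' * R * K = e / 4" using K R by (simp add: e'_def field_simps)
    have t1: "norm (pr (f x - f y) (g x - g 0)) \<le> e / 4 * ?n"
    proof -
      have "norm (pr (f x - f y) (g x - g 0)) \<le> norm (f x - f y) * norm (g x - g 0) * K" by (rule K)
      also have "\<dots> \<le> (Kf * ?n) * (Kg * d) * K"
        using K Kf(1) by (intro mult_right_mono mult_mono gx fxy) auto
      also have "\<dots> = (K * Kf * Kg * d) * ?n" by simp
      also have "\<dots> \<le> e / 4 * ?n" by (intro mult_right_mono dK) simp
      finally show ?thesis .
    qed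
    have t3: "norm (pr (f y - f 0) (g x - g y)) \<le> e / 4 * ?n"
    proof -
      have "norm (pr (f y - f 0) (g x - g y)) \<le> norm (f y - f 0) * norm (g x - g y) * K" by (rule K)
      also have "\<dots> \<le> (Kf * d) * (Kg * ?n) * K"
        using K Kf(1) d(1) by (intro mult_right_mono mult_mono fy fxy) auto
      also have "\<dots> = (K * Kf * Kg * d) * ?n" by simp
      also have "\<dots> \<le> e / 4 * ?n" by (intro mult_right_mono dK) simp
      finally show ?thesis .
    qed
    have t2: "norm (pr (f x - f y - L (x - y)) (g 0)) \<le> e / 4 * ?n"
    proof -
      have "norm (pr (f x - f y - L (x - y)) (g 0)) \<le> norm (f x - f y - L (x - y)) * norm (g 0) * K"
        by (rule K)
      also have "\<dots> \<le> (e' * ?n) * R * K"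
        using K e' by (intro mult_right_mono mult_mono fd R1) auto
      also have "\<dots> = (e' * R * K) * ?n" by simp
      finally show ?thesis by (simp only: e'K)
    qed
    have t4: "norm (pr (f 0) (g x - g y - M (x - y))) \<le> e / 4 * ?n"
    proof -
      have "norm (pr (f 0) (g x - g y - M (x - y))) \<le> norm (f 0) * norm (g x - g y - M (x - y)) * K"
        by (rule K)
      also have "\<dots> \<le> R * (e' * ?n) * K"
        using K e' R by (intro mult_right_mono mult_mono fd R1) auto
      also have "\<dots> = (e' * R * K) * ?n" by simp
      finally show ?thesis by (simp only: e'K)
    qed
    show "norm (pr (f x) (g x) - pr (f y) (g y) - (pr (L (x - y)) (g 0) + pr (f 0) (M (x - y)))) \<le> e * ?n"
      unfolding eq
      using norm_triangle_ineq[of "pr (f x - f y) (g x - g 0)" "pr (f x - f y - L (x - y)) (g 0)"]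
        norm_triangle_ineq[of "pr (f x - f y) (g x - g 0) + pr (f x - f y - L (x - y)) (g 0)"
          "pr (f y - f 0) (g x - g y)"]
        norm_triangle_ineq[of "pr (f x - f y) (g x - g 0) + pr (f x - f y - L (x - y)) (g 0)
           + pr (f y - f 0) (g x - g y)" "pr (f 0) (g x - g y - M (x - y))"] t1 t2 t3 t4
      by linarith
  qed (rule d(1))
qed

text \<open>An injective \<open>L\<close> satisfies \<open>norm (L x) \<ge> m * norm x\<close> with
  some \<open>m > 0\<close>, and an error of half this size cannot make two values agree.\<close>

lemma strict_deriv_injective:
  fixes f :: "'a::euclidean_space \<Rightarrow> 'b::euclidean_space"
  assumes f: "strict_deriv f L" and L: "\<And>x. L x = 0 \<Longrightarrow> x = 0"
  obtains d where "d > 0" "inj_on f (ball 0 d)" "continuous_on (ball 0 d) f"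
proof -
  have bl: "bounded_linear L" using f by (simp add: strict_deriv_def)
  obtain m where m: "m > 0" "\<And>x. norm (L x) \<ge> m * norm x"
    using injective_imp_isometric[of UNIV L] bl L by auto
  obtain d1 where d1: "d1 > 0"
    "\<And>x y. norm x < d1 \<Longrightarrow> norm y < d1 \<Longrightarrow> norm (f x - f y - L (x - y)) \<le> m / 2 * norm (x - y)"
    using strict_derivD[OF f, of "m / 2"] m by auto
  obtain K d2 where K: "K > 0" "d2 > 0"
    "\<And>x y. norm x < d2 \<Longrightarrow> norm y < d2 \<Longrightarrow> norm (f x - f y) \<le> K * norm (x - y)"
    using strict_deriv_lipschitz[OF f] by blast
  define d where "d = min d1 d2"
  have "inj_on f (ball 0 d)"
  proof (rule inj_onI)
    fix x y assume "x \<in> ball 0 d" "y \<in> ball 0 d" "f x = f y"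
    then have "norm (L (x - y)) \<le> m / 2 * norm (x - y)" using d1(2)[of x y] by (simp add: d_def)
    then have "m * norm (x - y) \<le> m / 2 * norm (x - y)" using m(2)[of "x - y"] by linarith
    then show "x = y" using m(1) by (simp add: mult_le_cancel_right)
  qed
  moreover have "K-lipschitz_on (ball 0 d) f"
    using K by (intro lipschitz_onI) (auto simp: d_def dist_norm)
  then have "continuous_on (ball 0 d) f" by (rule lipschitz_on_continuous_on)
  ultimately show thesis using that[of d] d1 K by (simp add: d_def)
qed

text \<open>With \<open>R X = (1 - X)^-1\<close> the resolvent identity reads
  \<open>R X - R Y = R X (X - Y) R Y\<close>, and both outer factors are close to 1 near 0.\<close>

lemma strict_deriv_cay: "strict_deriv (cay :: real^'n^'n \<Rightarrow> _) (\<lambda>X. 2 *\<^sub>R X)"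
  unfolding strict_deriv_def
proof (intro conjI allI impI)
  show "bounded_linear (\<lambda>X :: real^'n^'n. 2 *\<^sub>R X)" by (rule bounded_linear_scaleR_right)
  fix e :: real assume e: "e > 0"
  obtain K where K: "K > 0" "\<And>(a :: real^'n^'n) b :: real^'n^'n. norm (a ** b) \<le> norm a * norm b * K"
    using mm.pos_bounded by blast
  define R where "R = (\<lambda>X :: real^'n^'n. matrix_inv (mat 1 - X))"
  have R0: "R 0 = mat 1" unfolding R_def by (rule matrix_inv_unique) simp
  define N where "N = norm (mat 1 :: real^'n^'n) + 1"
  have N: "N > 0" by (simp add: N_def add_nonneg_pos)
  \<comment> \<open>If \<open>R\<close> stays within \<open>\<eta>\<close> of 1, the two error terms
    add up to at most \<open>e / 2\<close> times the distance; the missing factor 2 comes from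
    \<open>cay = 2 R - 1\<close>.\<close>
  define \<eta> where "\<eta> = min 1 (e / 2 / (K * K * N + K))"
  have KN: "K * K * N + K > 0" using K N by (simp add: add_pos_pos)
  have \<eta>: "\<eta> > 0" "\<eta> \<le> 1" using e KN by (simp_all add: \<eta>_def)
  have "\<eta> \<le> e / 2 / (K * K * N + K)" unfolding \<eta>_def by (rule min.cobounded2)
  then have \<eta>K: "\<eta> * (K * K * N + K) \<le> e / 2"
    by (subst (asm) pos_le_divide_eq[OF KN])
  have I: "open {X :: real^'n^'n. invertible (mat 1 - X)}" (is "open ?I") by (rule open_invertible_minus)
  have "continuous_on ?I R" unfolding R_def by (intro continuous_intros) auto
  then have "open (?I \<inter> R -` ball (mat 1) \<eta>)"
    using I continuous_on_open_vimage by (metis inf_commute open_ball)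
  moreover have "0 \<in> ?I \<inter> R -` ball (mat 1) \<eta>" using \<eta> by (simp add: R0)
  ultimately obtain d where d: "d > 0" "ball 0 d \<subseteq> ?I \<inter> R -` ball (mat 1) \<eta>" by (rule openE)
  show "\<exists>d>0. \<forall>(x :: real^'n^'n) y :: real^'n^'n. norm x < d \<longrightarrow> norm y < d \<longrightarrow>
     norm (cay x - cay y - 2 *\<^sub>R (x - y)) \<le> e * norm (x - y)"
  proof (intro exI[of _ d] conjI allI impI d(1))
    fix X Y :: "real^'n^'n" assume XY: "norm X < d" "norm Y < d"
    let ?D = "X - Y"
    have i: "invertible (mat 1 - X)" "invertible (mat 1 - Y)"
      and n: "norm (R X - mat 1) \<le> \<eta>" "norm (R Y - mat 1) \<le> \<eta>"
      using d(2) XY by (auto simp: subset_iff dist_norm norm_minus_commute less_imp_le)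
    have "norm (R Y) \<le> norm (R Y - mat 1) + norm (mat 1 :: real^'n^'n)"
      by (metis norm_triangle_sub add.commute)
    then have nY: "norm (R Y) \<le> N" using n(2) \<eta>(2) by (simp add: N_def)
    have "R X - R Y = R X ** ((mat 1 - Y) - (mat 1 - X)) ** R Y"
    proof -
      have "R X ** ((mat 1 - Y) - (mat 1 - X)) ** R Y
          = R X ** ((mat 1 - Y) ** R Y) - (R X ** (mat 1 - X)) ** R Y"
        by (simp only: mm.diff_left mm.diff_right matrix_mul_assoc)
      then show ?thesis using i by (simp add: R_def mat_inv)
    qed
    then have "R X - R Y = R X ** ?D ** R Y" by simp
    then have eq: "R X - R Y - ?D = (R X - mat 1) ** (?D ** R Y) + ?D ** (R Y - mat 1)"
      by (simp add: mm.diff_left mm.diff_right matrix_mul_assoc)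
    have "norm (R X - R Y - ?D) \<le> norm ((R X - mat 1) ** (?D ** R Y)) + norm (?D ** (R Y - mat 1))"
      unfolding eq by (rule norm_triangle_ineq)
    also have "norm ((R X - mat 1) ** (?D ** R Y)) \<le> \<eta> * (norm ?D * N * K) * K"
    proof -
      have "norm (?D ** R Y) \<le> norm ?D * norm (R Y) * K" by (rule K)
      also have "\<dots> \<le> norm ?D * N * K" using K by (intro mult_right_mono mult_left_mono nY) auto
      finally have "norm (?D ** R Y) \<le> norm ?D * N * K" .
      then have "norm (R X - mat 1) * norm (?D ** R Y) * K \<le> \<eta> * (norm ?D * N * K) * K"
        using K \<eta> by (intro mult_right_mono mult_mono n) auto
      then show ?thesis using K(2) order_trans by blast
    qed
    also have "norm (?D ** (R Y - mat 1)) \<le> norm ?D * \<eta> * K"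
    proof -
      have "norm ?D * norm (R Y - mat 1) * K \<le> norm ?D * \<eta> * K"
        using K by (intro mult_right_mono mult_left_mono n) auto
      then show ?thesis using K(2) order_trans by blast
    qed
    also have "\<eta> * (norm ?D * N * K) * K + norm ?D * \<eta> * K = \<eta> * (K * K * N + K) * norm ?D"
      by (simp add: algebra_simps)
    also have "\<dots> \<le> e / 2 * norm ?D" by (intro mult_right_mono \<eta>K) simp
    finally have *: "norm (R X - R Y - ?D) \<le> e / 2 * norm ?D" by simp
    have "cay X - cay Y - 2 *\<^sub>R ?D = 2 *\<^sub>R (R X - R Y - ?D)"
      by (simp add: cay_def R_def scaleR_diff_right)
    then have "norm (cay X - cay Y - 2 *\<^sub>R ?D) = 2 * norm (R X - R Y - ?D)"
      by (simp only: norm_scaleR)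
    then show "norm (cay X - cay Y - 2 *\<^sub>R ?D) \<le> e * norm ?D" using * by simp
  qed
qed

section \<open>The z-class of a regular isometry is open\<close>

context lorentz
begin

definition ad :: "real^'n^'n \<Rightarrow> real^'n^'n \<Rightarrow> real^'n^'n" where
  "ad T Y = T ** Y - Y ** T"

lemma linear_ad: "linear (ad T)"
  by (rule linearI) (auto simp: ad_def mat_ring algebra_simps)

lemma ad_0_iff: "ad T Y = 0 \<longleftrightarrow> Y ** T = T ** Y"
  by (auto simp: ad_def)

lemma regular_ad_ad: "regular T \<Longrightarrow> ad T (ad T Y) = 0 \<Longrightarrow> ad T Y = 0"
  using regular_ad_semisimple[of T "ad T Y" Y] by (simp add: ad_0_iff ad_def)

text \<open>Because \<open>adj T = T^-1\<close>, the range of \<open>[T, -]\<close> is stable under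
  the adjoint. This is where \<open>T\<close> has to be an isometry.\<close>

lemma adj_ad:
  assumes "T \<in> OB"
  shows "adj (ad T Y) = ad T (adj T ** adj Y ** adj T)"
  using OB_D[OF assms]
  by (simp add: ad_def mat_ring) (simp add: matrix_mul_assoc)

text \<open>The projection to the commutant along the range of \<open>[T, -]\<close>: the two are
  complementary as \<open>T\<close> is regular, and each is stable under \<open>adj\<close>, so the
  projection commutes with \<open>adj\<close>.\<close>

lemma regular_projection:
  assumes T: "regular T" "T \<in> OB"
  obtains p where "linear p" "\<And>Y. p Y ** T = T ** p Y" "\<And>Y. Y - p Y \<in> range (ad T)"
    "\<And>Y. Y ** T = T ** Y \<Longrightarrow> p Y = Y" "\<And>Y. p (ad T Y) = 0" "\<And>Y. p (adj Y) = adj (p Y)"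
proof -
  have uniq: "k = k'" if k: "ad T k = 0" "Y - k \<in> range (ad T)" "ad T k' = 0" "Y - k' \<in> range (ad T)"
    for Y k k'
  proof -
    obtain a b where ab: "Y - k = ad T a" "Y - k' = ad T b" using k by blast
    have "k' - k = (Y - k) - (Y - k')" by simp
    also have "\<dots> = ad T (a - b)" by (simp only: ab linear_diff[OF linear_ad])
    finally have "k' - k = ad T (a - b)" .
    moreover have "ad T (k' - k) = 0" using k by (simp add: linear_diff[OF linear_ad])
    ultimately have "k' - k = 0" using regular_ad_ad[OF T(1)] by metis
    then show ?thesis by simp
  qed
  have ex: "\<exists>k. ad T k = 0 \<and> Y - k \<in> range (ad T)" for Y
  proof -
    obtain k y where "ad T k = 0" "Y = k + ad T y"
      using linear_ker_im_decomposition[OF linear_ad, of T Y] regular_ad_ad[OF T(1)] by metis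
    then show ?thesis by (intro exI[of _ k]) auto
  qed
  then obtain p where p: "\<And>Y. ad T (p Y) = 0" "\<And>Y. Y - p Y \<in> range (ad T)" by metis
  have eq: "p Y = k" if "ad T k = 0" "Y - k \<in> range (ad T)" for Y k
    using uniq p that by blast
  show thesis
  proof
    show "linear p"
    proof (rule linearI)
      fix X Y
      obtain x y where "X - p X = ad T x" "Y - p Y = ad T y" using p by blast
      then have "X + Y - (p X + p Y) = ad T (x + y)"
        by (simp only: linear_add[OF linear_ad] add_diff_add)
      then have "X + Y - (p X + p Y) \<in> range (ad T)" by (rule range_eqI)
      then show "p (X + Y) = p X + p Y"
        by (intro eq) (simp_all add: linear_add[OF linear_ad] p(1) del: add_diff_add)
    next
      fix c Y
      obtain y where "Y - p Y = ad T y" using p by blast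
      then have "c *\<^sub>R Y - c *\<^sub>R p Y = ad T (c *\<^sub>R y)"
        by (simp add: linear_scale[OF linear_ad] scaleR_diff_right[symmetric])
      then have "c *\<^sub>R Y - c *\<^sub>R p Y \<in> range (ad T)" by (rule range_eqI)
      then show "p (c *\<^sub>R Y) = c *\<^sub>R p Y" by (intro eq) (simp_all add: linear_scale[OF linear_ad] p(1))
    qed
    show "p Y ** T = T ** p Y" for Y using p(1) by (simp add: ad_0_iff)
    show "Y - p Y \<in> range (ad T)" for Y by (rule p)
    show "p Y = Y" if "Y ** T = T ** Y" for Y
      by (rule eq) (use that linear_0[OF linear_ad] in \<open>auto simp: ad_0_iff intro!: image_eqI[of _ _ 0]\<close>)
    show "p (ad T Y) = 0" for Y by (rule eq) (auto simp: linear_0[OF linear_ad])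
    show "p (adj Y) = adj (p Y)" for Y
    proof (rule eq)
      show "ad T (adj (p Y)) = 0" using commute_adj[OF T(2)] p(1) by (simp add: ad_0_iff)
      obtain y where "Y - p Y = ad T y" using p by blast
      then have "adj Y - adj (p Y) = adj (ad T y)" by (metis adj_simps(2))
      then show "adj Y - adj (p Y) \<in> range (ad T)" by (simp add: adj_ad[OF T(2)])
    qed
  qed
qed

text \<open>\<open>ad S\<close> is injective on \<open>range (ad T)\<close>, hence bounded below
  there, and a small change of \<open>S\<close> keeps it injective. So the commutant of
  \<open>S'\<close> cannot grow beyond that of \<open>T\<close>.\<close>

lemma commutant_stable:
  fixes S T :: "real^'n^'n"
  assumes T: "regular T" and ST: "\<And>Y. Y ** S = S ** Y \<longleftrightarrow> Y ** T = T ** Y"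
  obtains d where "d > 0"
    "\<And>S' Y. norm (S' - S) < d \<Longrightarrow> S' ** T = T ** S' \<Longrightarrow> Y ** S' = S' ** Y \<longleftrightarrow> Y ** T = T ** Y"
proof -
  have adS: "ad S Y = 0 \<longleftrightarrow> ad T Y = 0" for Y using ST by (simp add: ad_0_iff)
  have sub: "subspace (range (ad T))" by (simp add: linear_ad linear_subspace_image)
  have "\<exists>e>0. \<forall>x\<in>range (ad T). e * norm x \<le> norm (ad S x)"
  proof (rule injective_imp_isometric)
    show "closed (range (ad T))" by (rule closed_subspace[OF sub])
    show "bounded_linear (ad S)" using linear_ad linear_conv_bounded_linear by blast
    show "\<forall>x\<in>range (ad T). ad S x = 0 \<longrightarrow> x = 0" using adS regular_ad_ad[OF T] by auto
  qed (rule sub)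
  then obtain e where e: "e > 0" "\<And>x. x \<in> range (ad T) \<Longrightarrow> e * norm x \<le> norm (ad S x)" by blast
  obtain K where K: "K > 0" "\<And>(a :: real^'n^'n) b :: real^'n^'n. norm (a ** b) \<le> norm a * norm b * K"
    using mm.pos_bounded by blast
  define d where "d = e / (2 * K)"
  show thesis
  proof
    show "d > 0" using e K by (simp add: d_def)
    fix S' Y assume S': "norm (S' - S) < d" "S' ** T = T ** S'"
    show "Y ** S' = S' ** Y \<longleftrightarrow> Y ** T = T ** Y"
    proof
      show "Y ** T = T ** Y \<Longrightarrow> Y ** S' = S' ** Y"
        using regular_commutant_commutes[OF T _ S'(2)] .
      assume Y: "Y ** S' = S' ** Y"
      obtain k y where ky: "ad T k = 0" "Y = k + ad T y"
        using linear_ker_im_decomposition[OF linear_ad, of T Y] regular_ad_ad[OF T] by metis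
      define x where "x = ad T y"
      have "ad S' k = 0" using regular_commutant_commutes[OF T _ S'(2)] ky(1) by (simp add: ad_0_iff)
      moreover have "ad S' Y = 0" using Y by (simp add: ad_0_iff)
      ultimately have x0: "ad S' x = 0" using ky(2) by (simp add: linear_add[OF linear_ad] x_def)
      have "ad S x = ad S x - ad S' x" using x0 by simp
      also have "\<dots> = x ** (S' - S) - (S' - S) ** x" by (simp add: ad_def mat_ring algebra_simps)
      finally have "norm (ad S x) \<le> norm (x ** (S' - S)) + norm ((S' - S) ** x)"
        using norm_triangle_ineq4 by metis
      also have "\<dots> \<le> norm x * norm (S' - S) * K + norm (S' - S) * norm x * K"
        by (intro add_mono K)
      also have "\<dots> = 2 * K * norm (S' - S) * norm x" by simp
      finally have "e * norm x \<le> 2 * K * norm (S' - S) * norm x"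
        using e(2)[of x] by (simp add: x_def)
      moreover have "2 * K * norm (S' - S) < e" using S'(1) K by (simp add: d_def field_simps)
      ultimately have "x = 0"
        by (metis (no_types, opaque_lifting) mult_le_cancel_right norm_le_zero_iff not_le)
      then show "Y ** T = T ** Y" using ky by (simp add: x_def[symmetric] ad_0_iff)
    qed
  qed
qed

text \<open>The map \<open>F\<close> of the proof has an injective strict derivative at 0, and \<open>F (- adj Y)\<close> is the inverse
  of \<open>adj (F Y)\<close>; so \<open>Y\<close> is skew whenever \<open>F Y\<close> is an isometry.\<close>

lemma z_class_open_at:
  assumes T: "regular T" "T \<in> G" and S: "S \<in> G" and cen: "centralizer G S = centralizer G T"
  obtains U where "open U" "S \<in> U"
    "\<And>S'. S' \<in> U \<Longrightarrow> S' \<in> G \<Longrightarrow>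
       \<exists>u\<in>G. centralizer G S' = (\<lambda>X. u ** X ** matrix_inv u) ` centralizer G S"
proof -
  note ST = commutant_eq[OF T(1) S cen]
  note SO = OB_D[OF G_OB[OF S]]
  obtain p where p: "linear p" "\<And>Y. p Y ** T = T ** p Y" "\<And>Y. Y - p Y \<in> range (ad T)"
    "\<And>Y. Y ** T = T ** Y \<Longrightarrow> p Y = Y" "\<And>Y. p (ad T Y) = 0" "\<And>Y. p (adj Y) = adj (p Y)"
    by (rule regular_projection[OF T(1) G_OB[OF T(2)]]) blast
  define q where "q Y = Y - p Y" for Y
  have bp: "bounded_linear p" using p(1) linear_conv_bounded_linear by blast
  have bq: "bounded_linear q" unfolding q_def by (intro bounded_linear_sub bounded_linear_ident bp)
  have q_adj: "q (adj Y) = adj (q Y)" for Y by (simp add: q_def p)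
  have p0 [simp]: "p 0 = 0" using p(1) linear_0 by blast
  have q0 [simp]: "q 0 = 0" by (simp add: q_def)
  have pm: "p (- Y) = - p Y" and qm: "q (- Y) = - q Y" for Y
    using linear_neg[OF p(1)] linear_neg[OF bounded_linear.linear[OF bq]] by auto
  \<comment> \<open>\<open>p Y\<close> moves \<open>S\<close> inside the commutant and
    \<open>q Y\<close> moves it by conjugation. Multiplying \<open>S\<close> by a Cayley transform,
    instead of adding \<open>p Y\<close>, makes the inverse and the adjoint of \<open>F Y\<close>
    have the same shape as \<open>F\<close>.\<close>
  define F where "F Y = (cay (q Y) ** (S ** cay (p Y))) ** cay (- q Y)" for Y
  have F0: "F 0 = S" by (simp add: F_def)
  have "strict_deriv (\<lambda>Y. cay (q Y)) (\<lambda>Y. 2 *\<^sub>R q Y)"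
    by (rule strict_deriv_compose_linear[OF strict_deriv_cay bq])
  moreover have "strict_deriv (\<lambda>Y. S ** cay (p Y)) (\<lambda>Y. 0 ** cay (p 0) + S ** (2 *\<^sub>R p Y))"
    by (rule strict_deriv_bilinear[OF bounded_bilinear_matrix_mult strict_deriv_const
          strict_deriv_compose_linear[OF strict_deriv_cay bp]])
  moreover have "strict_deriv (\<lambda>Y. cay (- q Y)) (\<lambda>Y. 2 *\<^sub>R (- q Y))"
    by (rule strict_deriv_compose_linear[OF strict_deriv_cay bounded_linear_minus[OF bq]])
  ultimately have dF': "strict_deriv F (\<lambda>Y. ((2 *\<^sub>R q Y) ** (S ** cay (p 0))
      + cay (q 0) ** (0 ** cay (p 0) + S ** (2 *\<^sub>R p Y))) ** cay (- q 0)
      + (cay (q 0) ** (S ** cay (p 0))) ** (2 *\<^sub>R (- q Y)))"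
    unfolding F_def
    by (intro strict_deriv_bilinear[OF bounded_bilinear_matrix_mult, of "\<lambda>Y. cay (q Y) ** (S ** cay (p Y))"]
        strict_deriv_bilinear[OF bounded_bilinear_matrix_mult, of "\<lambda>Y. cay (q Y)" _ "\<lambda>Y. S ** cay (p Y)"])
  then have dF: "strict_deriv F (\<lambda>Y. 2 *\<^sub>R (q Y ** S) + 2 *\<^sub>R (S ** p Y) - 2 *\<^sub>R (S ** q Y))"
    by (simp add: mm.scaleR_left mm.scaleR_right mm.minus_right)
  \<comment> \<open>A vanishing derivative means \<open>S ** p Y = ad S (q Y)\<close>. The left side
    commutes with \<open>T\<close> and the right side lies in the range of \<open>ad T\<close>, so
    both are 0; the same argument then gives \<open>q Y = 0\<close>.\<close>
  have inj: "Y = 0" if Y: "2 *\<^sub>R (q Y ** S) + 2 *\<^sub>R (S ** p Y) - 2 *\<^sub>R (S ** q Y) = 0" for Y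
  proof -
    obtain y where y: "q Y = ad T y" using p(3) by (auto simp: q_def)
    have "(1/2) *\<^sub>R (2 *\<^sub>R (q Y ** S) + 2 *\<^sub>R (S ** p Y) - 2 *\<^sub>R (S ** q Y)) = 0" by (simp only: Y) simp
    then have eq: "S ** p Y = ad S (q Y)" by (simp add: ad_def algebra_simps)
    have ST': "S ** T = T ** S" using ST[of S] by simp
    have "ad S (ad T y) = ad T (ad S y)"
      using ST' by (simp add: ad_def mat_ring algebra_simps) (simp add: matrix_mul_assoc ST')
    then have SpI: "S ** p Y = ad T (ad S y)" using eq y by simp
    have "(S ** p Y) ** T = T ** (S ** p Y)" by (rule commute_mult[OF ST' p(2)])
    then have "ad T (ad T (ad S y)) = 0" using SpI by (simp add: ad_0_iff)
    then have "S ** p Y = 0" using SpI regular_ad_ad[OF T(1)] by simp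
    then have "adj S ** (S ** p Y) = 0" by simp
    then have pY: "p Y = 0" using SO by (simp add: matrix_mul_assoc)
    then have "ad S (q Y) = 0" using eq by simp
    then have "ad T (ad T y) = 0" using ST y by (simp add: ad_0_iff)
    then have "q Y = 0" using y regular_ad_ad[OF T(1)] by simp
    then show ?thesis using pY by (simp add: q_def)
  qed
  obtain d1 where d1: "d1 > 0" "inj_on F (ball 0 d1)" "continuous_on (ball 0 d1) F"
    by (rule strict_deriv_injective[OF dF]) (use inj in blast)+
  obtain c where c: "c > 0" "\<And>X. norm X < c \<Longrightarrow> invertible (mat 1 - X) \<and> B e0 (cay X *v e0) > 0"
    by (rule cay_near_0) blast
  obtain d where d: "d > 0"
    "\<And>S' Y. norm (S' - S) < d \<Longrightarrow> S' ** T = T ** S' \<Longrightarrow> Y ** S' = S' ** Y \<longleftrightarrow> Y ** T = T ** Y"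
    by (rule commutant_stable[OF T(1) ST]) blast
  let ?C = "{Y. norm (q Y) < c \<and> norm (p Y) < c}"
  have cont: "continuous_on UNIV p" "continuous_on UNIV q"
    using bp bq linear_continuous_on by blast+
  have oC: "open ?C"
    using cont by (intro open_Collect_conj open_Collect_less continuous_intros)
  have "continuous_on ?C (\<lambda>Y. S ** cay (p Y))"
    unfolding cay_def
    by (intro mm.continuous_on continuous_intros continuous_on_subset[OF cont(1)]) (use c in auto)
  then have "open ((\<lambda>Y. S ** cay (p Y)) -` ball S d \<inter> ?C)"
    using continuous_on_open_vimage[OF oC] open_ball by blast
  then have oD: "open (ball 0 d1 \<inter> ((\<lambda>Y. S ** cay (p Y)) -` ball S d \<inter> ?C))"
    by (rule open_Int[OF open_ball])
  define D where "D = ball 0 d1 \<inter> ((\<lambda>Y. S ** cay (p Y)) -` ball S d \<inter> ?C)"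
  have D: "Y \<in> ball 0 d1" "norm (S ** cay (p Y) - S) < d" "norm (q Y) < c" "norm (p Y) < c" if "Y \<in> D" for Y
    using that by (auto simp: D_def dist_norm norm_minus_commute)
  \<comment> \<open>\<open>W\<close> is symmetric under \<open>Y \<mapsto> - adj Y\<close>, so that
    injectivity applies to the pair \<open>Y\<close>, \<open>- adj Y\<close>.\<close>
  define W where "W = D \<inter> (\<lambda>Y. - adj Y) -` D"
  have "continuous_on UNIV (\<lambda>Y. - adj Y)" by (intro continuous_intros)
  then have oW: "open W"
    unfolding W_def using oD open_vimage[of D "\<lambda>Y. - adj Y"] by (simp add: D_def open_Int)
  have WD: "W \<subseteq> ball 0 d1" using D(1) by (auto simp: W_def)
  show thesis
  proof
    show "open (F ` W)"
      by (rule invariance_of_domain[OF continuous_on_subset[OF d1(3) WD] oW inj_on_subset[OF d1(2) WD]])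
    have "0 \<in> W" using d1(1) c(1) d(1) by (simp add: W_def D_def)
    then show "S \<in> F ` W" using F0 by (metis imageI)
    fix S' assume "S' \<in> F ` W" and S': "S' \<in> G"
    then obtain Y where Y: "Y \<in> D" "- adj Y \<in> D" "S' = F Y" by (auto simp: W_def)
    define a b where "a = q Y" and "b = p Y"
    have ab: "norm a < c" "norm b < c" "norm (adj a) < c" "norm (adj b) < c"
      using D[OF Y(1)] D[OF Y(2)] unfolding a_def b_def by (simp_all add: q_adj p pm qm)
    have ia: "invertible (mat 1 - a)" "invertible (mat 1 + a)" "invertible (mat 1 - adj a)" "invertible (mat 1 + adj a)"
      using ab(1,3) c(2)[of a] c(2)[of "- a"] c(2)[of "adj a"] c(2)[of "- adj a"] by simp_all
    have ib: "invertible (mat 1 - b)" "invertible (mat 1 + b)" "invertible (mat 1 - adj b)" "invertible (mat 1 + adj b)"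
      using ab(2,4) c(2)[of b] c(2)[of "- b"] c(2)[of "adj b"] c(2)[of "- adj b"] by simp_all
    have FY: "S' = (cay a ** (S ** cay b)) ** cay (- a)" using Y(3) by (simp add: F_def a_def b_def)
    have Fm: "F (- adj Y) = (cay (- adj a) ** (S ** cay (- adj b))) ** cay (adj a)"
      by (simp add: F_def q_adj p pm qm a_def b_def)
    have adjS': "adj S' = (cay (- adj a) ** (cay (adj b) ** adj S)) ** cay (adj a)"
      using ia ib by (simp add: FY adj_cay matrix_mul_assoc)
    have "F (- adj Y) ** adj S' = mat 1"
    proof -
      have "F (- adj Y) ** adj S' = cay (- adj a) ** (S ** (cay (- adj b) **
         ((cay (adj a) ** cay (- adj a)) ** cay (adj b)) ** adj S)) ** cay (adj a)"
        unfolding Fm adjS' by (simp add: matrix_mul_assoc)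
      also have "\<dots> = cay (- adj a) ** ((S ** (cay (- adj b) ** cay (adj b)) ** adj S)) ** cay (adj a)"
        using cay_inverse(2)[of "adj a"] ia by (simp add: matrix_mul_assoc)
      also have "\<dots> = cay (- adj a) ** cay (adj a)"
        using cay_inverse(1)[of "adj b"] ib SO by simp
      also have "\<dots> = mat 1" using cay_inverse(1)[of "adj a"] ia by simp
      finally show ?thesis .
    qed
    then have "(F (- adj Y) ** adj S') ** S' = S'" by simp
    then have "F (- adj Y) = F Y"
      using OB_D[OF G_OB[OF S']] Y(3) by (simp add: matrix_mul_assoc[symmetric])
    then have "- adj Y = Y" using inj_onD[OF d1(2)] D(1) Y by blast
    then have "adj Y = - Y" by (metis minus_minus)
    then have "adj a = - a" by (simp add: a_def q_adj[symmetric] qm)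
    then have sk: "a \<in> skew" by (simp add: skew_def)
    define u where "u = cay a"
    have uG: "u \<in> G" using sk ia c(2)[OF ab(1)] by (simp add: u_def G_iff cay_OB)
    have iu: "invertible u" "matrix_inv u = cay (- a)" using invertible_cay ia by (auto simp: u_def)
    \<comment> \<open>\<open>S2\<close> lies near \<open>S\<close> in the commutant of
      \<open>T\<close>, so it has the same commutant as \<open>S\<close>. Conjugation by the
      isometry \<open>u\<close> takes it to \<open>S'\<close>.\<close>
    define S2 where "S2 = S ** cay b"
    have "b ** T = T ** b" by (simp add: b_def p)
    then have "cay b ** T = T ** cay b" using cay_commute ib by blast
    then have S2T: "S2 ** T = T ** S2" unfolding S2_def using ST[of S] by (intro commute_mult) auto
    have "norm (S2 - S) < d" using D(2)[OF Y(1)] by (simp add: S2_def b_def)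
    then have S2c: "X ** S2 = S2 ** X \<longleftrightarrow> X ** S = S ** X" for X using d(2) S2T ST by blast
    have S'u: "S' = u ** S2 ** matrix_inv u" by (simp add: FY u_def[symmetric] iu S2_def)
    have "X ** S' = S' ** X \<longleftrightarrow> (matrix_inv u ** X ** u) ** S2 = S2 ** (matrix_inv u ** X ** u)" for X
    proof
      assume "X ** S' = S' ** X"
      then have "matrix_inv u ** (X ** S') ** u = matrix_inv u ** (S' ** X) ** u" by simp
      then show "(matrix_inv u ** X ** u) ** S2 = S2 ** (matrix_inv u ** X ** u)"
        using iu(1) by (simp add: S'u matrix_mul_assoc[symmetric] mat_inv)
    next
      assume "(matrix_inv u ** X ** u) ** S2 = S2 ** (matrix_inv u ** X ** u)"
      then have "u ** ((matrix_inv u ** X ** u) ** S2) ** matrix_inv u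
        = u ** (S2 ** (matrix_inv u ** X ** u)) ** matrix_inv u" by simp
      then show "X ** S' = S' ** X"
        using iu(1) by (simp add: S'u matrix_mul_assoc[symmetric] mat_inv)
    qed
    then have c': "X \<in> centralizer G S' \<longleftrightarrow> X \<in> G \<and> matrix_inv u ** X ** u \<in> centralizer G S" for X
      using uG by (auto simp: centralizer_def S2c G_mult G_matrix_inv)
    have "centralizer G S' = (\<lambda>X. u ** X ** matrix_inv u) ` centralizer G S"
    proof (intro equalityI subsetI)
      fix X assume "X \<in> centralizer G S'"
      then have "matrix_inv u ** X ** u \<in> centralizer G S" using c' by blast
      moreover have "X = u ** (matrix_inv u ** X ** u) ** matrix_inv u"
        using iu(1) by (simp add: matrix_mul_assoc[symmetric] mat_inv)
      ultimately show "X \<in> (\<lambda>X. u ** X ** matrix_inv u) ` centralizer G S" by (rule rev_image_eqI)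
    next
      fix X assume "X \<in> (\<lambda>X. u ** X ** matrix_inv u) ` centralizer G S"
      then obtain V where V: "V \<in> centralizer G S" "X = u ** V ** matrix_inv u" by blast
      then have "matrix_inv u ** X ** u = V"
        using iu(1) by (simp add: matrix_mul_assoc[symmetric] mat_inv)
      moreover have "X \<in> G" using V uG by (simp add: centralizer_def G_mult G_matrix_inv)
      ultimately show "X \<in> centralizer G S'" using c' V(1) by blast
    qed
    then show "\<exists>u\<in>G. centralizer G S' = (\<lambda>X. u ** X ** matrix_inv u) ` centralizer G S"
      using uG by blast
  qed
qed

end

section \<open>The discriminant\<close>

primrec mpow :: "real^'n^'n \<Rightarrow> nat \<Rightarrow> real^'n^'n" where
  "mpow A 0 = mat 1"
| "mpow A (Suc k) = A ** mpow A k"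

text \<open>\<open>charpoly_deriv T\<close> is \<open>p' (T)\<close> for the characteristic polynomial \<open>p\<close> of \<open>T\<close>, so that
  \<open>disc T\<close> is the product of \<open>p' (z)\<close> over the roots \<open>z\<close> of \<open>p\<close>.\<close>

definition charpoly_deriv :: "real^'n^'n \<Rightarrow> real^'n^'n" where
  "charpoly_deriv T = (\<Sum>k<CARD('n). (real (Suc k) * coeff (charpoly T) (Suc k)) *\<^sub>R mpow T k)"

definition disc :: "real^'n^'n \<Rightarrow> real" where
  "disc T = det (charpoly_deriv T)"

lemma cmat_mpow_eigen: "cmat T *v v = z *s v \<Longrightarrow> cmat (mpow T k) *v v = z ^ k *s v"
  by (induction k) (simp_all add: cmat_simps matrix_vector_mul_assoc[symmetric] vector_scalar_commute
      vector_smult_assoc mult.commute)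

lemma cmat_scaleR_mult: "cmat (c *\<^sub>R A) *v v = of_real c *s (cmat A *v v)"
  by (simp add: vec_eq_iff matrix_vector_mult_def sum_distrib_left mult.assoc)

lemma cmat_sum_mult: "finite S \<Longrightarrow> cmat (\<Sum>k\<in>S. f k) *v v = (\<Sum>k\<in>S. cmat (f k) *v v)"
  by (induction S rule: finite_induct) (simp_all add: cmat_simps matrix_vector_mult_add_rdistrib)

lemma cmat_charpoly_deriv_eigen:
  fixes T :: "real^'n^'n"
  assumes "cmat T *v v = z *s v"
  shows "cmat (charpoly_deriv T) *v v = poly (pderiv (map_poly of_real (charpoly T))) z *s v"
proof -
  let ?q = "map_poly complex_of_real (charpoly T)"
  have deg: "degree ?q = CARD('n)" by (simp add: degree_map_poly charpoly_monic(1))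
  have "cmat (charpoly_deriv T) *v v
      = (\<Sum>k<CARD('n). (of_nat (Suc k) * coeff ?q (Suc k) * z ^ k) *s v)"
    by (simp add: charpoly_deriv_def cmat_sum_mult cmat_scaleR_mult cmat_mpow_eigen[OF assms]
        vector_smult_assoc coeff_map_poly del: of_nat_Suc)
  also have "\<dots> = (\<Sum>k<CARD('n). of_nat (Suc k) * coeff ?q (Suc k) * z ^ k) *s v"
    by (simp add: vec_eq_iff sum_distrib_right)
  also have "(\<Sum>k<CARD('n). of_nat (Suc k) * coeff ?q (Suc k) * z ^ k) = poly (pderiv ?q) z"
  proof -
    have "degree (pderiv ?q) = CARD('n) - 1" by (simp add: degree_pderiv deg)
    moreover have "{..<CARD('n)} = {..CARD('n) - 1}" by (auto simp: le_less_Suc_eq less_Suc_eq_le[symmetric])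
    ultimately show ?thesis by (simp add: poly_altdef coeff_pderiv del: of_nat_Suc)
  qed
  finally show ?thesis .
qed

lemma det_cmat: "det (cmat A) = of_real (det A)"
  unfolding cmat_def by (rule det_hom[symmetric]) auto

lemma rsquarefree_iff_card_roots:
  fixes q :: "complex poly"
  assumes "q \<noteq> 0"
  shows "rsquarefree q \<longleftrightarrow> card {z. poly q z = 0} = degree q"
proof
  assume "rsquarefree q"
  note arg_cong[OF complex_poly_decompose_rsquarefree[OF this], of degree]
  then show "card {z. poly q z = 0} = degree q"
    using assms by (simp add: degree_prod_eq_sum_degree)
next
  assume c: "card {z. poly q z = 0} = degree q"
  have fin: "finite {z. poly q z = 0}" using assms by (rule poly_roots_finite)
  have pos: "1 \<le> order z q" if "poly q z = 0" for z
    using that assms by (metis One_nat_def Suc_leI order_root neq0_conv)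
  have "order z q = 0 \<or> order z q = 1" for z
  proof (rule ccontr)
    assume "\<not> ?thesis"
    then have z: "poly q z = 0" "1 < order z q" using assms by (auto simp: order_root)
    have "(\<Sum>x | poly q x = 0. 1) < (\<Sum>x | poly q x = 0. order x q)"
      using fin pos z by (intro sum_strict_mono_ex1) auto
    then show False using sum_order_le_degree[OF assms] c by simp
  qed
  then show "rsquarefree q" using assms by (simp add: rsquarefree_def)
qed

lemma regular_iff_rsquarefree: "regular T \<longleftrightarrow> rsquarefree (map_poly complex_of_real (charpoly T))"
proof -
  have "map_poly complex_of_real (charpoly T) \<noteq> 0"
    by (simp add: map_poly_eq_0_iff charpoly_nonzero)
  then show ?thesis
    by (simp add: regular_def cspec_def rsquarefree_iff_card_roots degree_map_poly charpoly_monic(1))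
qed

text \<open>An eigenvector of \<open>T\<close> for \<open>z\<close> is one of \<open>p' (T)\<close>
  for \<open>p' (z)\<close>, so \<open>p' (T)\<close> is singular exactly if \<open>p\<close> and
  \<open>p'\<close> share a root. Regularity thus becomes the nonvanishing of a function that is
  polynomial in the entries.\<close>

lemma regular_iff_disc: "regular T \<longleftrightarrow> disc (T :: real^'n^'n) \<noteq> 0"
proof
  let ?q = "map_poly complex_of_real (charpoly T)"
  assume reg: "regular T"
  obtain E l where E: "invertible (E :: complex^'n^'n)" "inj l"
      and TE: "cmat T ** E = E ** (\<chi> i j. if i = j then l i else 0)"
    by (rule regular_diagonalizable[OF reg]) blast
  have col: "(A *v axis j 1) $ i = A $ i $ j" for A :: "complex^'n^'n" and i j
    by (simp add: matrix_vector_mult_def axis_def if_distrib cong: if_cong)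
  have ax: "(\<chi> i j. if i = j then f i else 0) *v axis j 1 = f j *s axis j 1" for f :: "'n \<Rightarrow> complex" and j
    unfolding vec_eq_iff col by (simp add: axis_def)
  have ev: "cmat T *v (E *v axis j 1) = l j *s (E *v axis j 1)" for j
    by (simp add: matrix_vector_mul_assoc TE) (simp add: matrix_vector_mul_assoc[symmetric] ax vector_scalar_commute)
  have inj: "E *v x \<noteq> 0" if "x \<noteq> 0" for x
    using E(1) that matrix_left_invertible_ker[of E] by (auto simp: invertible_def)
  have "axis j (1 :: complex) \<noteq> 0" for j :: 'n by (auto simp: vec_eq_iff axis_def)
  then have "l j \<in> cspec T" for j unfolding cspec_iff using ev inj by blast
  then have nz: "poly (pderiv ?q) (l j) \<noteq> 0" for j
    using reg unfolding regular_iff_rsquarefree rsquarefree_roots cspec_def by blast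
  have "cmat (charpoly_deriv T) ** E = E ** (\<chi> i j. if i = j then poly (pderiv ?q) (l i) else 0)" (is "?L = ?R")
  proof -
    have "?L *v axis j 1 = ?R *v axis j 1" for j
      using cmat_charpoly_deriv_eigen[OF ev]
      by (simp add: matrix_vector_mul_assoc[symmetric] ax vector_scalar_commute)
    then have "(?L *v axis j 1) $ i = (?R *v axis j 1) $ i" for i j by simp
    then have "?L $ i $ j = ?R $ i $ j" for i j
      by (simp only: col)
    then show ?thesis by (simp add: vec_eq_iff)
  qed
  then have "det (cmat (charpoly_deriv T)) * det E
      = det E * det (\<chi> i j. if i = j then poly (pderiv ?q) (l i) else 0)"
    by (simp only: det_mul[symmetric])
  also have "det (\<chi> i j. if i = j then poly (pderiv ?q) (l i) else 0) = (\<Prod>i\<in>UNIV. poly (pderiv ?q) (l i))"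
    by (subst det_diagonal) simp_all
  finally have "det (cmat (charpoly_deriv T)) * det E = det E * (\<Prod>i\<in>UNIV. poly (pderiv ?q) (l i))" .
  moreover have "det E \<noteq> 0" using E(1) invertible_det_nz by blast
  moreover have "(\<Prod>i\<in>UNIV. poly (pderiv ?q) (l i)) \<noteq> 0" using nz by simp
  ultimately have "det (cmat (charpoly_deriv T)) \<noteq> 0" by auto
  then show "disc T \<noteq> 0" by (simp add: disc_def det_cmat)
next
  let ?q = "map_poly complex_of_real (charpoly T)"
  assume "disc T \<noteq> 0"
  then have det: "det (cmat (charpoly_deriv T)) \<noteq> 0" by (simp add: disc_def det_cmat)
  have "\<not> (poly ?q z = 0 \<and> poly (pderiv ?q) z = 0)" for z
  proof
    assume z: "poly ?q z = 0 \<and> poly (pderiv ?q) z = 0"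
    then have "z \<in> cspec T" by (simp add: cspec_def)
    then obtain v where v: "v \<noteq> 0" "cmat T *v v = z *s v" by (auto simp: cspec_iff)
    then have "cmat (charpoly_deriv T) *v v = 0"
      using cmat_charpoly_deriv_eigen[OF v(2)] z by (simp add: vec_eq_iff)
    then show False using det v(1) det_eq_0_iff_ker by blast
  qed
  then show "regular T" by (simp add: regular_iff_rsquarefree rsquarefree_roots)
qed


section \<open>Rational functions\<close>

text \<open>Rational functions whose denominator is a power of the fixed polynomial
  \<open>b\<close>, with the denominator cleared; nothing is required at the zeros of
  \<open>b\<close>. Sums and products keep the same \<open>b\<close>.\<close>

definition ratfun :: "real poly \<Rightarrow> (real \<Rightarrow> real) \<Rightarrow> bool" where
  "ratfun b f \<longleftrightarrow> (\<exists>p k. \<forall>t. poly b t \<noteq> 0 \<longrightarrow> f t * poly b t ^ k = poly p t)"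

lemma ratfun_const: "ratfun b (\<lambda>t. c)"
  unfolding ratfun_def by (rule exI[of _ "[:c:]"], rule exI[of _ 0]) simp

lemma ratfun_add:
  assumes "ratfun b f" "ratfun b g"
  shows "ratfun b (\<lambda>t. f t + g t)"
proof -
  obtain p k where p: "\<And>t. poly b t \<noteq> 0 \<Longrightarrow> f t * poly b t ^ k = poly p t"
    using assms(1) unfolding ratfun_def by blast
  obtain q l where q: "\<And>t. poly b t \<noteq> 0 \<Longrightarrow> g t * poly b t ^ l = poly q t"
    using assms(2) unfolding ratfun_def by blast
  have "(f t + g t) * poly b t ^ (k + l) = poly (p * b ^ l + q * b ^ k) t" if "poly b t \<noteq> 0" for t
  proof -
    have "(f t + g t) * poly b t ^ (k + l)
        = (f t * poly b t ^ k) * poly b t ^ l + (g t * poly b t ^ l) * poly b t ^ k"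
      by (simp add: power_add algebra_simps)
    then show ?thesis by (simp add: p[OF that] q[OF that])
  qed
  then show ?thesis unfolding ratfun_def by blast
qed

lemma ratfun_mult:
  assumes "ratfun b f" "ratfun b g"
  shows "ratfun b (\<lambda>t. f t * g t)"
proof -
  obtain p k where p: "\<And>t. poly b t \<noteq> 0 \<Longrightarrow> f t * poly b t ^ k = poly p t"
    using assms(1) unfolding ratfun_def by blast
  obtain q l where q: "\<And>t. poly b t \<noteq> 0 \<Longrightarrow> g t * poly b t ^ l = poly q t"
    using assms(2) unfolding ratfun_def by blast
  have "f t * g t * poly b t ^ (k + l) = poly (p * q) t" if "poly b t \<noteq> 0" for t
  proof -
    have "f t * g t * poly b t ^ (k + l) = (f t * poly b t ^ k) * (g t * poly b t ^ l)"
      by (simp add: power_add)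
    then show ?thesis by (simp add: p[OF that] q[OF that])
  qed
  then show ?thesis unfolding ratfun_def by blast
qed

lemma ratfun_sum: "(\<And>i. i \<in> S \<Longrightarrow> ratfun b (f i)) \<Longrightarrow> ratfun b (\<lambda>t. \<Sum>i\<in>S. f i t)"
  by (induction S rule: infinite_finite_induct) (auto intro: ratfun_const ratfun_add)

lemma ratfun_prod: "(\<And>i. i \<in> S \<Longrightarrow> ratfun b (f i)) \<Longrightarrow> ratfun b (\<lambda>t. \<Prod>i\<in>S. f i t)"
  by (induction S rule: infinite_finite_induct) (auto intro: ratfun_const ratfun_mult)

lemma ratfun_det:
  "(\<And>i j. ratfun b (\<lambda>t. A t $ i $ j)) \<Longrightarrow> ratfun b (\<lambda>t. det (A t))"
  unfolding det_def by (intro ratfun_sum ratfun_mult ratfun_const ratfun_prod)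

lemma ratfun_coeff_sum:
  "(\<And>i m. i \<in> S \<Longrightarrow> ratfun b (\<lambda>t. coeff (F i t) m)) \<Longrightarrow> ratfun b (\<lambda>t. coeff (\<Sum>i\<in>S. F i t) m)"
  by (simp add: coeff_sum ratfun_sum)

lemma ratfun_coeff_mult:
  "(\<And>m. ratfun b (\<lambda>t. coeff (F t) m)) \<Longrightarrow> (\<And>m. ratfun b (\<lambda>t. coeff (K t) m)) \<Longrightarrow>
    ratfun b (\<lambda>t. coeff (F t * K t) m)"
  by (simp add: coeff_mult ratfun_sum ratfun_mult)

lemma ratfun_coeff_prod:
  "(\<And>i m. i \<in> S \<Longrightarrow> ratfun b (\<lambda>t. coeff (F i t) m)) \<Longrightarrow> ratfun b (\<lambda>t. coeff (\<Prod>i\<in>S. F i t) m)"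
  by (induction S arbitrary: m rule: infinite_finite_induct)
    (auto intro: ratfun_const ratfun_coeff_mult)

lemma ratfun_charpoly:
  assumes A: "\<And>i j. ratfun b (\<lambda>t. A t $ i $ j)"
  shows "ratfun b (\<lambda>t. coeff (charpoly (A t)) m)"
proof -
  have "ratfun b (\<lambda>t. coeff ((mat [:0, 1:] - map_matrix (\<lambda>a. [:a:]) (A t)) $ i $ j) m)" for i j m
  proof -
    have "ratfun b (\<lambda>t. coeff (mat [:0, 1:] $ i $ j) m + (- 1) * (if m = 0 then A t $ i $ j else 0))"
      by (intro ratfun_add ratfun_const ratfun_mult, cases "m = 0") (use A ratfun_const in auto)
    also have "(\<lambda>t. coeff (mat [:0, 1:] $ i $ j) m + (- 1) * (if m = 0 then A t $ i $ j else 0))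
        = (\<lambda>t. coeff ((mat [:0, 1:] - map_matrix (\<lambda>a. [:a:]) (A t)) $ i $ j) m)"
      by (auto simp: coeff_pCons split: nat.splits)
    finally show ?thesis .
  qed
  moreover have "ratfun b (\<lambda>t. coeff (of_int (sign p)) m)" for p :: "'b \<Rightarrow> 'b" and m
    by (rule ratfun_const)
  ultimately show ?thesis
    unfolding charpoly_def det_def by (intro ratfun_coeff_sum ratfun_coeff_mult ratfun_coeff_prod)
qed

lemma ratfun_matrix_mult:
  "(\<And>i j. ratfun b (\<lambda>t. A t $ i $ j)) \<Longrightarrow> (\<And>i j. ratfun b (\<lambda>t. C t $ i $ j)) \<Longrightarrow>
    ratfun b (\<lambda>t. (A t ** C t) $ i $ j)"
  by (simp add: matrix_matrix_mult_def ratfun_sum ratfun_mult)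

lemma ratfun_mpow:
  "(\<And>i j. ratfun b (\<lambda>t. A t $ i $ j)) \<Longrightarrow> ratfun b (\<lambda>t. mpow (A t) k $ i $ j)"
  by (induction k arbitrary: i j) (auto intro: ratfun_const ratfun_matrix_mult)

lemma ratfun_disc:
  fixes A :: "real \<Rightarrow> real^'n^'n"
  assumes A: "\<And>i j. ratfun b (\<lambda>t. A t $ i $ j)"
  shows "ratfun b (\<lambda>t. disc (A t))"
  unfolding disc_def
proof (rule ratfun_det)
  fix i j
  have "ratfun b (\<lambda>t. \<Sum>k<CARD('n). real (Suc k) * coeff (charpoly (A t)) (Suc k) * mpow (A t) k $ i $ j)"
    by (intro ratfun_sum ratfun_mult ratfun_const ratfun_charpoly ratfun_mpow A)
  then show "ratfun b (\<lambda>t. charpoly_deriv (A t) $ i $ j)"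
    by (simp add: charpoly_deriv_def sum_component mult.assoc)
qed

text \<open>One nonzero value makes the numerator a nonzero polynomial, so together with
  \<open>b\<close> it has only finitely many zeros in any interval.\<close>

lemma ratfun_nonzero_near_0:
  assumes f: "ratfun b f" and s: "poly b s \<noteq> 0" "f s \<noteq> 0" and e: "e > 0"
  obtains t where "0 < t" "t < e" "poly b t \<noteq> 0" "f t \<noteq> 0"
proof -
  obtain p k where p: "\<And>t. poly b t \<noteq> 0 \<Longrightarrow> f t * poly b t ^ k = poly p t"
    using f unfolding ratfun_def by blast
  have "poly (p * b) s \<noteq> 0" using p[OF s(1)] s by (metis mult_eq_0_iff poly_mult power_not_zero)
  then have "p * b \<noteq> 0" by auto
  then have "finite {t. poly (p * b) t = 0}" by (rule poly_roots_finite)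
  then have "infinite ({0<..<e} - {t. poly (p * b) t = 0})"
    using e by (intro Diff_infinite_finite) (auto simp: infinite_Ioo_iff)
  then obtain t where "t \<in> {0<..<e} - {t. poly (p * b) t = 0}"
    by (metis ex_in_conv finite.emptyI)
  then have "0 < t" "t < e" "poly p t \<noteq> 0" "poly b t \<noteq> 0" by auto
  then show thesis using that p[of t] by fastforce
qed

text \<open>By Cramer's rule the only denominator is
  \<open>det (mat 1 - t *\<^sub>R X)\<close>.\<close>

lemma ratfun_cay:
  fixes X :: "real^'n^'n"
  obtains b where "\<And>t. poly b t = det (mat 1 - t *\<^sub>R X)" "\<And>i j. ratfun b (\<lambda>t. cay (t *\<^sub>R X) $ i $ j)"
proof -
  have det: "\<exists>q. \<forall>t. poly q t = det (C t)" if C: "\<And>i j. \<exists>q. \<forall>t. poly q t = C t $ i $ j" for C :: "real \<Rightarrow> real^'n^'n"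
  proof -
    obtain c where c: "\<And>i j t. poly (c i j) t = C t $ i $ j" using C by metis
    have "poly (\<Sum>p\<in>{p. p permutes UNIV}. of_int (sign p) * (\<Prod>i\<in>UNIV. c i (p i))) t = det (C t)" for t
      by (simp add: det_def poly_sum poly_prod c)
    then show ?thesis by blast
  qed
  have en: "poly [:mat 1 $ i $ j, - (X $ i $ j):] t = (mat 1 - t *\<^sub>R X) $ i $ j" for i j t by simp
  obtain b where b: "\<And>t. poly b t = det (mat 1 - t *\<^sub>R X)" using det[of "\<lambda>t. mat 1 - t *\<^sub>R X"] en by metis
  have "ratfun b (\<lambda>t. matrix_inv (mat 1 - t *\<^sub>R X) $ k $ l)" for k l
  proof -
    let ?C = "\<lambda>t. \<chi> i j. if j = k then axis l 1 $ i else (mat 1 - t *\<^sub>R X) $ i $ j"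
    have "\<exists>q. \<forall>t. poly q t = ?C t $ i $ j" for i j
      by (cases "j = k") (auto intro: exI[of _ "[:axis l 1 $ i:]"] exI[of _ "[:mat 1 $ i $ j, - (X $ i $ j):]"])
    then obtain q where q: "\<And>t. poly q t = det (?C t)" using det[of ?C] by blast
    have "matrix_inv (mat 1 - t *\<^sub>R X) $ k $ l * poly b t ^ 1 = poly q t" if "poly b t \<noteq> 0" for t
    proof -
      have "invertible (mat 1 - t *\<^sub>R X)" using that b by (simp add: invertible_det_nz)
      then show ?thesis using that by (simp add: matrix_inv_component q b)
    qed
    then show ?thesis unfolding ratfun_def by blast
  qed
  then have "ratfun b (\<lambda>t. 2 * matrix_inv (mat 1 - t *\<^sub>R X) $ i $ j + - (mat 1 $ i $ j))" for i j
    by (intro ratfun_add ratfun_mult ratfun_const)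
  then have "ratfun b (\<lambda>t. cay (t *\<^sub>R X) $ i $ j)" for i j by (simp add: cay_def)
  then show thesis using that b by blast
qed

section \<open>Regular isometries are dense\<close>

lemma cmat_cay_eigen:
  assumes i: "invertible (mat 1 - X)" and v: "cmat X *v v = z *s v" "v \<noteq> 0"
  shows "z \<noteq> 1" "cmat (cay X) *v v = ((1 + z) / (1 - z)) *s v"
proof -
  have "cmat (mat 1 - X) *v v = (1 - z) *s v"
    by (simp add: cmat_simps matrix_vector_mult_diff_rdistrib v vec_eq_iff algebra_simps)
  moreover have "cmat (matrix_inv (mat 1 - X)) ** cmat (mat 1 - X) = mat 1"
    using i by (simp add: cmat_simps(5)[symmetric] mat_inv cmat_simps(4))
  ultimately have *: "(1 - z) *s (cmat (matrix_inv (mat 1 - X)) *v v) = v"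
    by (metis matrix_vector_mul_assoc matrix_vector_mul_lid vector_scalar_commute)
  then show z: "z \<noteq> 1" using v(2) by auto
  have "cmat (matrix_inv (mat 1 - X)) *v v
      = (1 / (1 - z) * (1 - z)) *s (cmat (matrix_inv (mat 1 - X)) *v v)"
    using z by simp
  also have "\<dots> = (1 / (1 - z)) *s v" by (simp only: vector_smult_assoc[symmetric] *)
  finally have "cmat (matrix_inv (mat 1 - X)) *v v = (1 / (1 - z)) *s v" .
  then have "cmat (cay X) *v v = 2 *s ((1 / (1 - z)) *s v) - v"
    unfolding cay_def cmat_simps(2) matrix_vector_mult_diff_rdistrib cmat_scaleR_mult
    by (simp add: cmat_simps)
  also have "\<dots> = (2 * (1 / (1 - z)) - 1) *s v"
    by (simp add: vec_eq_iff algebra_simps)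
  also have "2 * (1 / (1 - z)) - 1 = (1 + z) / (1 - z)" using z by (simp add: field_simps)
  finally show "cmat (cay X) *v v = ((1 + z) / (1 - z)) *s v" .
qed

text \<open>Distinct eigenvalues of \<open>X\<close> therefore give distinct eigenvalues of
  \<open>cay X\<close>.\<close>

lemma moebius_inj: "inj_on (\<lambda>z. (1 + z) / (1 - z)) (- {1 :: complex})"
  by (rule inj_onI) (auto simp: frac_eq_eq algebra_simps)

text \<open>A Cayley transform never has the eigenvalue -1, so a reflection can contribute it as a
  new one.\<close>

lemma moebius_neq: "z \<noteq> 1 \<Longrightarrow> (1 + z) / (1 - z) \<noteq> (- 1 :: complex)"
  by (auto simp: divide_eq_eq)

lemma cay_conj:
  fixes T :: "real^'n^'n"
  assumes T: "invertible T" and X: "invertible (mat 1 - X)"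
  shows "invertible (mat 1 - matrix_inv T ** X ** T)"
    "cay (matrix_inv T ** X ** T) = matrix_inv T ** cay X ** T"
proof -
  have eq: "mat 1 - matrix_inv T ** X ** T = matrix_inv T ** (mat 1 - X) ** T"
    using T by (simp add: mm.diff_left mm.diff_right mat_inv)
  have "(matrix_inv T ** (mat 1 - X) ** T) ** (matrix_inv T ** matrix_inv (mat 1 - X) ** T) = mat 1"
    using T X by (simp add: matrix_mul_assoc[symmetric] mat_inv)
  note this[folded eq]
  from matrix_inv_unique[OF this]
  show "invertible (mat 1 - matrix_inv T ** X ** T)"
    "cay (matrix_inv T ** X ** T) = matrix_inv T ** cay X ** T"
    using T by (simp_all add: cay_def mm.diff_left mm.diff_right mm.scaleR_left mm.scaleR_right mat_inv)
qed

context lorentz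
begin

definition regular_limit :: "real^'n^'n \<Rightarrow> bool" where
  "regular_limit T \<longleftrightarrow> (\<forall>e>0. \<exists>R\<in>G. regular R \<and> norm (R - T) < e)"

lemma regular_regular_limit: "R \<in> G \<Longrightarrow> regular R \<Longrightarrow> regular_limit R"
  unfolding regular_limit_def by (metis diff_self norm_zero)

text \<open>Along \<open>t \<mapsto> T cay (t X)\<close> the discriminant is a rational function, so if it is nonzero somewhere,
  it is nonzero for arbitrarily small \<open>t\<close>.\<close>

lemma regular_limit_cay_right:
  assumes T: "T \<in> G" and X: "X \<in> skew" "invertible (mat 1 - X)" and regular_limit: "regular_limit (T ** cay X)"
  shows "regular_limit T"
proof -
  note TO = OB_D[OF G_OB[OF T]]
  have "open ((\<lambda>R. mat 1 + adj T ** R) -` {A. invertible A})"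
    by (intro open_vimage open_invertible continuous_intros mm.continuous_on)
  moreover have "T ** cay X \<in> (\<lambda>R. mat 1 + adj T ** R) -` {A. invertible A}"
  proof -
    have "mat 1 + adj T ** (T ** cay X) = 2 *\<^sub>R matrix_inv (mat 1 - X)"
      using TO by (simp add: matrix_mul_assoc cay_def)
    then show ?thesis using X scalar_invertible[of 2 "matrix_inv (mat 1 - X)"]
      by (simp add: invertible_matrix_inv)
  qed
  ultimately obtain d where d: "d > 0" "ball (T ** cay X) d \<subseteq> (\<lambda>R. mat 1 + adj T ** R) -` {A. invertible A}"
    by (rule openE)
  \<comment> \<open>\<open>T ** cay X\<close> is only a limit of regular isometries. A regular
    \<open>R\<close> close enough to it still lies in the Cayley chart around \<open>T\<close>, so a
    curve from \<open>T\<close> to \<open>R\<close> itself can be used.\<close>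
  obtain R where R: "R \<in> G" "regular R" "norm (R - T ** cay X) < d" using regular_limit d(1) unfolding regular_limit_def by blast
  have "R \<in> ball (T ** cay X) d" using R(3) by (simp add: dist_norm norm_minus_commute)
  then have i: "invertible (mat 1 + adj T ** R)" using d(2) by blast
  define Y where "Y = mat 1 - 2 *\<^sub>R matrix_inv (mat 1 + adj T ** R)"
  have Y: "Y \<in> skew" "invertible (mat 1 - Y)" "cay Y = adj T ** R"
    using OB_cay_skew[OF _ i] cay_surj[OF i] R(1) T unfolding Y_def by (auto simp: OB_mult OB_adj G_OB)
  then have TY: "T ** cay Y = R" using TO by (simp add: matrix_mul_assoc)
  obtain b where b: "\<And>t. poly b t = det (mat 1 - t *\<^sub>R Y)" "\<And>i j. ratfun b (\<lambda>t. cay (t *\<^sub>R Y) $ i $ j)"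
    by (rule ratfun_cay) blast
  have rat: "ratfun b (\<lambda>t. disc (T ** cay (t *\<^sub>R Y)))"
    by (intro ratfun_disc ratfun_matrix_mult ratfun_const b)
  have b1: "poly b 1 \<noteq> 0" using Y(2) by (simp add: b invertible_det_nz)
  have f1: "disc (T ** cay (1 *\<^sub>R Y)) \<noteq> 0" using TY R(2) by (simp add: regular_iff_disc)
  show ?thesis
    unfolding regular_limit_def
  proof (intro allI impI)
    fix e :: real assume e: "e > 0"
    let ?I = "{t. invertible (mat 1 - t *\<^sub>R Y)}"
    have "open ((\<lambda>t. mat 1 - t *\<^sub>R Y) -` {A. invertible A})"
      by (intro open_vimage open_invertible continuous_intros)
    then have I: "open ?I" by (simp add: vimage_def)
    have "continuous_on ?I (\<lambda>t. T ** cay (t *\<^sub>R Y))"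
      unfolding cay_def by (intro continuous_intros mm.continuous_on) auto
    then have "open ((\<lambda>t. T ** cay (t *\<^sub>R Y)) -` (ball T e \<inter> {A. B e0 (A *v e0) > 0}) \<inter> ?I)"
    proof -
      have "open {A. B e0 (A *v e0) > 0}"
        by (intro open_Collect_less continuous_intros mv.continuous_on)
      then have "open (ball T e \<inter> {A. B e0 (A *v e0) > 0})" by blast
      then show ?thesis
        using continuous_on_open_vimage[OF I] \<open>continuous_on ?I (\<lambda>t. T ** cay (t *\<^sub>R Y))\<close> by blast
    qed
    moreover have "0 \<in> (\<lambda>t. T ** cay (t *\<^sub>R Y)) -` (ball T e \<inter> {A. B e0 (A *v e0) > 0}) \<inter> ?I"
      using e T by (simp add: G_iff)
    ultimately obtain r where r: "r > 0"
      "ball 0 r \<subseteq> (\<lambda>t. T ** cay (t *\<^sub>R Y)) -` (ball T e \<inter> {A. B e0 (A *v e0) > 0}) \<inter> ?I"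
      by (rule openE)
    obtain t where t: "0 < t" "t < r" "poly b t \<noteq> 0" "disc (T ** cay (t *\<^sub>R Y)) \<noteq> 0"
      using ratfun_nonzero_near_0[OF rat b1 f1 r(1)] by blast
    have "t \<in> ball 0 r" using t by simp
    then have t': "norm (T ** cay (t *\<^sub>R Y) - T) < e" "B e0 ((T ** cay (t *\<^sub>R Y)) *v e0) > 0"
      "invertible (mat 1 - t *\<^sub>R Y)"
      using r(2) by (auto simp: dist_norm norm_minus_commute subset_iff)
    have "t *\<^sub>R Y \<in> skew" using Y(1) subspace_skew by (simp add: subspace_def)
    then have "T ** cay (t *\<^sub>R Y) \<in> G"
      using t' T by (simp add: G_iff OB_mult cay_OB)
    then show "\<exists>R\<in>G. regular R \<and> norm (R - T) < e"
      using t(4) t'(1) by (auto simp: regular_iff_disc)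
  qed
qed

text \<open>A left factor becomes a right one by \<open>cay X ** T = T ** cay (T^-1 X T)\<close>,
  and conjugation by an isometry keeps matrices skew.\<close>

lemma regular_limit_cay_left:
  assumes T: "T \<in> G" and X: "X \<in> skew" "invertible (mat 1 - X)" and regular_limit: "regular_limit (cay X ** T)"
  shows "regular_limit T"
proof (rule regular_limit_cay_right[OF T])
  note TO = OB_D[OF G_OB[OF T]]
  note c = cay_conj[OF TO(3) X(2)]
  show "matrix_inv T ** X ** T \<in> skew"
    using X(1) TO by (simp add: skew_def mm.minus_left mm.minus_right matrix_mul_assoc)
  show "invertible (mat 1 - matrix_inv T ** X ** T)" by (rule c)
  have "T ** (matrix_inv T ** cay X ** T) = cay X ** T"
    using TO(3) by (simp add: matrix_mul_assoc[symmetric] mat_inv)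
  then show "regular_limit (T ** cay (matrix_inv T ** X ** T))" using regular_limit c(2) by simp
qed

section \<open>Infinitesimal rotations and boosts in a plane, and Cayley transforms moving one
  vector to another\<close>

definition wedge :: "real^'n \<Rightarrow> real^'n \<Rightarrow> real^'n^'n" where
  "wedge a b = matrix (\<lambda>y. B a y *\<^sub>R b - B b y *\<^sub>R a)"

lemma wedge_apply: "wedge a b *v y = B a y *\<^sub>R b - B b y *\<^sub>R a"
proof -
  have "linear (\<lambda>y. B a y *\<^sub>R b - B b y *\<^sub>R a)"
    by (rule linearI) (auto simp: algebra_simps)
  then show ?thesis unfolding wedge_def by (simp add: matrix_works)
qed

lemma wedge_skew: "wedge a b \<in> skew"
proof -
  have "adj (wedge a b) = - wedge a b"
    by (rule adj_unique) (simp add: wedge_apply mat_vec B_sym algebra_simps)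
  then show ?thesis by (simp add: skew_def)
qed

text \<open>With \<open>a = u + v\<close> and \<open>b = v - u\<close>, the skew matrix of the plane
  of \<open>a\<close> and \<open>b\<close> is scaled so that it maps \<open>a\<close> to
  \<open>b\<close>, which says \<open>(1 - X) v = (1 + X) u\<close>. The scaling needs
  \<open>B a a \<noteq> 0\<close>, and invertibility of \<open>1 - X\<close> needs
  \<open>B u u \<noteq> 0\<close>.\<close>

lemma transvection:
  assumes uv: "B u u = B v v" "B u u \<noteq> 0" "B (u + v) (u + v) \<noteq> 0"
  obtains X where "X \<in> skew" "invertible (mat 1 - X)" "cay X *v u = v"
    "\<And>y. B u y = 0 \<Longrightarrow> B v y = 0 \<Longrightarrow> cay X *v y = y"
proof -
  define a b where "a = u + v" and "b = v - u"
  have ab: "B a b = 0" "B b a = 0" using uv(1) by (simp_all add: a_def b_def B_sym)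
  have aa: "B a a \<noteq> 0" using uv(3) by (simp add: a_def)
  define X where "X = (1 / B a a) *\<^sub>R wedge a b"
  have Xy: "X *v y = (B a y / B a a) *\<^sub>R b - (B b y / B a a) *\<^sub>R a" for y
    by (simp add: X_def mat_vec wedge_apply scaleR_diff_right)
  have sk: "X \<in> skew" using wedge_skew subspace_skew unfolding X_def by (simp add: subspace_def)
  have Xa: "X *v a = b" using aa ab by (simp add: Xy)
  have Xb: "X *v b = - (B b b / B a a) *\<^sub>R a" using ab by (simp add: Xy)
  have i: "invertible (mat 1 - X)"
    unfolding invertible_iff_ker
  proof (intro allI impI)
    fix y assume "(mat 1 - X) *v y = 0"
    then have y: "X *v y = y" by (simp add: mat_vec)
    \<comment> \<open>A vector fixed by \<open>X\<close> lies in the plane of \<open>a\<close> and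
      \<open>b\<close>, on which \<open>X\<close> has the square \<open>- r\<close>. If it is
      nonzero, then \<open>r = - 1\<close>, that is
      \<open>B a a + B b b = 4 * B u u = 0\<close>.\<close>
    define r \<alpha> \<beta> where "r = B b b / B a a" and "\<alpha> = B a y / B a a" and "\<beta> = B b y / B a a"
    have yab: "y = \<alpha> *\<^sub>R b - \<beta> *\<^sub>R a" using Xy y unfolding \<alpha>_def \<beta>_def by metis
    have Xr: "X *v b = - (r *\<^sub>R a)" using Xb by (simp add: r_def)
    have "X *v (X *v (\<alpha> *\<^sub>R b - \<beta> *\<^sub>R a)) = - (r *\<^sub>R (\<alpha> *\<^sub>R b - \<beta> *\<^sub>R a))"
      by (simp add: mat_vec Xa Xr algebra_simps)
    then have "X *v (X *v y) = - (r *\<^sub>R y)" by (simp only: yab[symmetric])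
    then have "y = - (B b b / B a a) *\<^sub>R y" using y by (simp add: r_def)
    then have "(1 + B b b / B a a) *\<^sub>R y = 0"
      by (simp add: scaleR_add_left eq_neg_iff_add_eq_0)
    moreover have "1 + B b b / B a a \<noteq> 0"
    proof
      assume "1 + B b b / B a a = 0"
      then have "B a a + B b b = 0" using aa by (simp add: field_simps)
      moreover have "B a a + B b b = 4 * B u u" using uv(1) by (simp add: a_def b_def)
      ultimately show False using uv(2) by simp
    qed
    ultimately show "y = 0" by simp
  qed
  show thesis
  proof
    show "X \<in> skew" "invertible (mat 1 - X)" by fact+
    have "X *v u + X *v v = v - u" using Xa by (simp add: a_def b_def mat_vec)
    then show "cay X *v u = v"
      by (intro cay_vector[OF i]) (simp add: mat_vec algebra_simps)
    fix y assume "B u y = 0" "B v y = 0"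
    then have "X *v y = 0" by (simp add: Xy a_def b_def)
    then show "cay X *v y = y" by (intro cay_vector[OF i]) (simp add: mat_vec)
  qed
qed

end

section \<open>An orthonormal basis and explicit regular isometries\<close>

locale lorentz_basis = lorentz J "e 0" for J :: "real^'n^'n" and e :: "nat \<Rightarrow> real^'n" +
  assumes B_basis: "i < CARD('n) \<Longrightarrow> j < CARD('n) \<Longrightarrow>
      B (e i) (e j) = (if i = j then if i = 0 then 1 else - 1 else 0)"
    and span_basis: "span (e ` {..<CARD('n)}) = UNIV"
begin

lemma basis_ext:
  assumes "\<And>i. i < CARD('n) \<Longrightarrow> A *v e i = C *v e i"
  shows "A = C"
proof -
  have "A *v x = C *v x" for x
    by (rule linear_eq_on_span[of "(*v) A" "(*v) C" "e ` {..<CARD('n)}"])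
      (use assms span_basis in auto)
  then show ?thesis by (simp add: matrix_eq)
qed

lemma basis_nonzero: "i < CARD('n) \<Longrightarrow> e i \<noteq> 0"
proof
  assume i: "i < CARD('n)" and z: "e i = 0"
  have "B (e i) (e i) = 0" unfolding z by simp
  then show False using B_basis[OF i i] by (simp split: if_splits)
qed

text \<open>Induction in steps of two, adding one coordinate plane at a time: a boost with real
  eigenvalues if the plane contains \<open>e 0\<close>, otherwise a rotation with imaginary ones. An
  odd \<open>m\<close> starts with \<open>e 0\<close> and the eigenvalue 0. Orthogonality to the
  later basis vectors is carried along so that a new plane leaves the old eigenvectors
  alone.\<close>

lemma skew_planes:
  assumes "m \<le> CARD('n)"
  shows "\<exists>X\<in>skew. (\<forall>i<CARD('n). m \<le> i \<longrightarrow> X *v e i = 0) \<and>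
    (\<exists>K. finite K \<and> card K = m \<and> (\<forall>z\<in>K. \<exists>x y. (x \<noteq> 0 \<or> y \<noteq> 0) \<and>
       X *v x = Re z *\<^sub>R x - Im z *\<^sub>R y \<and> X *v y = Im z *\<^sub>R x + Re z *\<^sub>R y \<and>
       (\<forall>i<CARD('n). m \<le> i \<longrightarrow> B x (e i) = 0 \<and> B y (e i) = 0)))"
  using assms
proof (induction m rule: induct_nat_012)
  case 0
  show ?case
    by (rule bexI[of _ 0]) (auto simp: skew_def intro!: exI[of _ "{}"])
next
  case 1
  show ?case
  proof (rule bexI[of _ 0], intro conjI exI[of _ "{0}"])
    show "\<forall>z\<in>{0}. \<exists>x y. (x \<noteq> 0 \<or> y \<noteq> 0) \<and> 0 *v x = Re z *\<^sub>R x - Im z *\<^sub>R y \<and>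
       0 *v y = Im z *\<^sub>R x + Re z *\<^sub>R y \<and>
       (\<forall>i<CARD('n). Suc 0 \<le> i \<longrightarrow> B x (e i) = 0 \<and> B y (e i) = 0)"
      by (rule ballI, rule exI[of _ "e 0"], rule exI[of _ 0]) (auto simp: basis_nonzero B_basis)
  qed (auto simp: skew_def)
next
  case (ge2 m)
  then have m: "m < CARD('n)" "Suc m < CARD('n)" by auto
  from ge2 obtain X K where X: "X \<in> skew" "\<And>i. i < CARD('n) \<Longrightarrow> m \<le> i \<Longrightarrow> X *v e i = 0"
    and K: "finite K" "card K = m"
    and ev: "\<forall>z\<in>K. \<exists>x y. (x \<noteq> 0 \<or> y \<noteq> 0) \<and>
       X *v x = Re z *\<^sub>R x - Im z *\<^sub>R y \<and> X *v y = Im z *\<^sub>R x + Re z *\<^sub>R y \<and>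
       (\<forall>i<CARD('n). m \<le> i \<longrightarrow> B x (e i) = 0 \<and> B y (e i) = 0)"
    by auto
  \<comment> \<open>Larger than the modulus of every earlier eigenvalue, so the two new eigenvalues
    of modulus \<open>c\<close> are really new.\<close>
  define c where "c = 1 + (\<Sum>z\<in>K. cmod z)"
  have cK: "cmod z < c" if "z \<in> K" for z
    using member_le_sum[OF that, of cmod] K(1) by (simp add: c_def)
  have c: "c > 0" unfolding c_def by (intro add_pos_nonneg sum_nonneg) auto
  define p q where "p = e m" and "q = e (Suc m)"
  have pq: "B q q = -1" "B p q = 0" "B q p = 0" "B p p = (if m = 0 then 1 else -1)" "p \<noteq> 0" "q \<noteq> 0"
    using m by (auto simp: p_def q_def B_basis basis_nonzero)
  define Y where "Y = X + c *\<^sub>R wedge p q"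
  have Yy: "Y *v y = X *v y + c *\<^sub>R (B p y *\<^sub>R q - B q y *\<^sub>R p)" for y
    by (simp add: Y_def mat_vec wedge_apply)
  have X0: "X *v p = 0" "X *v q = 0" using X(2) m by (auto simp: p_def q_def)
  have Yp: "Y *v p = (c * B p p) *\<^sub>R q" and Yq: "Y *v q = c *\<^sub>R p"
    by (simp_all add: Yy X0 pq)
  have orth: "B p (e i) = 0" "B q (e i) = 0" if "i < CARD('n)" "Suc (Suc m) \<le> i" for i
    using that m by (auto simp: p_def q_def B_basis)
  define l1 l2 where "l1 = (if m = 0 then Complex c 0 else Complex 0 c)"
    and "l2 = (if m = 0 then Complex (- c) 0 else Complex 0 (- c))"
  define K' where "K' = insert l1 (insert l2 K)"
  have l: "cmod l1 = c" "cmod l2 = c" "l1 \<noteq> l2"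
    using c by (auto simp: l1_def l2_def cmod_def)
  have lK: "l1 \<notin> K" "l2 \<notin> K" using cK l by force+
  let ?P = "\<lambda>z. \<exists>x y. (x \<noteq> 0 \<or> y \<noteq> 0) \<and>
       Y *v x = Re z *\<^sub>R x - Im z *\<^sub>R y \<and> Y *v y = Im z *\<^sub>R x + Re z *\<^sub>R y \<and>
       (\<forall>i<CARD('n). Suc (Suc m) \<le> i \<longrightarrow> B x (e i) = 0 \<and> B y (e i) = 0)"
  have old: "?P z" if "z \<in> K" for z
  proof -
    obtain x y where xy: "x \<noteq> 0 \<or> y \<noteq> 0" "X *v x = Re z *\<^sub>R x - Im z *\<^sub>R y"
      "X *v y = Im z *\<^sub>R x + Re z *\<^sub>R y" "\<And>i. i < CARD('n) \<Longrightarrow> m \<le> i \<Longrightarrow> B x (e i) = 0 \<and> B y (e i) = 0"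
      using ev \<open>z \<in> K\<close> by blast
    have "B p x = 0" "B q x = 0" "B p y = 0" "B q y = 0"
      using xy(4)[of m] xy(4)[of "Suc m"] m by (auto simp: p_def q_def B_sym)
    then have "Y *v x = X *v x" "Y *v y = X *v y" by (simp_all add: Yy)
    then show ?thesis using xy by (intro exI[of _ x] exI[of _ y]) auto
  qed
  have new1: "?P l1"
  proof (cases "m = 0")
    case True
    then show ?thesis
      using Yp Yq pq orth
      by (intro exI[of _ "p + q"] exI[of _ 0]) (auto simp: l1_def mat_vec algebra_simps add_eq_0_iff)
  next
    case False
    then show ?thesis
      using Yp Yq pq orth by (intro exI[of _ p] exI[of _ q]) (auto simp: l1_def)
  qed
  have new2: "?P l2"
  proof (cases "m = 0")
    case True
    then show ?thesis
      using Yp Yq pq orth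
      by (intro exI[of _ "p - q"] exI[of _ 0]) (auto simp: l2_def mat_vec algebra_simps)
  next
    case False
    then show ?thesis
      using Yp Yq pq orth by (intro exI[of _ p] exI[of _ "- q"]) (auto simp: l2_def mat_vec)
  qed
  have "Y \<in> skew"
    using X(1) wedge_skew[of p q] subspace_skew unfolding Y_def by (auto simp: subspace_def)
  moreover have "Y *v e i = 0" if "i < CARD('n)" "Suc (Suc m) \<le> i" for i
    using X(2)[of i] orth[OF that] that by (simp add: Yy)
  moreover have "finite K'" "card K' = Suc (Suc m)" using K l lK by (auto simp: K'_def)
  moreover have "\<forall>z\<in>K'. ?P z" using old new1 new2 by (auto simp: K'_def)
  ultimately show ?case by blast
qed

text \<open>A small multiple of the matrix from \<open>skew_planes\<close> has its Cayley transform
  in \<open>G\<close>. The Moebius map keeps the eigenvalues distinct and avoids -1.\<close>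

lemma cay_planes:
  assumes "m \<le> CARD('n)"
  obtains X L where "X \<in> skew" "invertible (mat 1 - X)" "cay X \<in> G"
    "\<And>i. i < CARD('n) \<Longrightarrow> m \<le> i \<Longrightarrow> cay X *v e i = e i"
    "finite L" "card L = m" "- 1 \<notin> L"
    "\<And>z. z \<in> L \<Longrightarrow> \<exists>x y. cvec x y \<noteq> 0 \<and> cmat (cay X) *v cvec x y = z *s cvec x y \<and>
       (\<forall>i<CARD('n). m \<le> i \<longrightarrow> B x (e i) = 0 \<and> B y (e i) = 0)"
proof -
  obtain X K where X: "X \<in> skew" "\<And>i. i < CARD('n) \<Longrightarrow> m \<le> i \<Longrightarrow> X *v e i = 0"
    and K: "finite K" "card K = m"
    and ev: "\<And>z. z \<in> K \<Longrightarrow> \<exists>x y. (x \<noteq> 0 \<or> y \<noteq> 0) \<and>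
       X *v x = Re z *\<^sub>R x - Im z *\<^sub>R y \<and> X *v y = Im z *\<^sub>R x + Re z *\<^sub>R y \<and>
       (\<forall>i<CARD('n). m \<le> i \<longrightarrow> B x (e i) = 0 \<and> B y (e i) = 0)"
    using skew_planes[OF assms] by blast
  obtain t where t: "t > 0" "invertible (mat 1 - t *\<^sub>R X)" "cay (t *\<^sub>R X) \<in> G"
    using small_cay_G[OF X(1)] by blast
  define f where "f z = (1 + of_real t * z) / (1 - of_real t * z)" for z :: complex
  have ev': "of_real t * z \<noteq> 1 \<and> (\<exists>x y. cvec x y \<noteq> 0 \<and> cmat (cay (t *\<^sub>R X)) *v cvec x y = f z *s cvec x y \<and>
       (\<forall>i<CARD('n). m \<le> i \<longrightarrow> B x (e i) = 0 \<and> B y (e i) = 0))" if "z \<in> K" for z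
  proof -
    obtain x y where xy: "x \<noteq> 0 \<or> y \<noteq> 0" "X *v x = Re z *\<^sub>R x - Im z *\<^sub>R y" "X *v y = Im z *\<^sub>R x + Re z *\<^sub>R y"
      and o: "\<forall>i<CARD('n). m \<le> i \<longrightarrow> B x (e i) = 0 \<and> B y (e i) = 0"
      using ev[OF \<open>z \<in> K\<close>] by blast
    have nz: "cvec x y \<noteq> 0" using xy(1) by (simp add: cvec_0)
    have "cmat X *v cvec x y = z *s cvec x y" using xy by (simp add: cmat_cvec scale_cvec)
    then have "cmat (t *\<^sub>R X) *v cvec x y = (of_real t * z) *s cvec x y"
      by (simp add: cmat_scaleR_mult vector_smult_assoc)
    from cmat_cay_eigen[OF t(2) this nz] show ?thesis using nz o unfolding f_def by blast
  qed
  have inj: "inj_on f K"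
  proof (rule inj_onI)
    fix z w assume zw: "z \<in> K" "w \<in> K" "f z = f w"
    then have "of_real t * z = of_real t * w"
      using inj_onD[OF moebius_inj, of "of_real t * z" "of_real t * w"] ev' by (simp add: f_def)
    then show "z = w" using t(1) by simp
  qed
  show thesis
  proof
    show "t *\<^sub>R X \<in> skew" using X(1) subspace_skew by (simp add: subspace_def)
    show "invertible (mat 1 - t *\<^sub>R X)" "cay (t *\<^sub>R X) \<in> G" by fact+
    show "cay (t *\<^sub>R X) *v e i = e i" if "i < CARD('n)" "m \<le> i" for i
      using X(2)[OF that] by (intro cay_vector[OF t(2)]) (simp add: mat_vec)
    show "finite (f ` K)" "card (f ` K) = m" using K inj by (simp_all add: card_image)
    show "- 1 \<notin> f ` K" using ev' moebius_neq unfolding f_def by fastforce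
    show "\<exists>x y. cvec x y \<noteq> 0 \<and> cmat (cay (t *\<^sub>R X)) *v cvec x y = z *s cvec x y \<and>
       (\<forall>i<CARD('n). m \<le> i \<longrightarrow> B x (e i) = 0 \<and> B y (e i) = 0)" if "z \<in> f ` K" for z
      using that ev' by blast
  qed
qed

lemma regular_limit_1: "regular_limit (mat 1)"
proof -
  obtain X L where X: "X \<in> skew" "invertible (mat 1 - X)" "cay X \<in> G" and L: "card L = CARD('n)"
    "\<And>z. z \<in> L \<Longrightarrow> \<exists>x y. cvec x y \<noteq> 0 \<and> cmat (cay X) *v cvec x y = z *s cvec x y \<and>
       (\<forall>i<CARD('n). CARD('n) \<le> i \<longrightarrow> B x (e i) = 0 \<and> B y (e i) = 0)"
    by (rule cay_planes[of "CARD('n)"]) auto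
  have "L \<subseteq> cspec (cay X)" using L(2) unfolding subset_iff cspec_iff by blast
  then have "regular (cay X)" using regularI(1)[of L "cay X"] L(1) by simp
  then have "regular_limit (mat 1 ** cay X)" using X(3) regular_regular_limit by simp
  then show ?thesis by (rule regular_limit_cay_right[OF G_1 X(1,2)])
qed

text \<open>The complement of \<open>e n\<close> provides \<open>n\<close> distinct eigenvalues,
  none of them -1, and the reflection provides -1 on \<open>e n\<close>.\<close>

lemma regular_limit_reflection:
  assumes n: "CARD('n) = Suc n" "n > 0"
  shows "regular_limit (reflection (e n))"
proof -
  let ?r = "reflection (e n)"
  have en: "B (e n) (e n) = -1" using n by (simp add: B_basis)
  then have rG: "?r \<in> G" by (intro reflection_G) simp
  obtain X L where X: "X \<in> skew" "invertible (mat 1 - X)" "cay X \<in> G"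
    "\<And>i. i < CARD('n) \<Longrightarrow> n \<le> i \<Longrightarrow> cay X *v e i = e i" and L: "finite L" "card L = n" "- 1 \<notin> L"
    "\<And>z. z \<in> L \<Longrightarrow> \<exists>x y. cvec x y \<noteq> 0 \<and> cmat (cay X) *v cvec x y = z *s cvec x y \<and>
       (\<forall>i<CARD('n). n \<le> i \<longrightarrow> B x (e i) = 0 \<and> B y (e i) = 0)"
    by (rule cay_planes[of n]) (use n in auto)
  have "z \<in> cspec (?r ** cay X)" if zL: "z \<in> L" for z
  proof -
    obtain x y where xy: "cvec x y \<noteq> 0" "cmat (cay X) *v cvec x y = z *s cvec x y"
      "B x (e n) = 0" "B y (e n) = 0"
      using L(4)[OF zL] n by auto
    have "cmat ?r *v cvec x y = cvec x y"
      using xy(3,4) by (simp add: cmat_cvec reflection_apply)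
    then have "cmat (?r ** cay X) *v cvec x y = z *s cvec x y"
      by (simp add: cmat_simps matrix_vector_mul_assoc[symmetric] xy(2) vector_scalar_commute)
    then show ?thesis using xy(1) cspec_iff by blast
  qed
  moreover have "- 1 \<in> cspec (?r ** cay X)"
  proof -
    have Xn: "cay X *v e n = e n" using X(4)[of n] n by simp
    have "(?r ** cay X) *v e n = (- 1) *\<^sub>R e n"
      unfolding matrix_vector_mul_assoc[symmetric] Xn
      using en by (simp add: reflection_apply vec_eq_iff)
    then have "of_real (- 1) \<in> cspec (?r ** cay X)"
      using of_real_cspec_iff[of "- 1" "?r ** cay X"] basis_nonzero[of n] n by auto
    then show ?thesis by simp
  qed
  ultimately have "insert (- 1) L \<subseteq> cspec (?r ** cay X)" by blast
  moreover have "card (insert (- 1) L) = CARD('n)" using L n by simp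
  ultimately have "regular (?r ** cay X)" using regularI(1)[of "insert (- 1) L" "?r ** cay X"] by simp
  then have "regular_limit (?r ** cay X)" using G_mult[OF rG X(3)] regular_regular_limit by blast
  then show ?thesis by (rule regular_limit_cay_right[OF rG X(1,2)])
qed

text \<open>\<open>T *v e n\<close> is orthogonal to the fixed basis vectors, hence a multiple of
  \<open>e n\<close>, and preservation of the form leaves the factors 1 and -1.\<close>

lemma fixes_all_but_last:
  assumes T: "T \<in> G" and n: "CARD('n) = Suc n" and fx: "\<And>i. i < n \<Longrightarrow> T *v e i = e i"
  shows "T = mat 1 \<or> n > 0 \<and> T = reflection (e n)"
proof -
  have TO: "T \<in> OB" using T by (rule G_OB)
  define c where "c = B (T *v e n) (e n) * B (e n) (e n)"
  have ee: "B (e n) (e n) * B (e n) (e n) = 1" using n by (simp add: B_basis)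
  have "B (T *v e n - c *\<^sub>R e n) (e i) = 0" if "i < CARD('n)" for i
  proof (cases "i < n")
    case True
    then have "B (T *v e n) (e i) = B (T *v e n) (T *v e i)" using fx by simp
    also have "\<dots> = 0" using TO True n by (simp add: B_basis)
    finally show ?thesis using True n by (simp add: B_basis)
  next
    case False
    then have "i = n" using that n by simp
    then show ?thesis using ee by (simp add: c_def mult.assoc)
  qed
  then have "\<forall>x\<in>span (e ` {..<CARD('n)}). B (T *v e n - c *\<^sub>R e n) x = 0"
    by (intro ballI, elim span_induct) (auto simp: subspace_def algebra_simps)
  then have "T *v e n - c *\<^sub>R e n = 0"
    using span_basis B_nondegenerate[of "T *v e n - c *\<^sub>R e n"] by (simp add: B_sym)
  then have Ten: "T *v e n = c *\<^sub>R e n" by simp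
  have "B (T *v e n) (T *v e n) = B (e n) (e n)" using TO by simp
  then have "c * c * B (e n) (e n) = B (e n) (e n)" by (simp add: Ten)
  then have "c * c = 1" using ee by auto
  then consider "c = 1" | "c = -1" by (metis square_eq_1_iff)
  then show ?thesis
  proof cases
    case 1
    have "T = mat 1"
    proof (rule basis_ext)
      fix i assume "i < CARD('n)"
      then consider "i < n" | "i = n" using n by linarith
      then show "T *v e i = mat 1 *v e i" using fx Ten 1 by cases auto
    qed
    then show ?thesis ..
  next
    case 2
    \<comment> \<open>In dimension 1 the factor -1 would exchange the two sheets.\<close>
    have n0: "n > 0"
    proof (rule ccontr)
      assume "\<not> n > 0"
      then show False using T Ten 2 by (simp add: G_iff)
    qed
    have "T = reflection (e n)"
    proof (rule basis_ext)
      fix i assume "i < CARD('n)"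
      then consider "i < n" | "i = n" using n by linarith
      then show "T *v e i = reflection (e n) *v e i"
        using fx Ten 2 n n0 by cases (auto simp: reflection_apply B_basis vec_eq_iff)
    qed
    then show ?thesis using n0 by simp
  qed
qed

text \<open>The transvection from \<open>T *v e k\<close> to \<open>v\<close> fixes the earlier
  basis vectors, because they are orthogonal to both. Multiplying by it on the left prescribes the
  image of one more basis vector.\<close>

lemma regular_limit_move:
  assumes T: "T \<in> G" and k: "k < CARD('n)" and fx: "\<And>i. i < k \<Longrightarrow> T *v e i = e i"
    and v: "B v v = B (e k) (e k)" "\<And>i. i < k \<Longrightarrow> B v (e i) = 0" "k = 0 \<Longrightarrow> v \<in> H"
    and nz: "B (T *v e k + v) (T *v e k + v) \<noteq> 0"
    and regular_limit: "\<And>T'. T' \<in> G \<Longrightarrow> (\<And>i. i < k \<Longrightarrow> T' *v e i = e i) \<Longrightarrow> T' *v e k = v \<Longrightarrow> regular_limit T'"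
  shows "regular_limit T"
proof -
  have TO: "T \<in> OB" using T by (rule G_OB)
  have "B (T *v e k) (T *v e k) = B v v" using TO v(1) by simp
  moreover have "B (T *v e k) (T *v e k) \<noteq> 0" using TO k by (simp add: B_basis)
  ultimately obtain X where X: "X \<in> skew" "invertible (mat 1 - X)" "cay X *v (T *v e k) = v"
    "\<And>y. B (T *v e k) y = 0 \<Longrightarrow> B v y = 0 \<Longrightarrow> cay X *v y = y"
    using transvection[OF _ _ nz] by metis
  have fixX: "cay X *v e i = e i" if "i < k" for i
  proof (rule X(4))
    have "B (T *v e k) (e i) = B (T *v e k) (T *v e i)" using fx that by simp
    also have "\<dots> = 0" using TO that k by (simp add: B_basis)
    finally show "B (T *v e k) (e i) = 0" .
  qed (rule v(2)[OF that])
  have "cay X \<in> G"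
  proof (cases "k = 0")
    case True
    then show ?thesis
      using G_I[OF cay_OB[OF X(1,2)], of "T *v e 0"] G_H[OF T e0_in_H] v(3) X(3) by simp
  next
    case False
    then show ?thesis using G_I[OF cay_OB[OF X(1,2)] e0_in_H] fixX[of 0] e0_in_H by simp
  qed
  then have "regular_limit (cay X ** T)"
    by (intro regular_limit G_mult T) (simp_all add: matrix_vector_mul_assoc[symmetric] fx fixX X(3))
  then show ?thesis by (rule regular_limit_cay_left[OF T X(1,2)])
qed

text \<open>Downward induction on the number \<open>k\<close> of fixed basis vectors; a transvection
  moves \<open>T *v e k\<close> to \<open>e k\<close>. The only obstruction is an isotropic sum of
  these two.\<close>

theorem G_regular_limit: "T \<in> G \<Longrightarrow> regular_limit T"
proof -
  obtain n where n: "CARD('n) = Suc n" using zero_less_card_finite[where 'a = 'n] by (metis gr0_implies_Suc)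
  have "regular_limit T" if "k \<le> n" "T \<in> G" "\<And>i. i < k \<Longrightarrow> T *v e i = e i" for k T
    using that
  proof (induction k arbitrary: T rule: inc_induct)
    case base
    then show ?case using fixes_all_but_last[of T n] n regular_limit_1 regular_limit_reflection by blast
  next
    case (step k)
    note k = \<open>k < n\<close> and IH = step.IH and T = \<open>T \<in> G\<close> and fx = step.prems(2)
    have TO: "T \<in> OB" using T by (rule G_OB)
    have kc: "k < CARD('n)" "Suc k < CARD('n)" using k n by auto
    have near: "regular_limit T'" if T': "T' \<in> G" "\<And>i. i < k \<Longrightarrow> T' *v e i = e i"
      and nz: "B (T' *v e k + e k) (T' *v e k + e k) \<noteq> 0" for T'
    proof (rule regular_limit_move[OF T'(1) kc(1) T'(2) _ _ _ nz])
      show "B (e k) (e i) = 0" if "i < k" for i using that kc by (simp add: B_basis)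
      show "e k \<in> H" if "k = 0" using that e0_in_H by simp
      fix T'' assume T'': "T'' \<in> G" "\<And>i. i < k \<Longrightarrow> T'' *v e i = e i" "T'' *v e k = e k"
      show "regular_limit T''"
        by (rule IH[OF T''(1)]) (use T'' less_Suc_eq in blast)
    qed auto
    show ?case
    proof (cases "B (T *v e k + e k) (T *v e k + e k) = 0")
      case False
      then show ?thesis using near T fx by blast
    next
      \<comment> \<open>Two vectors in \<open>H\<close> have a sum of positive square, so
        \<open>k \<noteq> 0\<close>. Then the sum is isotropic and orthogonal to \<open>e 0\<close>,
        hence 0. A detour over \<open>e (Suc k)\<close>, which exists as \<open>k < n\<close>,
        avoids moving a vector to its opposite.\<close>
      case True
      have k0: "k \<noteq> 0"
      proof
        assume "k = 0"
        have "B (e 0) (T *v e 0) > 0" using T by (simp add: G_iff)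
        moreover have "B (T *v e 0 + e 0) (T *v e 0 + e 0) = 2 + 2 * B (e 0) (T *v e 0)"
          using TO by (simp add: B_sym[of "T *v e 0" "e 0"])
        ultimately show False using True \<open>k = 0\<close> by simp
      qed
      have "B (e 0) (T *v e k) = B (T *v e 0) (T *v e k)" using fx k0 by simp
      also have "\<dots> = 0" using TO kc k0 by (simp add: B_basis)
      finally have "B (e 0) (T *v e k + e k) = 0" using kc k0 by (simp add: B_basis)
      then have "T *v e k + e k = 0" using B_nonneg_eq_0 True by simp
      then have Tk: "T *v e k = - e k" by (simp add: eq_neg_iff_add_eq_0)
      show ?thesis
      proof (rule regular_limit_move[OF T kc(1) fx])
        show "B (e (Suc k)) (e (Suc k)) = B (e k) (e k)" using kc k0 by (simp add: B_basis)
        show "B (e (Suc k)) (e i) = 0" if "i < k" for i using that kc by (simp add: B_basis)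
        show "e (Suc k) \<in> H" if "k = 0" using that k0 by simp
        show "B (T *v e k + e (Suc k)) (T *v e k + e (Suc k)) \<noteq> 0"
          using kc k0 by (simp add: Tk B_basis)
        fix T' assume T': "T' \<in> G" "\<And>i. i < k \<Longrightarrow> T' *v e i = e i" "T' *v e k = e (Suc k)"
        show "regular_limit T'"
          by (rule near[OF T'(1,2)]) (use kc k0 T'(3) in \<open>simp_all add: B_basis\<close>)
      qed
    qed
  qed
  then show "T \<in> G \<Longrightarrow> regular_limit T" by blast
qed

end

section \<open>Eigenvalues of isometries\<close>

lemma cspec_cis: "z \<in> cspec T \<Longrightarrow> cmod z = 1 \<Longrightarrow> Im z > 0 \<Longrightarrow>
    \<exists>\<theta>. 0 < \<theta> \<and> \<theta> < pi \<and> z = cis \<theta>"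
proof (rule exI[of _ "arccos (Re z)"])
  assume z: "cmod z = 1" "Im z > 0"
  have sq: "(Re z)\<^sup>2 + (Im z)\<^sup>2 = 1" using z(1) by (simp add: cmod_def)
  moreover have "(Im z)\<^sup>2 > 0" using z(2) by simp
  ultimately have "(Re z)\<^sup>2 < 1" by linarith
  then have b: "- 1 < Re z" "Re z < 1" by (auto simp: abs_square_less_1)
  have "sin (arccos (Re z)) = sqrt (1 - (Re z)\<^sup>2)" using b by (simp add: sin_arccos)
  also have "1 - (Re z)\<^sup>2 = (Im z)\<^sup>2" using sq by simp
  also have "sqrt ((Im z)\<^sup>2) = Im z" using z(2) by simp
  finally have "sin (arccos (Re z)) = Im z" .
  then show "0 < arccos (Re z) \<and> arccos (Re z) < pi \<and> z = cis (arccos (Re z))"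
    using b arccos_lt_bounded[of "Re z"] by (simp add: complex_eq_iff)
qed

lemma poly_real_complex: "poly (map_poly of_real p) (of_real x) = complex_of_real (poly p x)"
  by (induction p) (auto simp: map_poly_pCons)

lemma degree_le_1E:
  assumes "degree p \<le> 1"
  obtains a b where "p = [:a, b:]"
proof -
  obtain a q where p: "p = pCons a q" by (cases p)
  have "degree q = 0" using assms by (cases "q = 0") (auto simp: p degree_pCons_eq)
  then obtain b where "q = [:b:]" by (rule degree_eq_zeroE)
  then show thesis using that p by blast
qed

text \<open>The remainder modulo the quadratic is real and linear. Its value at
  \<open>cis \<theta>\<close> has imaginary part \<open>b * sin \<theta>\<close>, so it vanishes
  there only if it is 0.\<close>

lemma quadratic_dvd_iff:
  fixes p :: "real poly"
  assumes \<theta>: "0 < \<theta>" "\<theta> < pi"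
  shows "[:1, - 2 * cos \<theta>, 1:] dvd p \<longleftrightarrow> poly (map_poly of_real p) (cis \<theta>) = 0"
proof -
  let ?q = "[:1, - 2 * cos \<theta>, 1:] :: real poly"
  have "1 - 2 * cos \<theta> * cos \<theta> + (cos \<theta> * cos \<theta> - sin \<theta> * sin \<theta>) = 0"
    using sin_cos_squared_add[of \<theta>] by (simp add: power2_eq_square)
  then have q0: "poly (map_poly of_real ?q) (cis \<theta>) = 0"
    by (simp add: map_poly_pCons complex_eq_iff algebra_simps)
  have s: "sin \<theta> > 0" using \<theta> by (rule sin_gt_zero)
  show ?thesis
  proof
    assume "?q dvd p"
    then obtain r where "p = ?q * r" by (rule dvdE)
    then show "poly (map_poly of_real p) (cis \<theta>) = 0"
      by (simp only: map_poly_of_real_mult poly_mult q0) simp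
  next
    assume p: "poly (map_poly of_real p) (cis \<theta>) = 0"
    define r where "r = p mod ?q"
    have "p = ?q * (p div ?q) + r" unfolding r_def by (rule mult_div_mod_eq[symmetric])
    then have "poly (map_poly of_real p) (cis \<theta>) = poly (map_poly of_real ?q) (cis \<theta>) * poly (map_poly of_real (p div ?q)) (cis \<theta>)
       + poly (map_poly of_real r) (cis \<theta>)"
      by (metis map_poly_of_real_add map_poly_of_real_mult poly_add poly_mult)
    then have r0: "poly (map_poly of_real r) (cis \<theta>) = 0" using p q0 by simp
    have "degree r < 2 \<or> r = 0" using degree_mod_less[of ?q p] by (auto simp: r_def)
    then have "degree r \<le> 1" by auto
    then obtain a b where r: "r = [:a, b:]" by (rule degree_le_1E)
    have "b * sin \<theta> = 0" "a + cos \<theta> * b = 0"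
      using r0 by (auto simp: r map_poly_pCons complex_eq_iff)
    then have "r = 0" using s r by auto
    then show "?q dvd p" by (simp add: r_def mod_eq_0_iff_dvd)
  qed
qed

lemma rotation_angles_eq: "rotation_angles T = {\<theta>. 0 < \<theta> \<and> \<theta> < pi \<and> cis \<theta> \<in> cspec T}"
  unfolding rotation_angles_def cspec_def using quadratic_dvd_iff by blast

lemma inj_on_cis: "inj_on cis {0<..<pi}"
  by (rule inj_onI) (auto simp: complex_eq_iff intro: cos_inj_pi)

lemma finite_rotation_angles: "finite (rotation_angles T)"
  and card_cis_rotation_angles: "card (cis ` rotation_angles T) = card (rotation_angles T)"
proof -
  have inj: "inj_on cis (rotation_angles T)"
    by (rule inj_on_subset[OF inj_on_cis]) (auto simp: rotation_angles_eq)
  have "cis ` rotation_angles T \<subseteq> cspec T" by (auto simp: rotation_angles_eq)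
  then show "finite (rotation_angles T)"
    using inj finite_cspec finite_subset inj_on_finite by metis
  show "card (cis ` rotation_angles T) = card (rotation_angles T)" by (rule card_image[OF inj])
qed

definition unit_spec :: "real^'n^'n \<Rightarrow> complex set" where
  "unit_spec T = cis ` rotation_angles T \<union> cnj ` cis ` rotation_angles T"

text \<open>The set consists of conjugate pairs on the unit circle off the real axis, and in the
  product of the negatives each pair contributes \<open>z * cnj z = 1\<close>. This product is used
  when an eigenvalue is found from the determinant.\<close>

lemma unit_spec_facts:
  "unit_spec T \<subseteq> cspec T" "finite (unit_spec T)" "card (unit_spec T) = 2 * card (rotation_angles T)"
  "unit_spec T \<inter> \<real> = {}" "(\<Prod>z\<in>unit_spec T. - z) = 1"
proof -
  let ?A = "cis ` rotation_angles T"
  show "unit_spec T \<subseteq> cspec T" by (auto simp: unit_spec_def rotation_angles_eq cnj_cspec)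
  show "finite (unit_spec T)" by (simp add: unit_spec_def finite_rotation_angles)
  have im: "Im z > 0" if "z \<in> ?A" for z using that by (auto simp: rotation_angles_eq intro: sin_gt_zero)
  have im': "Im z < 0" if "z \<in> cnj ` ?A" for z
  proof -
    from that obtain w where "w \<in> ?A" "z = cnj w" by blast
    then show ?thesis using im[of w] by simp
  qed
  have disj: "?A \<inter> cnj ` ?A = {}" using im im' by fastforce
  have cc: "card (cnj ` ?A) = card ?A" by (intro card_image inj_onI) simp
  show "card (unit_spec T) = 2 * card (rotation_angles T)"
    unfolding unit_spec_def
    by (subst card_Un_disjoint) (use finite_rotation_angles disj cc in \<open>auto simp: card_cis_rotation_angles\<close>)
  show "unit_spec T \<inter> \<real> = {}"
    using im im' by (force simp: unit_spec_def complex_is_Real_iff)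
  have "(\<Prod>z\<in>unit_spec T. - z) = (\<Prod>z\<in>?A. - z) * (\<Prod>z\<in>cnj ` ?A. - z)"
    unfolding unit_spec_def by (rule prod.union_disjoint) (use finite_rotation_angles disj in auto)
  also have "(\<Prod>z\<in>cnj ` ?A. - z) = (\<Prod>z\<in>?A. - cnj z)"
    by (subst prod.reindex) (auto intro: inj_onI)
  also have "(\<Prod>z\<in>?A. - z) * (\<Prod>z\<in>?A. - cnj z) = (\<Prod>z\<in>?A. z * cnj z)"
    by (simp add: prod.distrib[symmetric])
  also have "\<dots> = 1" by (intro prod.neutral) (auto simp: complex_norm_square[symmetric])
  finally show "(\<Prod>z\<in>unit_spec T. - z) = 1" .
qed

section \<open>Multiplicities of the factors of the characteristic polynomial\<close>

lemma minus_one_mult_pos: "minus_one_mult T \<noteq> 0 \<longleftrightarrow> - 1 \<in> cspec T"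
  using of_real_cspec_iff_poly[of "- 1" T] charpoly_nonzero[of T]
  by (simp add: minus_one_mult_def order_root)

text \<open>If \<open>d\<close> occurs twice, dropping one copy keeps all roots but lowers the
  degree by \<open>degree d\<close>.\<close>

lemma regular_square_dvd:
  assumes T: "regular (T :: real^'n^'n)" and d: "d * d dvd charpoly T"
  shows "degree d = 0"
proof -
  obtain q where q: "charpoly T = d * d * q" using d by (rule dvdE)
  have nz: "d \<noteq> 0" "q \<noteq> 0" using q charpoly_nonzero[of T] by auto
  let ?c = "map_poly complex_of_real"
  have nzc: "?c (d * q) \<noteq> 0" using nz by (simp add: map_poly_eq_0_iff)
  have "cspec T \<subseteq> {z. poly (?c (d * q)) z = 0}"
    by (auto simp: cspec_def q map_poly_of_real_mult)
  then have "card (cspec T) \<le> card {z. poly (?c (d * q)) z = 0}"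
    using poly_roots_finite[OF nzc] card_mono by blast
  also have "\<dots> \<le> degree (?c (d * q))" by (rule card_poly_roots_bound[OF nzc])
  also have "\<dots> = degree d + degree q" using nz by (simp add: degree_map_poly degree_mult_eq)
  finally have "CARD('n) \<le> degree d + degree q" using T by (simp add: regular_def)
  moreover have "CARD('n) = degree d + degree d + degree q"
    using charpoly_monic(1)[of T] nz q by (simp add: degree_mult_eq)
  ultimately show ?thesis by simp
qed

lemma regular_minus_one_mult: "regular T \<Longrightarrow> minus_one_mult T \<le> 1"
proof (rule ccontr)
  assume T: "regular T" and "\<not> minus_one_mult T \<le> 1"
  then have "2 \<le> order (- 1) (charpoly T)" by (simp add: minus_one_mult_def)
  then have "[:- (- 1), 1:] ^ 2 dvd charpoly T" using order_divides by blast
  then have "[:1, 1:] * [:1, 1:] dvd charpoly T" by (simp add: power2_eq_square)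
  from regular_square_dvd[OF T this] show False by simp
qed

lemma regular_angle_mult: "regular T \<Longrightarrow> \<theta> \<in> rotation_angles T \<Longrightarrow> angle_mult T \<theta> = 1"
  unfolding angle_mult_def
proof (rule multiplicity_eqI)
  let ?q = "[:1, - 2 * cos \<theta>, 1:]"
  assume T: "regular T" and "\<theta> \<in> rotation_angles T"
  then show "?q ^ 1 dvd charpoly T" by (simp add: rotation_angles_def)
  show "\<not> ?q ^ Suc 1 dvd charpoly T"
  proof
    assume "?q ^ Suc 1 dvd charpoly T"
    then have "?q * ?q dvd charpoly T" by (simp only: power_Suc power_0 One_nat_def mult_1_right)
    from regular_square_dvd[OF T this] show False by simp
  qed
qed

lemma regular_distinct_rotation_angles:
  assumes "regular T"
  shows "distinct_rotation_angles T" "rotation_number T = card (rotation_angles T)"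
proof -
  have "(\<Sum>\<theta>\<in>rotation_angles T. angle_mult T \<theta>) = card (rotation_angles T)"
    using regular_angle_mult[OF assms] by simp
  then show "rotation_number T = card (rotation_angles T)"
    using regular_minus_one_mult[OF assms] by (simp add: rotation_number_def)
  then show "distinct_rotation_angles T"
    using regular_angle_mult[OF assms] by (simp add: distinct_rotation_angles_def)
qed

text \<open>Simple angles make the sum in the rotation number equal to the number of angles, so the
  term \<open>minus_one_mult T div 2\<close> must vanish.\<close>

lemma distinct_rotation_angles_D:
  assumes "distinct_rotation_angles T"
  shows "rotation_number T = card (rotation_angles T)" "minus_one_mult T \<le> 1"
proof -
  show r: "rotation_number T = card (rotation_angles T)"
    using assms by (simp add: distinct_rotation_angles_def)
  have "(\<Sum>\<theta>\<in>rotation_angles T. angle_mult T \<theta>) = card (rotation_angles T)"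
    using assms by (simp add: distinct_rotation_angles_def)
  then have "minus_one_mult T div 2 = 0" using r by (simp add: rotation_number_def)
  then show "minus_one_mult T \<le> 1" by simp
qed

lemma prod_linear_dvd:
  fixes q :: "complex poly"
  assumes "finite L" "L \<subseteq> {z. poly q z = 0}"
  shows "(\<Prod>z\<in>L. [:- z, 1:]) dvd q"
  using assms
proof (induction L rule: finite_induct)
  case (insert z L)
  then have "(\<Prod>z\<in>L. [:- z, 1:]) dvd q" by simp
  then obtain r where r: "q = (\<Prod>z\<in>L. [:- z, 1:]) * r" by (rule dvdE)
  have "poly (\<Prod>z\<in>L. [:- z, 1:]) z \<noteq> 0" using insert(1,2) by (auto simp: poly_prod)
  then have "poly r z = 0" using insert.prems r by auto
  then have "[:- z, 1:] dvd r" by (simp only: poly_eq_0_iff_dvd)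
  then obtain s where s: "r = [:- z, 1:] * s" by (rule dvdE)
  have "q = (\<Prod>z\<in>insert z L. [:- z, 1:]) * s"
    unfolding r s prod.insert[OF insert(1,2)] by (simp only: mult_ac)
  then show ?case by (rule dvdI)
qed simp

text \<open>The one eigenvalue missing from \<open>L\<close> is determined by the determinant.\<close>

lemma one_root_missing:
  fixes T :: "real^'n^'n"
  assumes L: "L \<subseteq> cspec T" "CARD('n) = Suc (card L)" and p: "(\<Prod>z\<in>L. - z) = 1"
    and d: "poly (charpoly T) 0 * poly (charpoly T) 0 = 1"
    and m: "minus_one_mult T \<le> 1" and one: "1 \<notin> L" and mone: "- 1 \<in> L \<or> minus_one_mult T = 0"
  shows "regular T"
proof (rule ccontr)
  assume nr: "\<not> regular T"
  let ?q = "map_poly complex_of_real (charpoly T)"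
  have finL: "finite L" using L(1) finite_cspec finite_subset by blast
  \<comment> \<open>Without regularity \<open>L\<close> already exhausts the roots, so the remaining
    linear factor repeats one of them.\<close>
  have Lc: "L = cspec T"
  proof (rule card_seteq[OF finite_cspec L(1)])
    show "card (cspec T) \<le> card L"
      using nr card_cspec[of T] L(2) by (simp add: regular_def)
  qed
  obtain s where s: "?q = (\<Prod>z\<in>L. [:- z, 1:]) * s"
    using prod_linear_dvd[OF finL, of ?q] L(1) by (auto simp: cspec_def elim: dvdE)
  have nz: "?q \<noteq> 0" using charpoly_nonzero[of T] by (simp add: map_poly_eq_0_iff)
  then have s0: "s \<noteq> 0" using s by auto
  have P: "degree (\<Prod>z\<in>L. [:- z, 1:]) = card L" "lead_coeff (\<Prod>z\<in>L. [:- z, 1:]) = 1"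
    by (simp add: degree_prod_eq_sum_degree) (simp only: lead_coeff_prod, simp)
  have "degree ?q = CARD('n)" "lead_coeff ?q = 1"
    using charpoly_monic[of T] by (simp_all add: degree_map_poly coeff_map_poly)
  moreover have "degree ?q = card L + degree s"
    unfolding s using s0 P finL by (subst degree_mult_eq) auto
  moreover have "lead_coeff ?q = lead_coeff s" unfolding s by (simp only: lead_coeff_mult P(2) mult_1)
  ultimately have ds: "degree s = 1" "lead_coeff s = 1" using L(2) by auto
  then obtain a b where ab: "s = [:a, b:]" using degree_le_1E[of s] by auto
  define c where "c = - a"
  have c: "s = [:- c, 1:]" using ab ds by (simp add: c_def split: if_splits)
  have "poly ?q 0 = (\<Prod>z\<in>L. - z) * (- c)" unfolding s c by (simp add: poly_prod)
  then have mc: "- c = of_real (poly (charpoly T) 0)"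
    using p poly_real_complex[of "charpoly T" 0] by simp
  have "c * c = (- c) * (- c)" by simp
  also have "\<dots> = of_real (poly (charpoly T) 0 * poly (charpoly T) 0)" by (simp only: mc of_real_mult)
  finally have "c * c = of_real (poly (charpoly T) 0 * poly (charpoly T) 0)" .
  then have "c * c = 1" using d by simp
  then have c1: "c = 1 \<or> c = - 1" by (metis square_eq_1_iff)
  have "poly ?q c = 0" unfolding s c by simp
  then have cL: "c \<in> L" using Lc by (simp add: cspec_def)
  then have cm: "c = - 1" using c1 one by blast
  then have "minus_one_mult T = 1"
    using m minus_one_mult_pos[of T] cL Lc by auto
  then have o: "order (- 1) (charpoly T) = 1" by (simp add: minus_one_mult_def)
  \<comment> \<open>Now -1 occurs both in the product over \<open>L\<close> and as the remaining
    factor, so the derivative vanishes there, which contradicts multiplicity 1.\<close>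
  define r where "r = (\<Prod>z\<in>L - {c}. [:- z, 1:])"
  have "(\<Prod>z\<in>L. [:- z, 1:]) = [:- c, 1:] * r" unfolding r_def by (rule prod.remove[OF finL cL])
  then have "?q = [:- c, 1:] * ([:- c, 1:] * r)" unfolding s c by (simp only: mult_ac)
  then have "poly (pderiv ?q) c = 0" by (simp only: pderiv_mult poly_add poly_mult) simp
  moreover have "pderiv ?q = map_poly of_real (pderiv (charpoly T))"
    by (simp add: poly_eq_iff coeff_pderiv coeff_map_poly)
  ultimately have "poly (map_poly of_real (pderiv (charpoly T))) (complex_of_real (- 1)) = 0"
    using cm by simp
  then have pd: "poly (pderiv (charpoly T)) (- 1) = 0" by (simp only: poly_real_complex of_real_eq_0_iff)
  have "poly (charpoly T) (- 1) = 0" using o by (simp add: order_root)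
  then have "order (- 1) (charpoly T) = Suc (order (- 1) (pderiv (charpoly T)))"
    by (rule order_pderiv[OF charpoly_nonzero])
  then have "order (- 1) (pderiv (charpoly T)) = 0" using o by simp
  then have "pderiv (charpoly T) = 0" using pd by (simp add: order_root)
  then show False using charpoly_monic(1)[of T] by (simp add: pderiv_eq_0_iff)
qed

section \<open>The spectrum of an isometry\<close>

context lorentz
begin

text \<open>The combination of \<open>x\<close> and \<open>y\<close> orthogonal to \<open>e0\<close>
  is isotropic, hence 0: there is no isotropic plane in signature (1, n).\<close>

lemma isotropic_dependent:
  assumes "B x x = 0" "B y y = 0" "B x y = 0" "x \<noteq> 0"
  obtains a where "y = a *\<^sub>R x"
proof -
  have x0: "B e0 x \<noteq> 0" using B_neg[of x] assms by force
  define w where "w = B e0 x *\<^sub>R y - B e0 y *\<^sub>R x"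
  have "B e0 w = 0" by (simp add: w_def)
  moreover have "B w w = 0" using assms by (simp add: w_def B_sym[of y x])
  ultimately have "w = 0" using B_nonneg_eq_0[of w] by simp
  then have "B e0 x *\<^sub>R y = B e0 y *\<^sub>R x" by (simp add: w_def)
  then have "(1 / B e0 x) *\<^sub>R (B e0 x *\<^sub>R y) = (1 / B e0 x) *\<^sub>R (B e0 y *\<^sub>R x)" by simp
  then have "y = (B e0 y / B e0 x) *\<^sub>R x" using x0 by simp
  then show thesis by (rule that)
qed

lemma eigen_isotropic:
  assumes "T \<in> OB" "T *v x = r *\<^sub>R x" "r \<noteq> 1" "r \<noteq> - 1"
  shows "B x x = 0"
proof -
  have "B (T *v x) (T *v x) = B x x" using assms(1) by simp
  then have "(r * r - 1) * B x x = 0" using assms(2) by (simp add: algebra_simps)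
  moreover have "r * r \<noteq> 1" using assms by (metis square_eq_1_iff)
  ultimately show ?thesis by simp
qed

text \<open>\<open>r - adj T\<close> is the adjoint of \<open>r - T\<close>, so \<open>r\<close> is
  also an eigenvalue of \<open>adj T = T^-1\<close>.\<close>

lemma eigenvalue_inverse:
  assumes T: "T \<in> OB" and r: "of_real r \<in> cspec T"
  shows "r \<noteq> 0" "of_real (1 / r) \<in> cspec T"
proof -
  obtain x where x: "x \<noteq> 0" "T *v x = r *\<^sub>R x" using r of_real_cspec_iff by blast
  show r0: "r \<noteq> 0"
  proof
    assume "r = 0"
    then have "adj T *v (T *v x) = 0" using x by simp
    then show False using x(1) OB_D[OF T] by (simp add: matrix_vector_mul_assoc)
  qed
  have "\<not> invertible (r *\<^sub>R mat 1 - T)"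
  proof -
    have "(r *\<^sub>R mat 1 - T) *v x = 0" using x by (simp add: mat_vec)
    then show ?thesis using x(1) unfolding invertible_iff_ker by blast
  qed
  then have "\<not> invertible (r *\<^sub>R mat 1 - adj T)"
    using invertible_adj[of "r *\<^sub>R mat 1 - adj T"] by auto
  then obtain y where y: "y \<noteq> 0" "adj T *v y = r *\<^sub>R y"
    unfolding invertible_iff_ker by (auto simp: mat_vec)
  have "T *v (adj T *v y) = y" using OB_D[OF T] by (simp add: matrix_vector_mul_assoc)
  then have "r *\<^sub>R (T *v y) = y" using y by (simp add: mat_vec)
  then have "(1 / r) *\<^sub>R (r *\<^sub>R (T *v y)) = (1 / r) *\<^sub>R y" by simp
  then have "T *v y = (1 / r) *\<^sub>R y" using r0 by simp
  then show "of_real (1 / r) \<in> cspec T" using y(1) of_real_cspec_iff by blast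
qed

text \<open>Eigenvectors for eigenvalues other than 1 and -1 are isotropic, and two of them are
  orthogonal unless the eigenvalues have product 1. But orthogonal isotropic vectors are
  proportional.\<close>

lemma real_eigenvalues:
  assumes T: "T \<in> OB" and r: "of_real r \<in> cspec T" "r \<noteq> 1" "r \<noteq> - 1"
    and s: "of_real s \<in> cspec T" "s \<noteq> 1" "s \<noteq> - 1"
  shows "s = r \<or> s = 1 / r"
proof (rule ccontr)
  assume neq: "\<not> ?thesis"
  obtain x where x: "x \<noteq> 0" "T *v x = r *\<^sub>R x" using r of_real_cspec_iff by blast
  obtain y where y: "y \<noteq> 0" "T *v y = s *\<^sub>R y" using s of_real_cspec_iff by blast
  have "B (T *v x) (T *v y) = B x y" using T by simp
  then have "(r * s - 1) * B x y = 0" using x y by (simp add: algebra_simps)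
  moreover have "r * s \<noteq> 1"
    using neq eigenvalue_inverse(1)[OF T r(1)] by (simp add: field_simps)
  ultimately have "B x y = 0" by simp
  then obtain a where a: "y = a *\<^sub>R x"
    using isotropic_dependent[of x y] eigen_isotropic[OF T x(2) r(2,3)] eigen_isotropic[OF T y(2) s(2,3)] x(1)
    by metis
  then have "T *v y = r *\<^sub>R y" using x(2) by (simp add: mat_vec)
  from this[symmetric] y(2) have "r *\<^sub>R y = s *\<^sub>R y" by (rule trans)
  then have "r = s" using y(1) by simp
  then show False using neq by simp
qed

text \<open>Off the unit circle, real and imaginary part of an eigenvector would be isotropic and
  orthogonal, hence dependent, which is impossible for a nonreal eigenvalue.\<close>

lemma nonreal_unimodular:
  assumes T: "T \<in> OB" and z: "z \<in> cspec T" "Im z \<noteq> 0"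
  shows "cmod z = 1"
proof (rule ccontr)
  assume ne: "cmod z \<noteq> 1"
  define a b where "a = Re z" and "b = Im z"
  obtain x y where xy: "x \<noteq> 0 \<or> y \<noteq> 0" "T *v x = a *\<^sub>R x - b *\<^sub>R y" "T *v y = b *\<^sub>R x + a *\<^sub>R y"
    using z(1) unfolding cspec_iff_real a_def b_def by blast
  have b0: "b \<noteq> 0" using z(2) by (simp add: b_def)
  have n: "a * a + b * b \<noteq> 1"
    using ne by (simp add: cmod_def a_def b_def power2_eq_square)
  have e1: "B (T *v x) (T *v x) = B x x" and e2: "B (T *v y) (T *v y) = B y y"
    and e3: "B (T *v x) (T *v y) = B x y" using T by simp_all
  define X Y Z where "X = B x x" and "Y = B y y" and "Z = B x y"
  have E1: "a * a * X - 2 * a * b * Z + b * b * Y = X"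
    using e1 unfolding xy(2) X_def Y_def Z_def by (simp add: B_sym[of y x] algebra_simps)
  have E2: "b * b * X + 2 * a * b * Z + a * a * Y = Y"
    using e2 unfolding xy(3) X_def Y_def Z_def by (simp add: B_sym[of y x] algebra_simps)
  have E3: "a * b * X + a * a * Z - b * b * Z - a * b * Y = Z"
    using e3 unfolding xy(2,3) X_def Y_def Z_def by (simp add: B_sym[of y x] algebra_simps)
  \<comment> \<open>For the eigenvector \<open>v = x + i y\<close>, the Hermitian value
    \<open>X + Y\<close> is multiplied by the square of the modulus of \<open>z\<close>, and the
    bilinear value, which is twice \<open>w\<close>, by the square of \<open>z\<close>. Neither
    factor is 1, so both values vanish.\<close>
  have "(a * a + b * b - 1) * (X + Y) = 0" using E1 E2 by (simp add: algebra_simps)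
  then have YX: "Y = - X" using n by simp
  define w where "w = Complex X Z"
  have "z * z * w = w"
    using E1 E3 unfolding YX w_def by (simp add: complex_eq_iff a_def b_def algebra_simps)
  then have "(z * z - 1) * w = 0" by (simp add: algebra_simps)
  moreover have "z * z \<noteq> 1" using z(2) by (metis square_eq_1_iff Im_complex_of_real of_real_1 of_real_minus)
  ultimately have "w = 0" by simp
  then have "X = 0" "Z = 0" by (simp_all add: w_def complex_eq_iff)
  then have iso: "B x x = 0" "B y y = 0" "B x y = 0" "B y x = 0"
    using YX by (simp_all add: X_def Y_def Z_def B_sym[of y x])
  show False
  proof (cases "x = 0")
    case True
    then show False using xy b0 by simp
  next
    case False
    then obtain k where k: "y = k *\<^sub>R x" using isotropic_dependent iso by blast
    have h: "T *v x = a *\<^sub>R x - b *\<^sub>R (k *\<^sub>R x)" "T *v (k *\<^sub>R x) = b *\<^sub>R x + a *\<^sub>R (k *\<^sub>R x)"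
      using xy(2,3) unfolding k by blast+
    have "k *\<^sub>R (a *\<^sub>R x - b *\<^sub>R (k *\<^sub>R x)) = b *\<^sub>R x + a *\<^sub>R (k *\<^sub>R x)"
      by (simp only: h(1)[symmetric] h(2)[symmetric] mv.scaleR_right)
    then have "(b * (1 + k * k)) *\<^sub>R x = 0" by (simp add: algebra_simps)
    then have "b * (1 + k * k) = 0" using False by simp
    moreover have "1 + k * k > 0" by (intro add_pos_nonneg) auto
    ultimately show False using b0 by simp
  qed
qed

lemma cspec_split:
  assumes "T \<in> OB"
  shows "cspec T = (cspec T \<inter> \<real>) \<union> unit_spec T"
    and "card (cspec T) = card (cspec T \<inter> \<real>) + 2 * card (rotation_angles T)"
proof -
  have "z \<in> unit_spec T" if z: "z \<in> cspec T" "z \<notin> \<real>" for z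
  proof -
    have im: "Im z \<noteq> 0" using z(2) by (simp add: complex_is_Real_iff)
    have cm: "cmod z = 1" using nonreal_unimodular[OF assms z(1) im] .
    show ?thesis
    proof (cases "Im z > 0")
      case True
      then show ?thesis using cspec_cis[OF z(1) cm] z(1)
        by (auto simp: unit_spec_def rotation_angles_eq)
    next
      case False
      then have "Im (cnj z) > 0" "cmod (cnj z) = 1" using im cm by auto
      then obtain \<theta> where "0 < \<theta>" "\<theta> < pi" "cnj z = cis \<theta>"
        using cspec_cis[OF cnj_cspec[OF z(1)]] by blast
      then have "cnj z \<in> cis ` rotation_angles T"
        using cnj_cspec[OF z(1)] by (auto simp: rotation_angles_eq)
      then have "cnj (cnj z) \<in> cnj ` cis ` rotation_angles T" by blast
      then show ?thesis by (simp add: unit_spec_def)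
    qed
  qed
  then show eq: "cspec T = (cspec T \<inter> \<real>) \<union> unit_spec T" using unit_spec_facts(1)[of T] by blast
  have "card ((cspec T \<inter> \<real>) \<union> unit_spec T) = card (cspec T \<inter> \<real>) + card (unit_spec T)"
    by (rule card_Un_disjoint) (use finite_cspec unit_spec_facts[of T] in auto)
  then show "card (cspec T) = card (cspec T \<inter> \<real>) + 2 * card (rotation_angles T)"
    using eq unit_spec_facts(3)[of T] by simp
qed

lemma OB_charpoly_0:
  assumes "T \<in> OB"
  shows "poly (charpoly T) 0 * poly (charpoly T) 0 = 1"
proof -
  have O: "- T \<in> OB" using assms by (simp add: OB_def mm.minus_left mm.minus_right)
  have "det (adj (- T)) = det (- T)"
  proof -
    have "det (matrix_inv J) * det J = 1"
      using invertible_J by (simp only: det_mul[symmetric] mat_inv det_I)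
    then show ?thesis by (simp add: adj_def det_mul det_transpose)
  qed
  moreover have "det (adj (- T)) * det (- T) = 1"
    using OB_D(1)[OF O] by (simp only: det_mul[symmetric] det_I)
  ultimately show ?thesis by (simp add: poly_charpoly)
qed

text \<open>A multiple of \<open>v\<close> lies in \<open>H\<close> and must stay there, so
  \<open>c\<close> is positive. An eigenvector for another real eigenvalue would be isotropic and
  orthogonal to \<open>v\<close>, but the form is definite on the complement of
  \<open>v\<close>.\<close>

lemma elliptic_eigenvector:
  assumes T: "T \<in> G" and v: "B v v > 0" "T *v v = c *\<^sub>R v"
  shows "c = 1" "\<And>r. of_real r \<in> cspec T \<Longrightarrow> r = 1 \<or> r = - 1"
proof -
  have TO: "T \<in> OB" using T by (rule G_OB)
  define s where "s = (if B e0 v > 0 then 1 else -1) / sqrt (B v v)"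
  have s: "s * s * B v v = 1" "s * B e0 v > 0"
    using v(1) timelike_B_ne_0[OF v(1)] by (auto simp: s_def divide_neg_pos)
  have "s *\<^sub>R v \<in> H" using s by (simp add: H_def mult.assoc)
  then have "T *v (s *\<^sub>R v) \<in> H" using T G_H by blast
  then have "s *\<^sub>R (c *\<^sub>R v) \<in> H" using v(2) by (simp add: mat_vec)
  then have "c * (s * B e0 v) > 0" by (simp add: H_def mult_ac)
  then have c0: "c > 0" using s(2) by (simp add: zero_less_mult_iff)
  have "B (T *v v) (T *v v) = B v v" using TO by simp
  then have "c * c = 1" using v by simp
  then show c1: "c = 1" using c0 by (metis less_minus_one_simps(1) less_asym square_eq_1_iff zero_less_one neg_0_less_iff_less)
  fix r assume "complex_of_real r \<in> cspec T"
  then obtain w where w: "w \<noteq> 0" "T *v w = r *\<^sub>R w" using of_real_cspec_iff by blast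
  show "r = 1 \<or> r = - 1"
  proof (rule ccontr)
    assume r: "\<not> ?thesis"
    have ww: "B w w = 0" using eigen_isotropic[OF TO w(2)] r by simp
    have "B (T *v v) (T *v w) = B v w" using TO by simp
    then have vw: "B v w = 0" using v w c1 r by simp
    define u where "u = B e0 v *\<^sub>R w - B e0 w *\<^sub>R v"
    have "B e0 u = 0" by (simp add: u_def)
    moreover have "B u u = B e0 w * B e0 w * B v v" using ww vw by (simp add: u_def B_sym[of w v])
    ultimately have u: "u = 0" using B_nonneg_eq_0[of u] v(1) by simp
    then have "B e0 w * B e0 w * B v v = 0" using \<open>B u u = B e0 w * B e0 w * B v v\<close> by simp
    then have "B e0 w = 0" using v(1) by simp
    then show False using B_neg[of w] w(1) ww by simp
  qed
qed

section \<open>A fixed point in the projectivized closed cone\<close>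

lemma cone_nonneg:
  assumes "B e0 x = 1" "B e0 y = 1" "B x x \<ge> 0" "B y y \<ge> 0"
  shows "B x y \<ge> 0"
proof -
  have "B (x - y) (x - y) \<le> 0" using assms by (intro B_nonpos) simp
  then show ?thesis using assms by (simp add: B_sym[of y x])
qed

text \<open>On the complement of \<open>e0\<close> the form \<open>- B\<close> is positive definite;
  its minimum \<open>m\<close> on the unit sphere there bounds the distance of a point of the
  section from \<open>e0\<close>.\<close>

lemma compact_cone_section: "compact {x. B e0 x = 1 \<and> B x x \<ge> 0}" (is "compact ?K")
proof -
  have "closed ({x. B e0 x = 1} \<inter> {x. 0 \<le> B x x})"
    by (intro closed_Int closed_Collect_eq closed_Collect_le continuous_intros)
  then have closed: "closed ?K" by (simp add: Collect_conj_eq)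
  let ?S = "sphere 0 1 \<inter> {y. B e0 y = 0}"
  have cS: "compact ?S" by (intro compact_Int_closed compact_sphere closed_Collect_eq continuous_intros)
  have "\<exists>m>0. \<forall>y. B e0 y = 0 \<longrightarrow> m * (norm y)\<^sup>2 \<le> - B y y"
  \<comment> \<open>In dimension 1 the sphere is empty and there is no minimum to take.\<close>
  proof (cases "?S = {}")
    case True
    have y0: "y = 0" if "B e0 y = 0" for y
    proof (rule ccontr)
      assume "y \<noteq> 0"
      then have "(1 / norm y) *\<^sub>R y \<in> ?S" using that by simp
      then show False using True by blast
    qed
    show ?thesis
    proof (intro exI[of _ 1] conjI allI impI)
      show "1 * (norm y)\<^sup>2 \<le> - B y y" if "B e0 y = 0" for y using y0[OF that] by simp
    qed simp
  next
    case False
    have cont: "continuous_on ?S (\<lambda>y. - B y y)" by (intro continuous_intros)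
    obtain y0 where y0: "y0 \<in> ?S" "\<And>y. y \<in> ?S \<Longrightarrow> - B y0 y0 \<le> - B y y"
      using continuous_attains_inf[OF cS False cont] by blast
    have "y0 \<noteq> 0" using y0(1) by auto
    then have m: "- B y0 y0 > 0" using B_neg[of y0] y0(1) by simp
    have "- B y0 y0 * (norm y)\<^sup>2 \<le> - B y y" if "B e0 y = 0" for y
    proof (cases "y = 0")
      case False
      then have "(1 / norm y) *\<^sub>R y \<in> ?S" using that by simp
      from y0(2)[OF this] have "- B y0 y0 \<le> - B y y / (norm y)\<^sup>2" by (simp add: power2_eq_square)
      moreover have "(norm y)\<^sup>2 > 0" using False by simp
      ultimately show ?thesis by (simp only: pos_le_divide_eq)
    qed simp
    then show ?thesis using m by blast
  qed
  then obtain m where m: "m > 0" "\<And>y. B e0 y = 0 \<Longrightarrow> m * (norm y)\<^sup>2 \<le> - B y y" by blast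
  have "norm x \<le> norm e0 + (1 + 1 / m)" if x: "x \<in> ?K" for x
  proof -
    have "B e0 (x - e0) = 0" using x by simp
    then have "m * (norm (x - e0))\<^sup>2 \<le> - B (x - e0) (x - e0)" by (rule m)
    also have "\<dots> \<le> 1" using x by (simp add: B_sym[of x e0])
    finally have *: "(norm (x - e0))\<^sup>2 \<le> 1 / m" using m(1) by (simp add: pos_le_divide_eq mult.commute)
    have "0 \<le> (norm (x - e0) - 1)\<^sup>2" by simp
    then have "2 * norm (x - e0) \<le> 1 + (norm (x - e0))\<^sup>2" by (simp add: power2_diff)
    then have "norm (x - e0) \<le> 1 + (norm (x - e0))\<^sup>2" using norm_ge_zero[of "x - e0"] by linarith
    then have "norm (x - e0) \<le> 1 + 1 / m" using * by linarith
    then show ?thesis using norm_triangle_sub[of x e0] by linarith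
  qed
  then have "bounded ?K" unfolding bounded_iff by blast
  then show ?thesis using closed by (simp add: compact_eq_bounded_closed)
qed

text \<open>An isometry acts on the projectivized closed cone, which is a ball, so by Brouwer's theorem
  it has an eigenvector there.\<close>

lemma cone_eigenvector:
  assumes T: "T \<in> G"
  obtains x c where "B e0 x = 1" "B x x \<ge> 0" "T *v x = c *\<^sub>R x" "c > 0"
proof -
  let ?K = "{x. B e0 x = 1 \<and> B x x \<ge> 0}"
  have TO: "T \<in> OB" using T by (rule G_OB)
  have pos: "B e0 (T *v x) > 0" if "x \<in> ?K" for x
  proof -
    have "adj T *v e0 \<in> H" using G_H[OF G_adj[OF T] e0_in_H] .
    then have "B (adj T *v e0) x > 0" using that cone_pos[of "adj T *v e0" x] by (simp add: H_def)
    then show ?thesis by (simp add: B_adj2)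
  qed
  have cvx: "convex ?K"
  proof (rule convexI)
    fix x y u v assume xy: "x \<in> ?K" "y \<in> ?K" and uv: "0 \<le> u" "0 \<le> v" "u + v = (1 :: real)"
    have "B x y \<ge> 0" using xy by (simp add: cone_nonneg)
    then have "B (u *\<^sub>R x + v *\<^sub>R y) (u *\<^sub>R x + v *\<^sub>R y) \<ge> 0"
      using xy uv by (auto simp: B_sym[of y x] intro!: add_nonneg_nonneg mult_nonneg_nonneg)
    then show "u *\<^sub>R x + v *\<^sub>R y \<in> ?K" using xy uv by simp
  qed
  define f where "f x = (1 / B e0 (T *v x)) *\<^sub>R (T *v x)" for x
  have "e0 \<in> ?K" by simp
  then have ne: "?K \<noteq> {}" by blast
  have cont: "continuous_on ?K f"
    unfolding f_def by (intro continuous_intros mv.continuous_on) (use pos in force)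
  have im: "f \<in> ?K \<rightarrow> ?K"
  proof
    fix x assume x: "x \<in> ?K"
    then show "f x \<in> ?K" using pos[OF x] TO by (simp add: f_def)
  qed
  obtain x where x: "x \<in> ?K" "f x = x"
    by (rule brouwer[OF compact_cone_section cvx ne cont im])
  have "T *v x = B e0 (T *v x) *\<^sub>R f x" using pos[OF x(1)] by (simp add: f_def)
  then have "T *v x = B e0 (T *v x) *\<^sub>R x" using x(2) by simp
  then show thesis using that x(1) pos[OF x(1)] by blast
qed

text \<open>The eigenvector in the cone decides, unless it is isotropic with eigenvalue 1. In that
  case regularity splits the space into the line of \<open>x\<close> and the range of
  \<open>T - mat 1\<close>, both orthogonal to \<open>x\<close>, which contradicts
  \<open>B e0 x = 1\<close>.\<close>

lemma regular_elliptic_or_hyperbolic: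
  assumes T: "T \<in> G" "regular T"
  shows "(\<exists>v c. B v v > 0 \<and> T *v v = c *\<^sub>R v) \<or>
    (\<exists>v r. v \<noteq> 0 \<and> r \<noteq> 1 \<and> r \<noteq> - 1 \<and> T *v v = r *\<^sub>R v)"
proof -
  have TO: "T \<in> OB" using T(1) by (rule G_OB)
  obtain x c where x: "B e0 x = 1" "B x x \<ge> 0" "T *v x = c *\<^sub>R x" "c > 0"
    by (rule cone_eigenvector[OF T(1)])
  have x0: "x \<noteq> 0" using x(1) by auto
  show ?thesis
  proof (cases "c = 1 \<and> B x x = 0")
    case False
    show ?thesis
    proof (cases "B x x = 0")
      case True
      then have "c \<noteq> 1" "c \<noteq> - 1" using False x(4) by auto
      then show ?thesis using x(3) x0 by blast
    next
      case False
      then have "B x x > 0" using x(2) by simp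
      then show ?thesis using x(3) by blast
    qed
  next
    case True
    define Z where "Z = T - mat 1"
    have ZT: "Z ** T = T ** Z" by (simp add: Z_def mm.diff_left mm.diff_right)
    obtain k y where ky: "Z *v k = 0" "e0 = k + Z *v y"
      using linear_ker_im_decomposition[of "(*v) Z" e0] regular_commutant_semisimple[OF T(2) ZT]
      by (metis matrix_vector_mul_linear)
    have Tk: "T *v k = 1 *\<^sub>R k" using ky(1) by (simp add: Z_def mat_vec)
    have Tx: "T *v x = 1 *\<^sub>R x" using x(3) True by simp
    obtain a where "k = a *\<^sub>R x" using regular_eigenspace[OF T(2) Tx Tk x0] by blast
    then have "B x k = 0" using True by simp
    moreover have "B x (Z *v y) = 0"
    proof -
      have "B x (T *v y) = B (T *v x) (T *v y)" using Tx by simp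
      then show ?thesis using TO by (simp add: Z_def mat_vec)
    qed
    ultimately have "B x e0 = 0" by (subst ky(2)) simp
    then show ?thesis using x(1) by (simp add: B_sym)
  qed
qed

end

section \<open>Rotatory isometries\<close>

context lorentz
begin

lemma real_cspec_elliptic:
  assumes T: "T \<in> G" and v: "B v v > 0" "T *v v = c *\<^sub>R v"
  shows "cspec T \<inter> \<real> = insert 1 (cspec T \<inter> {- 1})"
proof -
  have "of_real 1 \<in> cspec T"
    using elliptic_eigenvector(1)[OF T v] v of_real_cspec_iff[of 1 T] by (auto intro!: exI[of _ v])
  moreover have "z = 1 \<or> z = - 1" if z: "z \<in> cspec T" "z \<in> \<real>" for z
  proof -
    obtain r where r: "z = of_real r" using z(2) by (rule Reals_cases)
    then have "r = 1 \<or> r = - 1" using elliptic_eigenvector(2)[OF T v, of r] z(1) by simp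
    then show ?thesis using r by auto
  qed
  ultimately show ?thesis by auto
qed

lemma real_cspec_hyperbolic:
  assumes T: "T \<in> G" and v: "v \<noteq> 0" "r \<noteq> 1" "r \<noteq> - 1" "T *v v = r *\<^sub>R v"
  shows "cspec T \<inter> \<real> = {of_real r, of_real (1 / r)} \<union> (cspec T \<inter> {1, - 1})"
    and "card ({of_real r, of_real (1 / r)} :: complex set) = 2"
    and "{of_real r, of_real (1 / r)} \<inter> {1, - 1 :: complex} = {}"
    and "r \<noteq> 0"
proof -
  have TO: "T \<in> OB" using T by (rule G_OB)
  have r: "of_real r \<in> cspec T" using v of_real_cspec_iff by blast
  note ri = eigenvalue_inverse[OF TO r]
  have "z \<in> {of_real r, of_real (1 / r), 1, - 1}" if z: "z \<in> cspec T" "z \<in> \<real>" for z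
  proof -
    obtain s where s: "z = of_real s" using z(2) by (rule Reals_cases)
    have "s = r \<or> s = 1 / r \<or> s = 1 \<or> s = - 1"
      using real_eigenvalues[OF TO r v(2,3), of s] z(1) s by blast
    then show ?thesis unfolding s by auto
  qed
  then show "cspec T \<inter> \<real> = {of_real r, of_real (1 / r)} \<union> (cspec T \<inter> {1, - 1})"
    using r ri(2) by auto
  have "r * r \<noteq> 1" using v(2,3) by (metis square_eq_1_iff)
  then have "of_real r \<noteq> (of_real (1 / r) :: complex)"
    unfolding of_real_eq_iff using ri(1) by (simp add: field_simps)
  then show "card ({of_real r, of_real (1 / r)} :: complex set) = 2" by simp
  have "1 / r \<noteq> 1" "1 / r \<noteq> - 1" using v(2,3) ri(1) by (auto simp: field_simps)
  then have "of_real (1 / r) \<noteq> (1 :: complex)" "of_real (1 / r) \<noteq> (- 1 :: complex)"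
    by (metis of_real_1 of_real_eq_iff of_real_minus)+
  moreover have "of_real r \<noteq> (1 :: complex)" "of_real r \<noteq> (- 1 :: complex)"
    using v(2,3) by (metis of_real_1 of_real_eq_iff of_real_minus)+
  ultimately show "{of_real r, of_real (1 / r)} \<inter> {1, - 1 :: complex} = {}" by auto
  show "r \<noteq> 0" by (rule ri(1))
qed

lemma regularI_real:
  fixes R :: "complex set"
  assumes T: "T \<in> OB" and R: "R \<subseteq> cspec T \<inter> \<real>" "CARD('n) \<le> card R + 2 * card (rotation_angles T)"
  shows "regular T"
proof -
  have "card R \<le> card (cspec T \<inter> \<real>)" using R(1) finite_cspec by (intro card_mono) auto
  then have "CARD('n) \<le> card (cspec T)" using R(2) cspec_split(2)[OF T] by simp
  then show ?thesis by (intro regularI(1)[OF order_refl])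
qed

text \<open>The known eigenvalues, those in \<open>R\<close> and on the unit circle, are one too
  few; \<open>one_root_missing\<close> supplies the last one.\<close>

lemma regularI_hyperbolic:
  assumes T: "T \<in> OB" and R: "R \<subseteq> cspec T \<inter> \<real>" "(\<Prod>z\<in>R. - z) = 1"
    "CARD('n) = Suc (card R + 2 * card (rotation_angles T))"
    and m: "minus_one_mult T \<le> 1" "1 \<notin> R" "- 1 \<in> R \<or> minus_one_mult T = 0"
  shows "regular T"
proof (rule one_root_missing)
  note u = unit_spec_facts[of T]
  have fR: "finite R" using R(1) finite_cspec finite_subset by blast
  have disj: "R \<inter> unit_spec T = {}" using R(1) u(4) by blast
  show "R \<union> unit_spec T \<subseteq> cspec T" using R(1) u(1) by blast
  show "CARD('n) = Suc (card (R \<union> unit_spec T))"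
    using card_Un_disjoint[OF fR u(2) disj] R(3) u(3) by simp
  show "(\<Prod>z\<in>R \<union> unit_spec T. - z) = 1"
    using prod.union_disjoint[OF fR u(2) disj, of uminus] R(2) u(5) by simp
  show "poly (charpoly T) 0 * poly (charpoly T) 0 = 1" by (rule OB_charpoly_0[OF T])
  show "minus_one_mult T \<le> 1" by (rule m)
  have "1 \<notin> unit_spec T" using u(4) by auto
  then show "1 \<notin> R \<union> unit_spec T" using m(2) by blast
  show "- 1 \<in> R \<union> unit_spec T \<or> minus_one_mult T = 0" using m(3) by auto
qed

lemma regular_data:
  assumes T: "T \<in> G" and reg: "regular T" and Q: "\<And>v. Q v = B v v" and iso: "isometries Q K = G"
  obtains "elliptic Q K T" "CARD('n) = 1 + minus_one_mult T + 2 * rotation_number T" "minus_one_mult T \<le> 1"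
  | l where "hyperbolic Q K T" "CARD('n) = 2 + l + minus_one_mult T + 2 * rotation_number T"
      "l \<le> 1" "minus_one_mult T \<le> 1"
proof -
  have TO: "T \<in> OB" using T by (rule G_OB)
  have s: "CARD('n) = card (cspec T \<inter> \<real>) + 2 * rotation_number T"
    using cspec_split(2)[OF TO] reg regular_distinct_rotation_angles(2)[OF reg] by (simp add: regular_def)
  have m: "minus_one_mult T \<le> 1" by (rule regular_minus_one_mult[OF reg])
  have cm: "card (cspec T \<inter> {- 1}) = minus_one_mult T"
    using m minus_one_mult_pos[of T] by (cases "- 1 \<in> cspec T") auto
  consider v c where "B v v > 0" "T *v v = c *\<^sub>R v"
    | v r where "v \<noteq> 0" "r \<noteq> 1" "r \<noteq> - 1" "T *v v = r *\<^sub>R v"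
    using regular_elliptic_or_hyperbolic[OF T reg] by blast
  then show thesis
  proof cases
    case 1
    have "card (cspec T \<inter> \<real>) = 1 + minus_one_mult T"
      unfolding real_cspec_elliptic[OF T 1] by (simp add: cm)
    moreover have "elliptic Q K T" using T 1 Q iso by (auto simp: elliptic_def)
    ultimately show thesis using that(1) s m by simp
  next
    case 2
    note h = real_cspec_hyperbolic[OF T 2]
    \<comment> \<open>Whether 1 is an eigenvalue. In the elliptic case this is no question, as the
      positive eigenvector belongs to 1.\<close>
    define l where "l = card (cspec T \<inter> {1})"
    have "cspec T \<inter> {1, - 1} = (cspec T \<inter> {1}) \<union> (cspec T \<inter> {- 1})" by blast
    moreover have "card ((cspec T \<inter> {1}) \<union> (cspec T \<inter> {- 1})) = l + minus_one_mult T"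
      unfolding l_def cm[symmetric] by (rule card_Un_disjoint) auto
    ultimately have c1: "card (cspec T \<inter> {1, - 1}) = l + minus_one_mult T" by simp
    have "card (cspec T \<inter> \<real>) = card ({of_real r, of_real (1 / r)} :: complex set) + card (cspec T \<inter> {1, - 1})"
      unfolding h(1) by (rule card_Un_disjoint) (use h(3) in auto)
    then have "card (cspec T \<inter> \<real>) = 2 + l + minus_one_mult T" using h(2) c1 by simp
    moreover have "l \<le> 1" using card_mono[of "{1 :: complex}" "cspec T \<inter> {1}"] by (simp add: l_def)
    moreover have "hyperbolic Q K T" using T 2 iso by (auto simp: hyperbolic_def)
    ultimately show thesis using that(2)[of l] s m by simp
  qed
qed

lemma elliptic_regular:
  assumes Q: "\<And>v. Q v = B v v" and iso: "isometries Q K = G" and e: "elliptic Q K T"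
    and d: "distinct_rotation_angles T"
    and n: "CARD('n) = 1 + minus_one_mult T + 2 * rotation_number T"
  shows "regular T"
proof -
  have T: "T \<in> G" using e iso by (simp add: elliptic_def)
  obtain v c where v: "B v v > 0" "T *v v = c *\<^sub>R v" using e Q by (auto simp: elliptic_def)
  note dd = distinct_rotation_angles_D[OF d]
  have "card (cspec T \<inter> {- 1}) = minus_one_mult T"
    using dd(2) minus_one_mult_pos[of T] by (cases "- 1 \<in> cspec T") auto
  then have "card (cspec T \<inter> \<real>) = 1 + minus_one_mult T"
    unfolding real_cspec_elliptic[OF T v] by simp
  then show ?thesis
    using regularI_real[OF G_OB[OF T], of "cspec T \<inter> \<real>"] n dd(1) by simp
qed

text \<open>Here \<open>l\<close> is only a gap in the dimension count. If \<open>l = 1\<close>, the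
  determinant has to show that a further distinct eigenvalue fills the gap.\<close>

lemma hyperbolic_regular:
  assumes iso: "isometries Q K = G" and h: "hyperbolic Q K T" and d: "distinct_rotation_angles T"
    and n: "CARD('n) = 2 + l + minus_one_mult T + 2 * rotation_number T" "l \<le> 1"
  shows "regular T"
proof -
  have T: "T \<in> G" using h iso by (simp add: hyperbolic_def)
  note TO = G_OB[OF T]
  obtain v r where v: "v \<noteq> 0" "r \<noteq> 1" "r \<noteq> - 1" "T *v v = r *\<^sub>R v" using h by (auto simp: hyperbolic_def)
  note dd = distinct_rotation_angles_D[OF d]
  note hh = real_cspec_hyperbolic[OF T v]
  define R where "R = {of_real r, of_real (1 / r)} \<union> (cspec T \<inter> {- 1 :: complex})"
  have R: "R \<subseteq> cspec T \<inter> \<real>" using hh(1) by (auto simp: R_def)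
  have cm: "card (cspec T \<inter> {- 1}) = minus_one_mult T"
    using dd(2) minus_one_mult_pos[of T] by (cases "- 1 \<in> cspec T") auto
  have disj: "{of_real r, of_real (1 / r)} \<inter> (cspec T \<inter> {- 1 :: complex}) = {}" using hh(3) by auto
  have cR: "card R = 2 + minus_one_mult T"
    unfolding R_def by (subst card_Un_disjoint) (use disj cm hh(2) in auto)
  show ?thesis
  proof (cases "l = 0")
    case True
    then show ?thesis using regularI_real[OF TO R] n cR dd(1) by simp
  next
    case False
    then have "l = 1" using n(2) by simp
    show ?thesis
    proof (rule regularI_hyperbolic[OF TO R])
      have "of_real r \<noteq> (of_real (1 / r) :: complex)" using hh(2) by auto
      then have "(\<Prod>z\<in>{of_real r, of_real (1 / r)}. - z) = (1 :: complex)"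
        using hh(4) by simp
      moreover have "(\<Prod>z\<in>cspec T \<inter> {- 1}. - z) = 1" by (rule prod.neutral) auto
      ultimately show "(\<Prod>z\<in>R. - z) = 1"
        unfolding R_def by (subst prod.union_disjoint) (use disj in auto)
      show "CARD('n) = Suc (card R + 2 * card (rotation_angles T))"
        using n(1) \<open>l = 1\<close> cR dd(1) by simp
      show "minus_one_mult T \<le> 1" by (rule dd)
      show "1 \<notin> R" using hh(3) by (auto simp: R_def)
      show "- 1 \<in> R \<or> minus_one_mult T = 0" using minus_one_mult_pos[of T] by (auto simp: R_def)
    qed
  qed
qed

text \<open>The dimension is odd. In the elliptic case this forces multiplicity 0 for -1; in the
  hyperbolic case exactly one of 1 and -1 is an eigenvalue, which separates the rotatory isometries
  from the inversions.\<close>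

lemma rotatory_even_iff:
  assumes Q: "\<And>v. Q v = B v v" and iso: "isometries Q K = G" and n: "CARD('n) = 2 * n' + 1"
  shows "(rotatory_elliptic Q K (int n') T \<or> rotatory_hyperbolic Q K (int n' - 1) T \<or>
      rotatory_hyperbolic_inversion Q K (int n' - 1) T) \<and> distinct_rotation_angles T
    \<longleftrightarrow> T \<in> G \<and> regular T" (is "?L \<longleftrightarrow> ?R")
proof
  assume L: ?L
  then have d: "distinct_rotation_angles T" by blast
  have m: "minus_one_mult T \<le> 1" by (rule distinct_rotation_angles_D[OF d])
  from L consider "rotatory_elliptic Q K (int n') T" | "rotatory_hyperbolic Q K (int n' - 1) T"
    | "rotatory_hyperbolic_inversion Q K (int n' - 1) T" by blast
  then have "elliptic Q K T \<and> CARD('n) = 1 + minus_one_mult T + 2 * rotation_number T \<or>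
    hyperbolic Q K T \<and> (\<exists>l\<le>1. CARD('n) = 2 + l + minus_one_mult T + 2 * rotation_number T)"
  proof cases
    case 1
    then have "minus_one_mult T = 0" using m by (auto simp: rotatory_elliptic_def le_Suc_eq)
    then show ?thesis using 1 n by (auto simp: rotatory_elliptic_def)
  next
    case 2
    then have "minus_one_mult T = 0" using m by (auto simp: rotatory_hyperbolic_def le_Suc_eq)
    then show ?thesis using 2 n by (auto simp: rotatory_hyperbolic_def intro!: exI[of _ 1])
  next
    case 3
    then have "minus_one_mult T = 1" using m by (auto simp: rotatory_hyperbolic_inversion_def le_Suc_eq)
    then show ?thesis using 3 n by (auto simp: rotatory_hyperbolic_inversion_def intro!: exI[of _ 0])
  qed
  then show ?R
    using elliptic_regular[OF Q iso _ d] hyperbolic_regular[OF iso _ d] iso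
    by (auto simp: elliptic_def hyperbolic_def)
next
  assume ?R
  then have T: "T \<in> G" "regular T" by auto
  note d = regular_distinct_rotation_angles(1)[OF T(2)]
  from T show ?L
  proof (rule regular_data[OF _ _ Q iso])
    assume h: "elliptic Q K T" "CARD('n) = 1 + minus_one_mult T + 2 * rotation_number T" "minus_one_mult T \<le> 1"
    then have "minus_one_mult T = 0 \<and> rotation_number T = n'" using n by presburger
    then show ?L using h d by (simp add: rotatory_elliptic_def)
  next
    fix l assume h: "hyperbolic Q K T" "CARD('n) = 2 + l + minus_one_mult T + 2 * rotation_number T"
      "l \<le> 1" "minus_one_mult T \<le> 1"
    then have "(minus_one_mult T = 0 \<or> minus_one_mult T = 1) \<and> Suc (rotation_number T) = n'" using n by presburger
    then show ?L using h d by (auto simp: rotatory_hyperbolic_def rotatory_hyperbolic_inversion_def)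
  qed
qed

text \<open>The dimension is even. In the elliptic case this forces the eigenvalue -1; in the
  hyperbolic case 1 and -1 are both absent or both present, and in the latter case there is one
  rotation angle less.\<close>

lemma rotatory_odd_iff:
  assumes Q: "\<And>v. Q v = B v v" and iso: "isometries Q K = G" and n: "CARD('n) = 2 * n' + 2"
  shows "(rotatory_hyperbolic Q K (int n') T \<or> rotatory_elliptic_inversion Q K (int n') T \<or>
      rotatory_hyperbolic_inversion Q K (int n' - 1) T) \<and> distinct_rotation_angles T
    \<longleftrightarrow> T \<in> G \<and> regular T" (is "?L \<longleftrightarrow> ?R")
proof
  assume L: ?L
  then have d: "distinct_rotation_angles T" by blast
  have m: "minus_one_mult T \<le> 1" by (rule distinct_rotation_angles_D[OF d])
  from L consider "rotatory_hyperbolic Q K (int n') T" | "rotatory_elliptic_inversion Q K (int n') T"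
    | "rotatory_hyperbolic_inversion Q K (int n' - 1) T" by blast
  then have "elliptic Q K T \<and> CARD('n) = 1 + minus_one_mult T + 2 * rotation_number T \<or>
    hyperbolic Q K T \<and> (\<exists>l\<le>1. CARD('n) = 2 + l + minus_one_mult T + 2 * rotation_number T)"
  proof cases
    case 1
    then have "minus_one_mult T = 0" using m by (auto simp: rotatory_hyperbolic_def le_Suc_eq)
    then show ?thesis using 1 n by (auto simp: rotatory_hyperbolic_def intro!: exI[of _ 0])
  next
    case 2
    then have "minus_one_mult T = 1" using m by (auto simp: rotatory_elliptic_inversion_def le_Suc_eq)
    then show ?thesis using 2 n by (auto simp: rotatory_elliptic_inversion_def)
  next
    case 3
    then have "minus_one_mult T = 1" using m by (auto simp: rotatory_hyperbolic_inversion_def le_Suc_eq)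
    then show ?thesis using 3 n by (auto simp: rotatory_hyperbolic_inversion_def intro!: exI[of _ 1])
  qed
  then show ?R
    using elliptic_regular[OF Q iso _ d] hyperbolic_regular[OF iso _ d] iso
    by (auto simp: elliptic_def hyperbolic_def)
next
  assume ?R
  then have T: "T \<in> G" "regular T" by auto
  note d = regular_distinct_rotation_angles(1)[OF T(2)]
  from T show ?L
  proof (rule regular_data[OF _ _ Q iso])
    assume h: "elliptic Q K T" "CARD('n) = 1 + minus_one_mult T + 2 * rotation_number T" "minus_one_mult T \<le> 1"
    then have "minus_one_mult T = 1 \<and> rotation_number T = n'" using n by presburger
    then show ?L using h d by (simp add: rotatory_elliptic_inversion_def)
  next
    fix l assume h: "hyperbolic Q K T" "CARD('n) = 2 + l + minus_one_mult T + 2 * rotation_number T"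
      "l \<le> 1" "minus_one_mult T \<le> 1"
    then have "minus_one_mult T = 0 \<and> rotation_number T = n' \<or> minus_one_mult T = 1 \<and> Suc (rotation_number T) = n'"
      using n by presburger
    then show ?L using h d by (auto simp: rotatory_hyperbolic_def rotatory_hyperbolic_inversion_def)
  qed
qed


section \<open>Generic z-classes\<close>

lemma centralizer_conj:
  assumes g: "g \<in> G"
  shows "centralizer G (g ** T ** matrix_inv g) = (\<lambda>X. g ** X ** matrix_inv g) ` centralizer G T"
proof -
  have i: "invertible g" using OB_D(3)[OF G_OB[OF g]] .
  have cc: "matrix_inv g ** (g ** X ** matrix_inv g) ** g = X" "g ** (matrix_inv g ** X ** g) ** matrix_inv g = X" for X
    using i by (simp_all add: matrix_mul_assoc[symmetric] mat_inv)
  have m: "g ** (X ** Y) ** matrix_inv g = (g ** X ** matrix_inv g) ** (g ** Y ** matrix_inv g)" for X Y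
    using i by (simp add: matrix_mul_assoc[symmetric] mat_inv)
  have 1: "g ** X ** matrix_inv g \<in> centralizer G (g ** T ** matrix_inv g)" if "X \<in> centralizer G T" for X
    using that g m[of X T] m[of T X] by (simp add: centralizer_def G_mult G_matrix_inv)
  have 2: "matrix_inv g ** X ** g \<in> centralizer G T" if X: "X \<in> centralizer G (g ** T ** matrix_inv g)" for X
  proof -
    let ?X = "matrix_inv g ** X ** g"
    have "g ** (?X ** T) ** matrix_inv g = g ** (T ** ?X) ** matrix_inv g"
      unfolding m[of ?X T] m[of T ?X] cc(2)[of X] using X by (simp add: centralizer_def)
    then have "matrix_inv g ** (g ** (?X ** T) ** matrix_inv g) ** g = matrix_inv g ** (g ** (T ** ?X) ** matrix_inv g) ** g"
      by simp
    then have "?X ** T = T ** ?X" unfolding cc .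
    then show ?thesis using X g by (simp add: centralizer_def G_mult G_matrix_inv)
  qed
  show ?thesis
  proof (intro equalityI subsetI)
    fix X assume "X \<in> centralizer G (g ** T ** matrix_inv g)"
    from 2[OF this] cc(2)[of X, symmetric] show "X \<in> (\<lambda>X. g ** X ** matrix_inv g) ` centralizer G T"
      by (rule rev_image_eqI)
  qed (use 1 in auto)
qed

lemma equiv_z: "equiv G (z_equivalence G)"
proof (rule equivI)
  show "z_equivalence G \<subseteq> G \<times> G" by (auto simp: z_equivalence_def)
  have "(S, S) \<in> z_equivalence G" if "S \<in> G" for S
  proof -
    have "matrix_inv (mat 1) = (mat 1 :: real^'n^'n)" by (rule matrix_inv_unique) simp
    then show ?thesis using that by (auto simp: z_equivalence_def intro!: bexI[of _ "mat 1"])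
  qed
  then show "refl_on G (z_equivalence G)" by (auto simp: refl_on_def)
  show "sym (z_equivalence G)"
  proof (rule symI)
    fix S T assume "(S, T) \<in> z_equivalence G"
    then obtain g where g: "S \<in> G" "T \<in> G" "g \<in> G"
      "centralizer G T = (\<lambda>X. g ** X ** matrix_inv g) ` centralizer G S"
      by (auto simp: z_equivalence_def)
    have i: "invertible g" using OB_D(3)[OF G_OB[OF g(3)]] .
    have "(\<lambda>X. matrix_inv g ** X ** matrix_inv (matrix_inv g)) ` centralizer G T = centralizer G S"
      unfolding g(4) image_image using i
      by (simp add: matrix_inv_matrix_inv matrix_mul_assoc[symmetric] mat_inv)
    then show "(T, S) \<in> z_equivalence G"
      using g G_matrix_inv[OF g(3)] by (auto simp: z_equivalence_def)
  qed
  show "trans (z_equivalence G)"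
  proof (rule transI)
    fix S T U assume "(S, T) \<in> z_equivalence G" "(T, U) \<in> z_equivalence G"
    then obtain g h where g: "S \<in> G" "T \<in> G" "U \<in> G" "g \<in> G" "h \<in> G"
      "centralizer G T = (\<lambda>X. g ** X ** matrix_inv g) ` centralizer G S"
      "centralizer G U = (\<lambda>X. h ** X ** matrix_inv h) ` centralizer G T"
      by (auto simp: z_equivalence_def)
    have i: "invertible g" "invertible h" using OB_D(3) G_OB g(4,5) by blast+
    have "centralizer G U = (\<lambda>X. (h ** g) ** X ** matrix_inv (h ** g)) ` centralizer G S"
      unfolding g(6,7) image_image by (simp add: matrix_inv_mult i matrix_mul_assoc)
    then show "(S, U) \<in> z_equivalence G"
      using g G_mult[OF g(5,4)] by (auto simp: z_equivalence_def)
  qed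
qed

lemma regular_conj:
  fixes g T :: "real^'n^'n"
  assumes g: "invertible g" and T: "regular T"
  shows "regular (g ** T ** matrix_inv g)"
proof (rule regularI(1))
  show "cspec T \<subseteq> cspec (g ** T ** matrix_inv g)"
  proof
    fix z assume "z \<in> cspec T"
    then obtain v where v: "v \<noteq> 0" "cmat T *v v = z *s v" by (auto simp: cspec_iff)
    have ii: "cmat (matrix_inv g) *v (cmat g *v v) = v"
      using g by (simp add: matrix_vector_mul_assoc cmat_simps(5)[symmetric] mat_inv cmat_simps(4))
    then have nz: "cmat g *v v \<noteq> 0" using v(1) by auto
    have "cmat (g ** T ** matrix_inv g) *v (cmat g *v v) = z *s (cmat g *v v)"
      by (simp add: cmat_simps matrix_vector_mul_assoc[symmetric] ii v(2) vector_scalar_commute)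
    then show "z \<in> cspec (g ** T ** matrix_inv g)" using nz cspec_iff by blast
  qed
  show "CARD('n) \<le> card (cspec T)" using T by (simp add: regular_def)
qed

text \<open>Each \<open>S\<close> in the class has the very centralizer of a suitable conjugate of
  \<open>T\<close>, which is regular again. So \<open>z_class_open_at\<close> applies to it.\<close>

lemma z_class_regular_open:
  assumes T: "T \<in> G" "regular T"
  shows "openin (top_of_set G) (z_class G T)"
proof -
  have cG: "z_class G T \<subseteq> G" by (auto simp: z_class_def z_equivalence_def)
  have "\<exists>U. open U \<and> S \<in> U \<and> U \<inter> G \<subseteq> z_class G T" if S: "S \<in> z_class G T" for S
  proof -
    have TS: "(T, S) \<in> z_equivalence G" using S by (simp add: z_class_def)
    then obtain g where g: "g \<in> G" "S \<in> G" "centralizer G S = (\<lambda>X. g ** X ** matrix_inv g) ` centralizer G T"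
      by (auto simp: z_equivalence_def)
    let ?T = "g ** T ** matrix_inv g"
    have "centralizer G S = centralizer G ?T" using g(3) centralizer_conj[OF g(1)] by simp
    moreover have "regular ?T" using regular_conj[OF OB_D(3)[OF G_OB[OF g(1)]] T(2)] .
    moreover have "?T \<in> G" using g(1) T(1) by (simp add: G_mult G_matrix_inv)
    ultimately obtain U where U: "open U" "S \<in> U" "\<And>S'. S' \<in> U \<Longrightarrow> S' \<in> G \<Longrightarrow>
       \<exists>u\<in>G. centralizer G S' = (\<lambda>X. u ** X ** matrix_inv u) ` centralizer G S"
      using z_class_open_at[of ?T S] g(2) by metis
    have "S' \<in> z_class G T" if S': "S' \<in> U" "S' \<in> G" for S'
    proof -
      have "(S, S') \<in> z_equivalence G" using U(3)[OF S'] S' g(2) by (auto simp: z_equivalence_def)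
      then have "(T, S') \<in> z_equivalence G" using TS equiv_z by (meson equivE transD)
      then show ?thesis by (simp add: z_class_def)
    qed
    then show ?thesis using U by blast
  qed
  note ex = this
  show ?thesis
  proof (subst openin_subopen, intro ballI)
    fix S assume S: "S \<in> z_class G T"
    then obtain U where "open U" "S \<in> U" "U \<inter> G \<subseteq> z_class G T" using ex by blast
    then show "\<exists>V. openin (top_of_set G) V \<and> S \<in> V \<and> V \<subseteq> z_class G T"
      using S cG by (intro exI[of _ "G \<inter> U"]) (auto simp: openin_open_Int)
  qed
qed

end

context lorentz_basis
begin

theorem generic_z_classes_eq:
  "generic_z_classes G = z_class G ` {T \<in> G. regular T}"
proof (intro equalityI subsetI)
  define N where "N = dim skew"
  have man: "manifold_of_dim N (top_of_set G)" unfolding N_def by (rule G_manifold)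
  have cls: "\<exists>T\<in>G. C = z_class G T" if "C \<in> z_classes G" for C
    using that by (auto simp: z_classes_def z_class_def quotient_def)
  have clsG: "C \<subseteq> G" "C \<noteq> {}" if "C \<in> z_classes G" for C
  proof -
    obtain T where T: "T \<in> G" "C = z_class G T" using cls \<open>C \<in> z_classes G\<close> by blast
    then show "C \<subseteq> G" by (auto simp: z_class_def z_equivalence_def)
    have "T \<in> C" using T equiv_class_self[OF equiv_z] by (simp add: z_class_def)
    then show "C \<noteq> {}" by blast
  qed
  have sub: "subtopology (top_of_set G) C = top_of_set C" if "C \<subseteq> G" for C
    using that by (simp add: subtopology_subtopology Int_absorb1)
  have le: "d \<le> N" if "C \<in> z_classes G" "manifold_of_dim d (top_of_set C)" for C d
    using submanifold_dim(1)[OF man, of C d] clsG[OF that(1)] sub that(2) by simp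
  have reg: "z_class G T \<in> z_classes G \<and> manifold_of_dim N (top_of_set (z_class G T))" if T: "T \<in> G" "regular T" for T
  proof -
    have 1: "z_class G T \<in> z_classes G" using T by (auto simp: z_classes_def z_class_def intro: quotientI)
    show ?thesis
      using manifold_of_dim_open_subset[OF man z_class_regular_open[OF T]] sub clsG(1)[OF 1] 1 by simp
  qed
  {
    fix C assume "C \<in> z_class G ` {T \<in> G. regular T}"
    then obtain T where T: "T \<in> G" "regular T" "C = z_class G T" by blast
    show "C \<in> generic_z_classes G"
      unfolding generic_z_classes_def using reg[OF T(1,2)] le T(3) by blast
  next
    fix C assume "C \<in> generic_z_classes G"
    then obtain d where C: "C \<in> z_classes G" "manifold_of_dim d (top_of_set C)"
      and max: "\<And>C' d'. C' \<in> z_classes G \<Longrightarrow> manifold_of_dim d' (top_of_set C') \<Longrightarrow> d' \<le> d"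
      unfolding generic_z_classes_def by blast
    \<comment> \<open>The identity is a limit of regular isometries, so there is one. Its class has
      dimension \<open>N\<close>, hence so has the given class of maximal dimension.\<close>
    obtain R where R: "R \<in> G" "regular R" using G_regular_limit[OF G_1] unfolding regular_limit_def by (meson zero_less_one)
    have "N \<le> d" using max reg[OF R] by blast
    then have "d = N" using le C by (simp add: le_antisym)
    then have "openin (top_of_set G) C"
      using submanifold_dim(2)[OF man, of C d] clsG(1)[OF C(1)] sub C(2) by simp
    then obtain U where U: "open U" "C = G \<inter> U" by (auto simp: openin_open)
    obtain S where S: "S \<in> C" using clsG(2)[OF C(1)] by blast
    then obtain e where e: "e > 0" "ball S e \<subseteq> U" using U openE by blast
    obtain T where T: "T \<in> G" "regular T" "norm (T - S) < e"
      using G_regular_limit[of S] S U e(1) unfolding regular_limit_def by blast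
    then have "T \<in> ball S e" by (simp add: dist_norm norm_minus_commute)
    then have TC: "T \<in> C" using U T(1) e(2) by blast
    obtain S0 where "S0 \<in> G" "C = z_equivalence G `` {S0}" using cls[OF C(1)] by (auto simp: z_class_def)
    then have "z_class G T = C"
      using TC equiv_class_eq[OF equiv_z, of S0 T] by (simp add: z_class_def)
    then show "C \<in> z_class G ` {T \<in> G. regular T}" using T by blast
  }
qed

end

section \<open>Quadratic forms of Lorentzian signature\<close>

lemma bilinear_matrix:
  fixes b :: "real^'n \<Rightarrow> real^'n \<Rightarrow> real"
  assumes b: "bilinear b" and sym: "\<And>x y. b x y = b y x"
  obtains J :: "real^'n^'n" where "transpose J = J" "\<And>x y. x \<bullet> (J *v y) = b x y"
proof -
  define g where "g y = adjoint (\<lambda>x. b x y) 1" for y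
  have g: "x \<bullet> g y = b x y" for x y
  proof -
    have "linear (\<lambda>x. b x y)" using b by (simp add: bilinear_def)
    from adjoint_works[OF this, of x 1] show ?thesis by (simp add: g_def)
  qed
  have "linear g"
  proof (rule linearI)
    show "g (y + z) = g y + g z" for y z
      by (subst vector_eq_ldot[symmetric]) (simp add: g inner_add_right bilinear_radd[OF b])
    show "g (c *\<^sub>R y) = c *\<^sub>R g y" for c y
      by (subst vector_eq_ldot[symmetric]) (simp add: g bilinear_rmul[OF b])
  qed
  define J where "J = matrix g"
  have J: "x \<bullet> (J *v y) = b x y" for x y using \<open>linear g\<close> by (simp add: J_def matrix_works g)
  have "x \<bullet> (transpose J *v y) = x \<bullet> (J *v y)" for x y
    by (metis J sym dot_lmul_matrix inner_commute transpose_matrix_vector)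
  then have "transpose J *v y = J *v y" for y by (metis vector_eq_ldot)
  then have "transpose J = J" by (simp add: matrix_eq)
  then show thesis using that J by blast
qed

section \<open>The sheet as a component of the hyperboloid\<close>

context lorentz
begin

text \<open>The sheet is a graph over the hyperplane orthogonal to \<open>e0\<close>.\<close>

lemma connected_H: "connected H"
proof -
  let ?f = "\<lambda>y. sqrt (1 - B y y) *\<^sub>R e0 + y"
  have "H = ?f ` {y. B e0 y = 0}"
  proof (intro equalityI subsetI)
    fix x assume x: "x \<in> H"
    define y where "y = x - B e0 x *\<^sub>R e0"
    have y: "B e0 y = 0" by (simp add: y_def)
    have "1 - B y y = (B e0 x)\<^sup>2"
      using x by (simp add: y_def H_def B_sym[of x e0] power2_eq_square)
    then have "sqrt (1 - B y y) = B e0 x" using x by (simp add: H_def)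
    then have "x = ?f y" by (simp add: y_def)
    then show "x \<in> ?f ` {y. B e0 y = 0}" using y by blast
  next
    fix x assume "x \<in> ?f ` {y. B e0 y = 0}"
    then obtain y where y: "B e0 y = 0" "x = ?f y" by blast
    have "1 - B y y > 0" using B_nonpos[OF y(1)] by simp
    then show "x \<in> H" using y by (simp add: H_def B_sym[of y e0])
  qed
  moreover have "convex {y. B e0 y = 0}" by (auto simp: convex_def)
  moreover have "continuous_on {y. B e0 y = 0} ?f" by (intro continuous_intros)
  ultimately show ?thesis by (simp only: connected_continuous_image convex_connected)
qed

text \<open>\<open>B e0\<close> has no zero on the hyperboloid, so it keeps its sign on a connected
  part of it.\<close>

lemma component_eq_H:
  assumes K: "K \<in> components {v. B v v = 1}" and x: "x \<in> K" "B e0 x > 0"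
  shows "K = H"
proof
  have KS: "K \<subseteq> {v. B v v = 1}" "connected K" using in_components_subset[OF K] in_components_connected[OF K] .
  have "x \<in> H" using KS(1) x by (auto simp: H_def)
  then show "H \<subseteq> K"
    using components_maximal[OF K connected_H] x(1) by (auto simp: H_def)
  show "K \<subseteq> H"
  proof
    fix y assume y: "y \<in> K"
    have "B e0 y > 0"
    proof (rule ccontr)
      assume "\<not> B e0 y > 0"
      then have "B e0 y \<le> 0" "0 \<le> B e0 x" using x(2) by auto
      moreover have "continuous_on K (B e0)" by (intro continuous_intros)
      then have "connected (B e0 ` K)" using KS(2) connected_continuous_image by blast
      ultimately have "0 \<in> B e0 ` K" using x(1) y connected_contains_Icc[of "B e0 ` K" "B e0 y" "B e0 x"] by auto
      then obtain z where "z \<in> K" "B e0 z = 0" by auto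
      then show False using timelike_B_ne_0[of z] KS(1) by auto
    qed
    then show "y \<in> H" using KS(1) y by (auto simp: H_def)
  qed
qed

lemma isometries_eq_G:
  assumes "\<And>v. Q v = B v v"
  shows "isometries Q H = G"
proof -
  have "orthogonal_group Q = OB"
    unfolding orthogonal_group_def assms using OB_iff OB_D(3) by blast
  then show ?thesis by (simp add: isometries_def G_def)
qed

end

lemma lorentz_basisI:
  fixes J :: "real^'n^'n" and e :: "nat \<Rightarrow> real^'n"
  assumes sym: "transpose J = J"
    and orth: "\<And>i j. i < CARD('n) \<Longrightarrow> j < CARD('n) \<Longrightarrow>
      e i \<bullet> (J *v e j) = (if i = j then if i = 0 then 1 else - 1 else 0)"
    and span: "span (e ` {..<CARD('n)}) = UNIV"
  shows "lorentz_basis J e"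
proof -
  let ?N = "CARD('n)"
  have N: "0 < ?N" by simp
  have inj: "inj_on e {..<?N}"
  proof (rule inj_onI, rule ccontr)
    fix i j assume ij: "i \<in> {..<?N}" "j \<in> {..<?N}" "e i = e j" "i \<noteq> j"
    then have "e i \<bullet> (J *v e i) = e i \<bullet> (J *v e j)" by simp
    then show False using orth[of i i] orth[of i j] ij by (auto split: if_splits)
  qed
  have neg: "y \<bullet> (J *v y) < 0" if y: "e 0 \<bullet> (J *v y) = 0" "y \<noteq> 0" for y
  proof -
    have "y \<in> span (e ` {..<?N})" using span by simp
    then obtain u where "y = (\<Sum>v\<in>e ` {..<?N}. u v *\<^sub>R v)" by (auto simp: span_finite)
    then have yc: "y = (\<Sum>i<?N. u (e i) *\<^sub>R e i)" using inj by (simp add: sum.reindex)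
    have ey: "e j \<bullet> (J *v y) = (if j = 0 then u (e j) else - u (e j))" if j: "j < ?N" for j
    proof -
      have "J *v y = (\<Sum>i<?N. u (e i) *\<^sub>R (J *v e i))"
        by (subst yc) (simp add: linear_sum[OF matrix_vector_mul_linear] mv.scaleR_right)
      then have "e j \<bullet> (J *v y) = (\<Sum>i<?N. u (e i) * (e j \<bullet> (J *v e i)))"
        by (simp add: inner_sum_right)
      also have "\<dots> = (\<Sum>i<?N. if i = j then (if j = 0 then u (e j) else - u (e j)) else 0)"
        using j by (intro sum.cong) (auto simp: orth)
      finally show ?thesis using j by simp
    qed
    have u0: "u (e 0) = 0" using ey[OF N] y(1) by simp
    have "y \<bullet> (J *v y) = (\<Sum>i<?N. u (e i) * (e i \<bullet> (J *v y)))"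
      by (subst (1) yc) (simp add: inner_sum_left)
    also have "\<dots> = (\<Sum>i<?N. - (u (e i))\<^sup>2)"
      using u0 by (intro sum.cong) (auto simp: ey power2_eq_square)
    finally have q: "y \<bullet> (J *v y) = - (\<Sum>i<?N. (u (e i))\<^sup>2)" by (simp add: sum_negf)
    have "(\<Sum>i<?N. (u (e i))\<^sup>2) \<noteq> 0"
    proof
      assume "(\<Sum>i<?N. (u (e i))\<^sup>2) = 0"
      then have "\<forall>i\<in>{..<?N}. (u (e i))\<^sup>2 = 0" by (subst (asm) sum_nonneg_eq_0_iff) auto
      then have "y = 0" by (subst yc) simp
      then show False using y(2) by simp
    qed
    moreover have "(\<Sum>i<?N. (u (e i))\<^sup>2) \<ge> 0" by (intro sum_nonneg) simp
    ultimately show ?thesis using q by linarith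
  qed
  interpret lorentz J "e 0"
    by unfold_locales (use sym orth[OF N N] neg in auto)
  show ?thesis
    by unfold_locales (use orth span in \<open>auto simp: B_def\<close>)
qed

lemma lorentz_basis_exists:
  fixes Q :: "real^'n \<Rightarrow> real" and K :: "(real^'n) set"
  assumes n: "CARD('n) = n + 1" and "quadratic_form Q" and "has_signature Q 1 n"
    and K: "K \<in> components {v. Q v = 1}"
  obtains J :: "real^'n^'n" and e where "lorentz_basis J e" "\<And>v. Q v = lorentz.B J v v" "K = lorentz.H J (e 0)"
proof -
  obtain b where b: "bilinear b" "\<And>x y. b x y = b y x" "\<And>v. Q v = b v v"
    using assms(2) unfolding quadratic_form_def by blast
  obtain J :: "real^'n^'n" where J: "transpose J = J" "\<And>x y. x \<bullet> (J *v y) = b x y"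
    by (rule bilinear_matrix[OF b(1,2)]) blast
  have polar: "polar_form Q x y = b x y" for x y
    by (simp add: polar_form_def b(3) bilinear_ladd[OF b(1)] bilinear_radd[OF b(1)] b(2)[of y x])
  obtain E where E: "independent E" "span E = UNIV" "pairwise (\<lambda>u v. polar_form Q u v = 0) E"
    "card {v \<in> E. Q v > 0} = 1" "card {v \<in> E. Q v < 0} = n"
    using assms(3) unfolding has_signature_def by blast
  have orth: "b u v = 0" if "u \<in> E" "v \<in> E" "u \<noteq> v" for u v
    using E(3) that polar unfolding pairwise_def by metis
  have fin: "finite E" using E(1) by (rule independent_imp_finite)
  have cE: "card E = n + 1" using E(1,2) n dim_eq_card[of E UNIV] dim_span[of E] by (simp add: dim_UNIV)
  obtain p where p: "{v \<in> E. Q v > 0} = {p}" using E(4) card_1_singletonE by blast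
  let ?M = "{v \<in> E. Q v < 0}"
  have pM: "p \<in> E" "Q p > 0" "p \<notin> ?M" using p by auto
  \<comment> \<open>One positive and \<open>n\<close> negative vectors exhaust a basis of
    \<open>n + 1\<close> vectors, so no basis vector is isotropic.\<close>
  have EM: "E = insert p ?M"
  proof (rule card_seteq[symmetric, OF fin])
    show "insert p ?M \<subseteq> E" using pM by blast
    show "card E \<le> card (insert p ?M)" using cE pM(3) fin E(5) by simp
  qed
  obtain f where f: "bij_betw f {0..<n} ?M"
    using ex_bij_betw_nat_finite[of ?M] fin E(5) by auto
  have K0: "K \<noteq> {}" "K \<subseteq> {v. Q v = 1}" using in_components_nonempty[OF K] in_components_subset[OF K] by auto
  then obtain x where x: "x \<in> K" "Q x = 1" by blast
  \<comment> \<open>The sign is chosen so that \<open>e 0\<close> points to the given component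
    \<open>K\<close>.\<close>
  define \<sigma> :: real where "\<sigma> = (if b p x > 0 then 1 else - 1)"
  define r where "r i = (if i = 0 then \<sigma> / sqrt (Q p) else 1 / sqrt (- Q (f (i - 1))))" for i
  define w where "w i = (if i = 0 then p else f (i - 1))" for i
  define e where "e i = r i *\<^sub>R w i" for i
  have fM: "f (k - 1) \<in> ?M" if "k < CARD('n)" "k \<noteq> 0" for k
    using f n that by (auto simp: bij_betw_def)
  have wE: "w i \<in> E" "r i \<noteq> 0" "r i * r i * Q (w i) = (if i = 0 then 1 else - 1)" if i: "i < CARD('n)" for i
  proof -
    show "w i \<in> E" using pM fM[OF i] by (simp add: w_def)
    show "r i \<noteq> 0" using pM fM[OF i] by (cases "i = 0") (simp_all add: r_def \<sigma>_def)
    show "r i * r i * Q (w i) = (if i = 0 then 1 else - 1)"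
      using pM fM[OF i] by (cases "i = 0") (simp_all add: w_def r_def \<sigma>_def)
  qed
  have w_inj: "w i \<noteq> w j" if ij: "i < CARD('n)" "j < CARD('n)" "i \<noteq> j" for i j
  proof -
    have "f (i - 1) \<noteq> f (j - 1)" if ij0: "i \<noteq> 0" "j \<noteq> 0"
    proof
      have "i - 1 < n" "j - 1 < n" using ij n ij0 by linarith+
      moreover assume "f (i - 1) = f (j - 1)"
      ultimately have "i - 1 = j - 1" using f by (auto simp: bij_betw_def dest: inj_onD)
      then show False using ij(3) ij0 by linarith
    qed
    then show ?thesis using fM[of i] fM[of j] ij pM(3) by (auto simp: w_def)
  qed
  have e_orth: "e i \<bullet> (J *v e j) = (if i = j then if i = 0 then 1 else - 1 else 0)"
    if ij: "i < CARD('n)" "j < CARD('n)" for i j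
  proof -
    have "e i \<bullet> (J *v e j) = r i * r j * b (w i) (w j)"
      by (simp add: e_def J(2) bilinear_lmul[OF b(1)] bilinear_rmul[OF b(1)])
    then show ?thesis
      using wE[OF ij(1)] wE[OF ij(2)] w_inj[OF ij] orth[of "w i" "w j"] by (cases "i = j") (auto simp: b(3))
  qed
  have "E \<subseteq> span (e ` {..<CARD('n)})"
  proof
    fix v assume "v \<in> E"
    have "\<exists>i<CARD('n). v = w i"
    proof (cases "v = p")
      case True
      then show ?thesis by (intro exI[of _ 0]) (simp add: w_def)
    next
      case False
      then have "v \<in> f ` {0..<n}" using \<open>v \<in> E\<close> EM f by (auto simp: bij_betw_def)
      then obtain k where "k < n" "v = f k" by auto
      then show ?thesis using n by (intro exI[of _ "Suc k"]) (simp add: w_def)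
    qed
    then obtain i where i: "i < CARD('n)" "v = w i" by blast
    then have v: "v = (1 / r i) *\<^sub>R e i" using wE(2) by (simp add: e_def)
    show "v \<in> span (e ` {..<CARD('n)})" unfolding v by (intro span_mul span_base) (use i(1) in simp)
  qed
  then have "span (e ` {..<CARD('n)}) = UNIV"
    using E(2) span_minimal[OF _ subspace_span] by blast
  then have L: "lorentz_basis J e" by (intro lorentz_basisI J(1) e_orth)
  then interpret lorentz_basis J e .
  have QB: "Q v = B v v" for v by (simp add: b(3) J(2) B_def)
  have "B (e 0) x \<noteq> 0" using timelike_B_ne_0[of x] x(2) QB by simp
  moreover have "B (e 0) x = r 0 * b p x" by (simp add: B_def J(2) e_def w_def bilinear_lmul[OF b(1)])
  ultimately have "B (e 0) x > 0" using pM(2)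
    by (auto simp: r_def \<sigma>_def zero_less_mult_iff divide_neg_pos not_less order.order_iff_strict split: if_splits)
  moreover have "K \<in> components {v. B v v = 1}" using K QB by simp
  ultimately have "K = H" using component_eq_H x(1) by blast
  then show thesis using that[OF L] QB by blast
qed

theorem theorem1p4:
  fixes Q :: "real ^ 'n \<Rightarrow> real" and H :: "(real ^ 'n) set" and n :: nat
  assumes "CARD('n) = n + 1"
    and "quadratic_form Q"
    and "has_signature Q 1 n"
    and "H \<in> components {v. Q v = 1}"
  shows "(\<forall>n'. n = 2 * n' \<longrightarrow>
            generic_z_classes (isometries Q H) =
              z_class (isometries Q H) `
                {T. (rotatory_elliptic Q H (int n') T \<or>
                     rotatory_hyperbolic Q H (int n' - 1) T \<or>
                     rotatory_hyperbolic_inversion Q H (int n' - 1) T) \<and>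
                    distinct_rotation_angles T})
       \<and> (\<forall>n'. n = 2 * n' + 1 \<longrightarrow>
            generic_z_classes (isometries Q H) =
              z_class (isometries Q H) `
                {T. (rotatory_hyperbolic Q H (int n') T \<or>
                     rotatory_elliptic_inversion Q H (int n') T \<or>
                     rotatory_hyperbolic_inversion Q H (int n' - 1) T) \<and>
                    distinct_rotation_angles T})"
proof -
  obtain J :: "real^'n^'n" and e where L: "lorentz_basis J e" and Q: "\<And>v. Q v = lorentz.B J v v"
    and H: "H = lorentz.H J (e 0)"
    by (rule lorentz_basis_exists[OF assms]) blast
  interpret L: lorentz_basis J e by (rule L)
  have iso: "isometries Q H = L.G" unfolding H by (rule L.isometries_eq_G[OF Q])
  show ?thesis
  proof (intro conjI allI impI)
    fix n' assume "n = 2 * n'"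
    then show "generic_z_classes (isometries Q H) = z_class (isometries Q H) `
                {T. (rotatory_elliptic Q H (int n') T \<or>
                     rotatory_hyperbolic Q H (int n' - 1) T \<or>
                     rotatory_hyperbolic_inversion Q H (int n' - 1) T) \<and>
                    distinct_rotation_angles T}"
      using L.rotatory_even_iff[OF Q iso, of n'] assms(1)
      by (simp add: iso L.generic_z_classes_eq)
  next
    fix n' assume "n = 2 * n' + 1"
    then show "generic_z_classes (isometries Q H) = z_class (isometries Q H) `
                {T. (rotatory_hyperbolic Q H (int n') T \<or>
                     rotatory_elliptic_inversion Q H (int n') T \<or>
                     rotatory_hyperbolic_inversion Q H (int n' - 1) T) \<and>
                    distinct_rotation_angles T}"
      using L.rotatory_odd_iff[OF Q iso, of n'] assms(1)
      by (simp add: iso L.generic_z_classes_eq)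
  qed
qed

end
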